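(* Let $0<a<b<\infty$ and assign to the edges of the $\mathbb{Z}^2$ nearest-neighbour lattice independent weights, each uniformly distributed on $\{a,b\}$. Let $\alpha<1/10$ and let $(k_n)$ be positive integers with $k_n/n^\alpha\to0$. Then for any sequence $(x_n)$ with $x_n\to\infty$ and $x_n/n^{(1-10\alpha)/18}\to0$, $$\mathbb{P}\Big(t(n,k_n)-\mathbb{E}[t(n,k_n)]<-x_n\sqrt{\mathrm{Var}(t(n,k_n))}\Big)=\big[1-\Phi(x_n)\big]\Big[1+o\Big(\frac{x_n^3}{n^{(1-10\alpha)/6}}\Big)\Big],$$ and likewise $$\mathbb{P}\Big(t(n,k_n)-\mathbb{E}[t(n,k_n)]>x_n\sqrt{\mathrm{Var}(t(n,k_n))}\Big)=\big[1-\Phi(x_n)\big]\Big[1+o\Big(\frac{x_n^3}{n^{(1-10\alpha)/6}}\Big)\Big].$$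
   Context: For a path $\Gamma$, $T(\Gamma):=\sum_{e\in\Gamma}\omega_e$. $t(n,k)$ denotes the left-right crossing time of the rectangle $[0,n]\times[0,k-1]$: the infimum of $T(\Gamma)$ over nearest-neighbour paths $\Gamma$ contained in $[0,n]\times[0,k-1]$ connecting $\{0\}\times[0,k-1]$ to $\{n\}\times[0,k-1]$. $\Phi$ is the standard Gaussian distribution function. *)

theory Defs
  imports "HOL-Probability.Probability" "HOL-Library.Landau_Symbols"
begin

type_synonym vertex = "int \<times> int"

text \<open>Edges of the Z^2 nearest-neighbour lattice: (v, True) is the horizontal edge
  from v to v + (1,0); (v, False) is the vertical edge from v to v + (0,1).\<close>
type_synonym edge = "vertex \<times> bool"

definition adj :: "vertex \<Rightarrow> vertex \<Rightarrow> bool" where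
  "adj u v \<longleftrightarrow> \<bar>fst u - fst v\<bar> + \<bar>snd u - snd v\<bar> = 1"

definition lat_edge :: "vertex \<Rightarrow> vertex \<Rightarrow> edge" where
  "lat_edge u v = (if snd u = snd v then ((min (fst u) (fst v), snd u), True)
                  else ((fst u, min (snd u) (snd v)), False))"

definition passage_time :: "(edge \<Rightarrow> real) \<Rightarrow> vertex list \<Rightarrow> real" where
  "passage_time \<omega> p = sum_list (map (\<lambda>(u, v). \<omega> (lat_edge u v)) (zip p (tl p)))"

definition crossing_paths :: "nat \<Rightarrow> nat \<Rightarrow> vertex list set" where
  "crossing_paths n k = {p. p \<noteq> [] \<and>
      (\<forall>i. Suc i < length p \<longrightarrow> adj (p ! i) (p ! Suc i)) \<and>
      (\<forall>v\<in>set p. 0 \<le> fst v \<and> fst v \<le> int n \<and> 0 \<le> snd v \<and> snd v \<le> int k - 1) \<and>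
      fst (hd p) = 0 \<and> fst (last p) = int n}"

definition crossing_time :: "nat \<Rightarrow> nat \<Rightarrow> (edge \<Rightarrow> real) \<Rightarrow> real" where
  "crossing_time n k \<omega> = Inf (passage_time \<omega> ` crossing_paths n k)"

definition weight_space :: "real \<Rightarrow> real \<Rightarrow> (edge \<Rightarrow> real) measure" where
  "weight_space a b = PiM UNIV (\<lambda>_. measure_pmf (pmf_of_set {a, b}))"

definition Phi :: "real \<Rightarrow> real" where
  "Phi x = measure (density lborel std_normal_density) {..x}"

end

theory Submission
  imports Defs "HOL-Real_Asymp.Real_Asymp"
begin

text \<open>
  Cut the rectangle into about \<open>n powr (1/3)\<close> blocks. The crossing time differs from the sum of the
  independent crossing times of the blocks by at most a constant times the number of cuts times the
  height. The block times have bounded differences, hence sub-Gaussian tails, so that they can be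
  clamped near their means; a tail version of Stein's method, which needs nothing but the moment
  generating function of the sum and the monotonicity of \<open>w f w\<close> for the solution \<open>f\<close> of
  Stein's equation, then compares the tail of the clamped sum with \<open>1 - Phi\<close>.

  This requires the lower bound \<open>c n / k\<close> for the variance. By Cauchy-Schwarz it suffices that the
  influences of the edges add up to at least a multiple of \<open>n\<close>. Divide the rectangle into strips of
  constant width \<open>L\<close>. After its last visit to the left side of a strip, the geodesic either can be
  shortened by lowering the weights in a box of bounded size, or its next \<open>L\<close> edges all have
  weight
  \<open>a\<close> and form an oriented path. Two-step oriented paths grow subcritically, by the factor
  \<open>15/16\<close>, so for large \<open>L\<close> a first-moment bound over all sequences of heights with the total
  variation allowed by the length of the geodesic rules out that most strips are of the second kind.
\<close>

text \<open>All errors are measured against the standard deviation, at least of order sqrt (n / k).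
  With m blocks, cutting costs m k, a relative error m k^(3/2) n^(-1/2). A block fluctuates by at
  most order sqrt (k n / m), a relative error k m^(-1/2), with an extra n^(\<alpha>/2) because large
  block deviations must stay negligible after a union bound. For k near n^\<alpha> both balance at m
  = n^(1/3) and give n^(-1/6 + 3 \<alpha>/2), smaller than the permitted n^(-(1 - 10 \<alpha>)/6) by
  the factor n^(-\<alpha>/6), which turns O into o. The probabilistic obstacle is that the error
  must be relative to \<open>1 - Phi x\<close>, which is itself tiny: an absolute bound of
  Berry-Esseen type is useless, and every estimate has to carry the factor \<open>1 - Phi x\<close>.
  The geometric obstacle is that a geodesic may run along cheap edges, where lowering weights gains
  nothing. A shortcut then exists unless the cheap segment is already as short as the lattice
  distance of its ends, and such a segment is an oriented path.\<close>

section \<open>Uniformly random edge sets\<close>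

text \<open>A configuration is encoded by the set \<open>S\<close> of those edges whose weight is \<open>b\<close>; the
  expectation of a quantity that depends on finitely many edges \<open>A\<close> is then an average over
  all \<open>S \<subseteq> A\<close>.\<close>
definition avg :: "'e set \<Rightarrow> ('e set \<Rightarrow> real) \<Rightarrow> real" where
  "avg A f = (\<Sum>S\<in>Pow A. f S) / 2 ^ card A"

definition depends_on :: "'e set \<Rightarrow> ('e set \<Rightarrow> 'b) \<Rightarrow> bool" where
  "depends_on B f \<longleftrightarrow> (\<forall>S. f S = f (S \<inter> B))"

lemma avg_empty [simp]: "avg {} f = f {}"
  by (simp add: avg_def)

lemma avg_insert:
  assumes "finite A" "e \<notin> A"
  shows "avg (insert e A) f = (avg A f + avg A (\<lambda>S. f (insert e S))) / 2"
proof -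
  have "(\<Sum>S\<in>Pow (insert e A). f S) = (\<Sum>S\<in>Pow A. f S) + (\<Sum>S\<in>insert e ` Pow A. f S)"
    unfolding Pow_insert using assms by (intro sum.union_disjoint) auto
  also have "(\<Sum>S\<in>insert e ` Pow A. f S) = (\<Sum>S\<in>Pow A. f (insert e S))"
    using assms by (subst sum.reindex) (auto intro!: inj_onI)
  finally show ?thesis
    using assms by (simp add: avg_def field_simps)
qed

lemma avg_cong: "(\<And>S. S \<subseteq> A \<Longrightarrow> f S = g S) \<Longrightarrow> avg A f = avg A g"
  by (simp add: avg_def)

lemma avg_mono: "(\<And>S. S \<subseteq> A \<Longrightarrow> f S \<le> g S) \<Longrightarrow> avg A f \<le> avg A g"
  by (auto simp: avg_def intro!: divide_right_mono sum_mono)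

lemma avg_add: "avg A (\<lambda>S. f S + g S) = avg A f + avg A g"
  by (simp add: avg_def sum.distrib add_divide_distrib)

lemma avg_diff: "avg A (\<lambda>S. f S - g S) = avg A f - avg A g"
  by (simp add: avg_def sum_subtractf diff_divide_distrib)

lemma avg_cmult: "avg A (\<lambda>S. c * f S) = c * avg A f"
  by (simp add: avg_def sum_distrib_left)

lemma avg_multc: "avg A (\<lambda>S. f S * c) = avg A f * c"
  using avg_cmult[of A c f] by (simp add: mult.commute)

lemma avg_divide: "avg A (\<lambda>S. f S / c) = avg A f / c"
  using avg_multc[of A f "1 / c"] by simp

lemma avg_const [simp]: "finite A \<Longrightarrow> avg A (\<lambda>S. c) = c"
  by (simp add: avg_def card_Pow)

lemma avg_sum: "avg A (\<lambda>S. \<Sum>i\<in>I. f i S) = (\<Sum>i\<in>I. avg A (f i))"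
  by (induction I rule: infinite_finite_induct) (auto simp: avg_add avg_def)

lemma avg_nonneg: "(\<And>S. S \<subseteq> A \<Longrightarrow> 0 \<le> f S) \<Longrightarrow> 0 \<le> avg A f"
  by (auto simp: avg_def intro!: divide_nonneg_nonneg sum_nonneg)

lemma avg_abs_le: "\<bar>avg A f\<bar> \<le> avg A (\<lambda>S. \<bar>f S\<bar>)"
  by (auto simp: avg_def intro!: divide_right_mono sum_abs)

lemma avg_le_const:
  assumes "finite A" "\<And>S. S \<subseteq> A \<Longrightarrow> f S \<le> c"
  shows "avg A f \<le> c"
  using avg_mono[of A f "\<lambda>_. c"] assms by simp

lemma avg_ge_const:
  assumes "finite A" "\<And>S. S \<subseteq> A \<Longrightarrow> c \<le> f S"
  shows "c \<le> avg A f"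
  using avg_mono[of A "\<lambda>_. c" f] assms by simp

lemma avg_Cauchy_Schwarz:
  "(avg A (\<lambda>S. f S * g S))\<^sup>2 \<le> avg A (\<lambda>S. (f S)\<^sup>2) * avg A (\<lambda>S. (g S)\<^sup>2)"
proof -
  have "(\<Sum>S\<in>Pow A. f S * g S)\<^sup>2 \<le> (\<Sum>S\<in>Pow A. (f S)\<^sup>2) * (\<Sum>S\<in>Pow A. (g S)\<^sup>2)"
    by (rule Cauchy_Schwarz_ineq_sum)
  then show ?thesis
    by (auto simp: avg_def power_divide power2_eq_square[of "2 ^ card A"] intro!: divide_right_mono)
qed

lemma avg_power2_le:
  assumes "finite A"
  shows "(avg A f)\<^sup>2 \<le> avg A (\<lambda>S. (f S)\<^sup>2)"
  using avg_Cauchy_Schwarz[of A f "\<lambda>_. 1"] assms by simp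

section \<open>Functions of disjoint edge sets are independent\<close>

lemma depends_on_comp: "depends_on B f \<Longrightarrow> depends_on B (\<lambda>S. h (f S))"
  by (simp add: depends_on_def)

lemma depends_on_comp2:
  assumes "depends_on B f" "depends_on B g"
  shows "depends_on B (\<lambda>S. h (f S) (g S))"
  unfolding depends_on_def
proof
  fix S
  show "h (f S) (g S) = h (f (S \<inter> B)) (g (S \<inter> B))"
    using assms unfolding depends_on_def by metis
qed

lemma depends_on_mono:
  assumes "depends_on B f" "B \<subseteq> C"
  shows "depends_on C f"
  unfolding depends_on_def
proof
  fix S
  have "S \<inter> C \<inter> B = S \<inter> B"
    using assms by auto
  then show "f S = f (S \<inter> C)"
    using assms(1) unfolding depends_on_def by metis
qed

lemma depends_on_insert_iff:
  assumes "depends_on B f" "e \<notin> B"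
  shows "f (insert e S) = f S"
  using assms unfolding depends_on_def by (metis Int_insert_left)

lemma depends_on_sum:
  assumes "\<And>i. i \<in> I \<Longrightarrow> depends_on B (f i)"
  shows "depends_on B (\<lambda>S. \<Sum>i\<in>I. f i S)"
  unfolding depends_on_def
proof
  fix S
  show "(\<Sum>i\<in>I. f i S) = (\<Sum>i\<in>I. f i (S \<inter> B))"
    using assms unfolding depends_on_def by (metis (no_types, lifting) sum.cong)
qed

text \<open>Peeling off one edge \<open>e\<close> at a time: \<open>e\<close> misses
  \<open>B\<close> or \<open>C\<close>, so one factor ignores it and can be taken out of the
  two-point average over \<open>e\<close>.\<close>

lemma avg_mult_indep:
  assumes "finite A" "depends_on B f" "depends_on C g" "B \<inter> C = {}"
  shows "avg A (\<lambda>S. f S * g S) = avg A f * avg A g"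
  using assms(1) assms(2-)
proof (induction A arbitrary: f g rule: finite_induct)
  case (insert e A)
  have dep_insert: "depends_on D (\<lambda>S. h (insert e S))"
    if "depends_on D h" for h :: "'a set \<Rightarrow> real" and D
    unfolding depends_on_def
  proof
    fix S
    have "insert e S \<inter> D = insert e (S \<inter> D) \<inter> D"
      by auto
    then show "h (insert e S) = h (insert e (S \<inter> D))"
      using that unfolding depends_on_def by metis
  qed
  note IH = insert.IH[OF _ _ insert.prems(3)]
  show ?case
  proof (cases "e \<in> B")
    case True
    then have "e \<notin> C"
      using insert.prems by auto
    then have g: "g (insert e S) = g S" for S
      using depends_on_insert_iff insert.prems(2) by metis
    have "avg A (\<lambda>S. f (insert e S) * g S) = avg A (\<lambda>S. f (insert e S)) * avg A g"
      by (intro IH dep_insert insert.prems)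
    moreover have "avg A (\<lambda>S. f S * g S) = avg A f * avg A g"
      by (intro IH insert.prems)
    ultimately show ?thesis
      using insert.hyps by (simp add: avg_insert g distrib_right add_divide_distrib)
  next
    case False
    then have f: "f (insert e S) = f S" for S
      using depends_on_insert_iff insert.prems(1) by metis
    have "avg A (\<lambda>S. f S * g (insert e S)) = avg A f * avg A (\<lambda>S. g (insert e S))"
      by (intro IH dep_insert insert.prems)
    moreover have "avg A (\<lambda>S. f S * g S) = avg A f * avg A g"
      by (intro IH insert.prems)
    ultimately show ?thesis
      using insert.hyps by (simp add: avg_insert f distrib_left add_divide_distrib)
  qed
qed simp

lemma avg_exp_sum_indep:
  fixes f :: "'i \<Rightarrow> 'e set \<Rightarrow> real"
  assumes "finite A" "finite I" "\<And>i. i \<in> I \<Longrightarrow> depends_on (F i) (f i)" "disjoint_family_on F I"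
  shows "avg A (\<lambda>S. exp (\<Sum>i\<in>I. f i S)) = (\<Prod>i\<in>I. avg A (\<lambda>S. exp (f i S)))"
  using assms(2-)
proof (induction I rule: finite_induct)
  case (insert i I)
  have "avg A (\<lambda>S. exp (f i S) * exp (\<Sum>i\<in>I. f i S)) =
      avg A (\<lambda>S. exp (f i S)) * avg A (\<lambda>S. exp (\<Sum>i\<in>I. f i S))"
  proof (rule avg_mult_indep)
    show "depends_on (F i) (\<lambda>S. exp (f i S))"
      by (rule depends_on_comp) (use insert.prems in auto)
    show "depends_on (\<Union>j\<in>I. F j) (\<lambda>S. exp (\<Sum>j\<in>I. f j S))"
      by (rule depends_on_comp, rule depends_on_sum, rule depends_on_mono[OF insert.prems(1)]) auto
    show "F i \<inter> (\<Union>j\<in>I. F j) = {}"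
      using insert.prems(2) insert.hyps(2) by (fastforce simp: disjoint_family_on_def)
  qed (rule assms(1))
  moreover have "disjoint_family_on F I"
    using insert.prems(2) by (auto simp: disjoint_family_on_def)
  ultimately show ?case
    using insert by (simp add: exp_add)
qed (use assms(1) in simp)

lemma avg_split:
  assumes "finite A" "e \<in> A"
  shows "avg A f = (avg A (\<lambda>S. f (S - {e})) + avg A (\<lambda>S. f (insert e S))) / 2"
proof -
  define B where "B = A - {e}"
  have A: "A = insert e B" "finite B" "e \<notin> B"
    using assms by (auto simp: B_def)
  have "S - {e} = S" if "S \<subseteq> B" for S
    using that A by auto
  then have 1: "avg B (\<lambda>S. f (S - {e})) = avg B f"
    by (intro avg_cong) auto
  then have 2: "avg B (\<lambda>S. f (insert e S - {e})) = avg B f"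
    by simp
  show ?thesis
    unfolding A(1) avg_insert[OF A(2,3)] 1 2 by simp
qed

section \<open>Concentration by bounded differences\<close>

lemma cosh_le_exp_square: "cosh x \<le> exp (x\<^sup>2 / 2)" for x :: real
proof -
  have 1: "(\<lambda>n. if even n then x ^ n /\<^sub>R fact n else 0) sums cosh x"
    by (rule cosh_converges)
  have c: "(\<lambda>n. x ^ (2 * n) /\<^sub>R fact (2 * n)) sums cosh x"
  proof -
    have "(\<lambda>n. if even (2 * n) then x ^ (2 * n) /\<^sub>R fact (2 * n) else 0) sums cosh x"
    proof (subst sums_mono_reindex[of "\<lambda>n. 2 * n"])
      show "strict_mono (\<lambda>n::nat. 2 * n)"
        by (simp add: strict_mono_def)
      show "(if even n then x ^ n /\<^sub>R fact n else 0) = 0" if "n \<notin> range (\<lambda>n. 2 * n)" for n :: nat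
        using that by (auto elim!: evenE)
    qed (rule 1)
    then show ?thesis by simp
  qed
  have e: "(\<lambda>n. (x\<^sup>2 / 2) ^ n /\<^sub>R fact n) sums exp (x\<^sup>2 / 2)"
    by (rule exp_converges)
  \<comment> \<open>The two power series are compared term by term.\<close>
  have fact_le: "2 ^ n * fact n \<le> (fact (2 * n) :: real)" for n
  proof (induction n)
    case (Suc n)
    have "2 ^ Suc n * fact (Suc n) = (2 * real (Suc n)) * (2 ^ n * fact n)"
      by simp
    also have "\<dots> \<le> (2 * real (Suc n)) * fact (2 * n)"
      using Suc by (intro mult_left_mono) auto
    also have "\<dots> \<le> (2 * real (Suc n)) * ((2 * real n + 1) * fact (2 * n))"
      by (intro mult_left_mono) (auto simp: algebra_simps)
    also have "\<dots> = fact (2 * Suc n)"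
      by (simp add: algebra_simps)
    finally show ?case .
  qed simp
  show ?thesis
  proof (rule sums_le[OF _ c e])
    fix n
    have "(x\<^sup>2) ^ n / fact (2 * n) \<le> (x\<^sup>2) ^ n / (2 ^ n * fact n)"
      using fact_le[of n] by (intro divide_left_mono) auto
    also have "\<dots> = (x\<^sup>2 / 2) ^ n /\<^sub>R fact n"
      by (simp add: power_divide field_simps)
    finally show "x ^ (2 * n) /\<^sub>R fact (2 * n) \<le> (x\<^sup>2 / 2) ^ n /\<^sub>R fact n"
      unfolding power_mult[of x 2 n] by (simp add: field_simps)
  qed
qed

text \<open>McDiarmid's argument, one edge per induction step. The two conditional means differ by
  at most \<open>c\<close>, so each is at distance \<open>|d| \<le> c / 2\<close> from the total
  mean. This contributes \<open>cosh (l * d)\<close>, the origin of the 8 in the exponent.\<close>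

lemma avg_exp_bounded_differences:
  fixes c l :: real
  assumes "finite A" and "\<And>S e. \<bar>f (insert e S) - f S\<bar> \<le> c"
  shows "avg A (\<lambda>S. exp (l * (f S - avg A f))) \<le> exp (l\<^sup>2 * c\<^sup>2 * card A / 8)"
  using assms
proof (induction A arbitrary: f rule: finite_induct)
  case (insert e A)
  let ?f1 = "\<lambda>S. f (insert e S)"
  define \<mu>0 where "\<mu>0 = avg A f"
  define \<mu>1 where "\<mu>1 = avg A ?f1"
  define d where "d = (\<mu>1 - \<mu>0) / 2"
  have mean: "avg (insert e A) f = (\<mu>0 + \<mu>1) / 2"
    by (simp add: avg_insert insert.hyps \<mu>0_def \<mu>1_def)
  have "\<bar>\<mu>1 - \<mu>0\<bar> \<le> avg A (\<lambda>S. \<bar>?f1 S - f S\<bar>)"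
    unfolding \<mu>0_def \<mu>1_def avg_diff[symmetric] by (rule avg_abs_le)
  also have "\<dots> \<le> c"
    using insert by (intro avg_le_const) auto
  finally have d: "\<bar>d\<bar> \<le> c / 2"
    by (simp add: d_def)
  define E where "E = exp (l\<^sup>2 * c\<^sup>2 * card A / 8)"
  have E: "E > 0" by (simp add: E_def)
  have 0: "avg A (\<lambda>S. exp (l * (f S - (\<mu>0 + \<mu>1) / 2))) \<le> exp (- (l * d)) * E"
  proof -
    have "avg A (\<lambda>S. exp (l * (f S - (\<mu>0 + \<mu>1) / 2)))
        = exp (- (l * d)) * avg A (\<lambda>S. exp (l * (f S - \<mu>0)))"
      unfolding avg_cmult[symmetric]
      by (intro avg_cong) (simp add: d_def field_simps flip: exp_add)
    then show ?thesis
      using insert.IH[of f] insert.prems by (simp add: E_def \<mu>0_def)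
  qed
  have 1: "avg A (\<lambda>S. exp (l * (?f1 S - (\<mu>0 + \<mu>1) / 2))) \<le> exp (l * d) * E"
  proof -
    have "avg A (\<lambda>S. exp (l * (?f1 S - (\<mu>0 + \<mu>1) / 2)))
        = exp (l * d) * avg A (\<lambda>S. exp (l * (?f1 S - \<mu>1)))"
      unfolding avg_cmult[symmetric]
      by (intro avg_cong) (simp add: d_def field_simps flip: exp_add)
    moreover have "\<bar>?f1 (insert e' S) - ?f1 S\<bar> \<le> c" for e' S
      using insert.prems[of e' "insert e S"] by (simp add: insert_commute)
    ultimately show ?thesis
      using insert.IH[of ?f1] by (simp add: E_def \<mu>1_def)
  qed
  have "avg (insert e A) (\<lambda>S. exp (l * (f S - avg (insert e A) f)))
      \<le> (exp (- (l * d)) * E + exp (l * d) * E) / 2"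
    unfolding mean unfolding avg_insert[OF insert.hyps]
    by (intro divide_right_mono add_mono 0 1) auto
  also have "\<dots> = cosh (l * d) * E"
    by (simp add: cosh_def field_simps)
  also have "\<dots> \<le> exp ((l * d)\<^sup>2 / 2) * E"
    using E cosh_le_exp_square by (intro mult_right_mono) auto
  also have "\<dots> \<le> exp ((l * (c / 2))\<^sup>2 / 2) * E"
  proof -
    have "(l * d)\<^sup>2 \<le> (l * (c / 2))\<^sup>2"
      unfolding power_mult_distrib using power_mono[OF d, of 2] by (intro mult_left_mono) auto
    then show ?thesis using E by (intro mult_right_mono) auto
  qed
  also have "\<dots> = exp (l\<^sup>2 * c\<^sup>2 * card (insert e A) / 8)"
    using insert.hyps by (simp add: E_def power_mult_distrib field_simps flip: exp_add)
  finally show ?case .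
qed simp

lemma avg_tail_bounded_differences:
  fixes c V u :: real
  assumes "finite A" and "\<And>S e. \<bar>f (insert e S) - f S\<bar> \<le> c"
    and "c\<^sup>2 * card A \<le> V" and "0 < V" and "0 \<le> u"
  shows "avg A (\<lambda>S. of_bool (u < \<bar>f S - avg A f\<bar>)) \<le> 2 * exp (- 2 * u\<^sup>2 / V)"
proof -
  have exp_le: "avg A (\<lambda>S. exp (l * (f S - avg A f))) \<le> exp (l\<^sup>2 * V / 8)" for l
  proof -
    have "l\<^sup>2 * c\<^sup>2 * card A \<le> l\<^sup>2 * V"
      using assms(3) by (simp add: mult.assoc mult_left_mono)
    then show ?thesis
      using avg_exp_bounded_differences[OF assms(1,2), of l]
      by (elim order_trans) (simp add: divide_right_mono)
  qed
  \<comment> \<open>The minimiser of the Chernoff exponent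
    \<open>- l * u + l\<^sup>2 * V / 8\<close>.\<close>
  define l where "l = 4 * u / V"
  have l0: "l \<ge> 0" using assms by (simp add: l_def)
  have "avg A (\<lambda>S. of_bool (u < \<bar>f S - avg A f\<bar>)) \<le>
     avg A (\<lambda>S. exp (- l * u) * exp (l * (f S - avg A f)) + exp (- l * u) * exp (- l * (f S - avg A f)))"
  proof (rule avg_mono)
    fix S
    let ?z = "f S - avg A f"
    show "of_bool (u < \<bar>?z\<bar>) \<le> exp (- l * u) * exp (l * ?z) + exp (- l * u) * exp (- l * ?z)"
    proof (cases "u < \<bar>?z\<bar>")
      case True
      then have "l * u \<le> l * \<bar>?z\<bar>"
        using l0 by (intro mult_left_mono) auto
      then have "l * u \<le> l * ?z \<or> l * u \<le> - l * ?z"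
        by (cases "?z \<ge> 0") (auto simp: abs_if algebra_simps)
      then have "1 \<le> exp (- l * u + l * ?z) \<or> 1 \<le> exp (- l * u + - l * ?z)"
        unfolding one_le_exp_iff by linarith
      then show ?thesis
        using exp_gt_zero[of "- l * u + l * ?z"] exp_gt_zero[of "- l * u + - l * ?z"]
        unfolding exp_add[symmetric] using True by (simp only: of_bool_eq) linarith
    qed (auto intro!: add_nonneg_nonneg)
  qed
  also have "\<dots> \<le> exp (- l * u) * exp (l\<^sup>2 * V / 8) + exp (- l * u) * exp (l\<^sup>2 * V / 8)"
    unfolding avg_add avg_cmult using exp_le[of l] exp_le[of "- l"]
    by (intro add_mono mult_left_mono) auto
  also have "\<dots> = 2 * exp (- 2 * u\<^sup>2 / V)"
  proof -
    have "- l * u + l\<^sup>2 * V / 8 = - 2 * u\<^sup>2 / V"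
      using assms(4) by (simp add: l_def field_simps power2_eq_square)
    then show ?thesis by (simp flip: exp_add)
  qed
  finally show ?thesis .
qed

section \<open>The normal distribution and Stein's equation\<close>

lemma Phi_eq_cdf: "Phi = cdf std_normal_distribution"
  by (simp add: Phi_def cdf_def fun_eq_iff)

lemma Phi_at_top: "(Phi \<longlongrightarrow> 1) at_top"
  unfolding Phi_eq_cdf
  using real_distribution.cdf_lim_at_top_prob[OF real_dist_normal_dist] .

lemma Phi_at_bot: "(Phi \<longlongrightarrow> 0) at_bot"
  unfolding Phi_eq_cdf
  using finite_borel_measure.cdf_lim_at_bot[OF real_distribution.finite_borel_measure_M[OF real_dist_normal_dist]] .

lemma Phi_nonneg: "0 \<le> Phi x"
  by (simp add: Phi_def)

lemma Phi_le_1: "Phi x \<le> 1"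
proof -
  interpret prob_space std_normal_distribution
    by (rule prob_space_normal_density) simp
  show ?thesis
    by (simp add: Phi_def)
qed

lemma Phi_diff:
  assumes "x \<le> y"
  shows "Phi y - Phi x = integral {x..y} std_normal_density"
proof -
  interpret real_distribution std_normal_distribution
    by (rule real_dist_normal_dist)
  have cont: "continuous_on {x..y} std_normal_density"
    unfolding std_normal_density_def by (intro continuous_intros) auto
  have int: "set_integrable lborel {x..y} std_normal_density"
    by (rule borel_integrable_atLeastAtMost') (rule cont)
  have "Phi y - Phi x = measure std_normal_distribution {x<..y}"
  proof (cases "x = y")
    case False
    then show ?thesis
      unfolding Phi_eq_cdf using assms by (intro cdf_diff_eq) auto
  qed simp
  also have "\<dots> = measure std_normal_distribution {x..y}"
  proof (rule measure_eq_AE)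
    have "AE z in lborel. z \<noteq> x"
      by (rule AE_lborel_singleton)
    then show "AE z in std_normal_distribution. z \<in> {x<..y} \<longleftrightarrow> z \<in> {x..y}"
      by (subst AE_density) (auto elim!: AE_mp)
  qed auto
  also have "\<dots> = (LINT z:{x..y}|lborel. std_normal_density z)"
  proof -
    have "emeasure std_normal_distribution {x..y}
        = (\<integral>\<^sup>+ z. ennreal (indicator {x..y} z * std_normal_density z) \<partial>lborel)"
      by (subst emeasure_density) (auto intro!: nn_integral_cong simp: indicator_def)
    also have "\<dots> = ennreal (LINT z:{x..y}|lborel. std_normal_density z)"
      unfolding set_lebesgue_integral_def using int
      by (subst nn_integral_eq_integral) (auto simp: set_integrable_def)
    finally have *: "emeasure std_normal_distribution {x..y} = ennreal (LINT z:{x..y}|lborel. std_normal_density z)" .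
    show ?thesis
      unfolding measure_def *
      by (rule enn2real_ennreal) (auto simp: set_lebesgue_integral_def intro!: integral_nonneg_AE)
  qed
  also have "\<dots> = integral {x..y} std_normal_density"
    using int by (rule set_borel_integral_eq_integral)
  finally show ?thesis .
qed

lemma Phi_has_derivative: "(Phi has_real_derivative std_normal_density x) (at x)"
proof -
  have cont: "continuous_on {x - 1..x + 1} std_normal_density"
    unfolding std_normal_density_def by (intro continuous_intros) auto
  have "((\<lambda>y. Phi (x - 1) + integral {x - 1..y} std_normal_density) has_real_derivative
      0 + std_normal_density x) (at x within {x - 1..x + 1})"
    by (intro DERIV_add DERIV_const integral_has_real_derivative[OF cont]) auto
  then have "((\<lambda>y. Phi (x - 1) + integral {x - 1..y} std_normal_density) has_real_derivative
      std_normal_density x) (at x within {x - 1..x + 1})"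
    by simp
  then have "(Phi has_real_derivative std_normal_density x) (at x within {x - 1..x + 1})"
  proof (rule has_field_derivative_transform_within[where d = 1])
    fix y assume "y \<in> {x - 1..x + 1}"
    then show "Phi (x - 1) + integral {x - 1..y} std_normal_density = Phi y"
      using Phi_diff[of "x - 1" y] by auto
  qed auto
  then show ?thesis
    by (subst (asm) at_within_interior) auto
qed

lemmas Phi_DERIV [derivative_intros] = DERIV_chain2[OF Phi_has_derivative]

lemma std_normal_density_DERIV:
  "(std_normal_density has_real_derivative - (x * std_normal_density x)) (at x)"
proof -
  have "((\<lambda>x. 1 / sqrt (2 * pi) * exp (- x\<^sup>2 / 2)) has_real_derivative
      1 / sqrt (2 * pi) * (exp (- x\<^sup>2 / 2) * - x)) (at x)"
    by (intro DERIV_cmult) (auto intro!: derivative_eq_intros)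
  then show ?thesis
    unfolding std_normal_density_def by (elim DERIV_cong) simp
qed

lemmas std_normal_density_DERIV' [derivative_intros] = DERIV_chain2[OF std_normal_density_DERIV]

lemma std_normal_density_at_top: "(std_normal_density \<longlongrightarrow> 0) at_top"
  unfolding std_normal_density_def by real_asymp

lemma std_normal_density_even: "std_normal_density (- x) = std_normal_density x"
  by (simp add: std_normal_density_def)

text \<open>The sum of both values has derivative zero because the density is even; the limits at
  infinity identify the constant.\<close>

lemma Phi_minus: "Phi (- x) = 1 - Phi x"
proof -
  define c where "c = Phi x + Phi (- x)"
  have c: "Phi y + Phi (- y) = c" for y
    unfolding c_def
  proof (rule DERIV_isconst_all[of "\<lambda>y. Phi y + Phi (- y)"], rule allI)
    show "((\<lambda>y. Phi y + Phi (- y)) has_real_derivative 0) (at z)" for z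
      by (auto intro!: derivative_eq_intros simp: std_normal_density_even)
  qed
  have "((\<lambda>y. Phi y + Phi (- y)) \<longlongrightarrow> 1 + 0) at_top"
    by (intro tendsto_add Phi_at_top filterlim_compose[OF Phi_at_bot] filterlim_uminus_at_bot_at_top)
  then have "c = 1"
    unfolding c by (simp add: tendsto_const_iff)
  with c[of x] show ?thesis by simp
qed

text \<open>The difference of the two sides tends to 0 at infinity and is decreasing, its derivative
  being \<open>- 2 / (1 + y\<^sup>2)\<^sup>2\<close> times the density. There is no sign condition
  on \<open>u\<close>, which later covers both halves of Stein's solution on the whole line.\<close>

lemma Mills_lower: "u / (1 + u\<^sup>2) * std_normal_density u < 1 - Phi u"
proof -
  define D where "D = (\<lambda>u. (1 - Phi u) - u / (1 + u\<^sup>2) * std_normal_density u)"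
  have pos: "1 + y * y > 0" for y :: real
    by (simp add: add_pos_nonneg)
  have "0 < D u"
  proof (rule DERIV_neg_imp_decreasing_at_top[of u D 0])
    fix y
    have "((\<lambda>u. u / (1 + u\<^sup>2)) has_real_derivative (1 - y\<^sup>2) / (1 + y\<^sup>2)\<^sup>2) (at y)"
      using pos[of y] by (auto intro!: derivative_eq_intros simp: power2_eq_square field_simps)
    then have "(D has_real_derivative (0 - std_normal_density y) -
        ((1 - y\<^sup>2) / (1 + y\<^sup>2)\<^sup>2 * std_normal_density y
          + - (y * std_normal_density y) * (y / (1 + y\<^sup>2)))) (at y)"
      unfolding D_def
      by (intro DERIV_diff DERIV_mult DERIV_const Phi_has_derivative std_normal_density_DERIV)
    moreover have "(0 - p) - ((1 - y\<^sup>2) / (1 + y\<^sup>2)\<^sup>2 * p + - (y * p) * (y / (1 + y\<^sup>2)))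
        = - (2 / (1 + y\<^sup>2)\<^sup>2 * p)" for p
    proof -
      define q where "q = 1 + y\<^sup>2"
      have q: "q \<noteq> 0" and y: "y\<^sup>2 = q - 1"
        using pos[of y] by (auto simp: q_def power2_eq_square)
      have yp: "- (y * p) * (y / q) = - ((q - 1) * p / q)"
        unfolding y[symmetric] by (simp add: power2_eq_square)
      have "(0 - p) - ((1 - (q - 1)) / q\<^sup>2 * p - (q - 1) * p / q) = - (2 / q\<^sup>2 * p)"
        using q by (simp add: divide_simps power2_eq_square) algebra
      then show ?thesis
        unfolding q_def[symmetric] yp unfolding y by (simp only: diff_conv_add_uminus)
    qed
    ultimately have "(D has_real_derivative - (2 / (1 + y\<^sup>2)\<^sup>2 * std_normal_density y)) (at y)"
      by (simp only:)
    moreover have "2 / (1 + y\<^sup>2)\<^sup>2 * std_normal_density y > 0"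
      using pos[of y] by (intro mult_pos_pos divide_pos_pos normal_density_pos) (auto simp: power2_eq_square)
    ultimately show "\<exists>d. DERIV D y :> d \<and> d < 0"
      by (intro exI[of _ "- (2 / (1 + y\<^sup>2)\<^sup>2 * std_normal_density y)"]) auto
  next
    have "((\<lambda>u::real. u / (1 + u\<^sup>2)) \<longlongrightarrow> 0) at_top"
      by real_asymp
    then have "(D \<longlongrightarrow> (1 - 1) - 0 * 0) at_top"
      unfolding D_def by (intro tendsto_intros Phi_at_top std_normal_density_at_top)
    then show "(D \<longlongrightarrow> 0) at_top" by simp
  qed
  then show ?thesis by (simp add: D_def)
qed

lemma Mills_upper:
  assumes "0 < u"
  shows "1 - Phi u < std_normal_density u / u"
proof -
  define D where "D = (\<lambda>u. std_normal_density u / u - (1 - Phi u))"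
  have "0 < D u"
  proof (rule DERIV_neg_imp_decreasing_at_top[of u D 0])
    fix y assume "u \<le> y"
    then have y: "y > 0" using assms by simp
    have "(D has_real_derivative
        (- (y * std_normal_density y) * y - std_normal_density y * 1) / (y * y) + std_normal_density y) (at y)"
      unfolding D_def using y by (auto intro!: derivative_eq_intros)
    then have "(D has_real_derivative - (std_normal_density y / y\<^sup>2)) (at y)"
      using y by (elim DERIV_cong) (simp add: field_simps power2_eq_square)
    moreover have "std_normal_density y / y\<^sup>2 > 0"
      using y by (intro divide_pos_pos normal_density_pos) auto
    ultimately show "\<exists>d. DERIV D y :> d \<and> d < 0"
      by (intro exI[of _ "- (std_normal_density y / y\<^sup>2)"]) auto
  next
    have "((\<lambda>u. std_normal_density u * (1 / u)) \<longlongrightarrow> 0 * 0) at_top"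
      by (intro tendsto_mult std_normal_density_at_top) real_asymp
    then have "(D \<longlongrightarrow> 0 * 0 - (1 - 1)) at_top"
      unfolding D_def by (intro tendsto_diff tendsto_const Phi_at_top) simp
    then show "(D \<longlongrightarrow> 0) at_top" by simp
  qed
  then show ?thesis by (simp add: D_def)
qed

lemma Phi_less_1: "Phi x < 1"
proof -
  have "0 < 1 - Phi (max x 0)"
    using Mills_lower[of "max x 0"] by (smt (verit) divide_nonneg_nonneg max_def mult_nonneg_nonneg
      normal_density_nonneg zero_le_power2)
  moreover have "Phi x \<le> Phi (max x 0)"
    unfolding Phi_def
  proof -
    interpret prob_space std_normal_distribution
      by (rule prob_space_normal_density) simp
    show "measure std_normal_distribution {..x} \<le> measure std_normal_distribution {..max x 0}"
      by (intro finite_measure_mono) auto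
  qed
  ultimately show ?thesis by simp
qed

lemma Phi_mono: "x \<le> y \<Longrightarrow> Phi x \<le> Phi y"
  using Phi_diff[of x y] integral_nonneg[of std_normal_density "{x..y}"]
    integral_nonneg integrable_continuous_real[of x y std_normal_density]
  by (smt (verit) normal_density_nonneg not_integrable_integral)

text \<open>The reciprocal of the standard normal density, which solves
  \<open>f' = v f\<close>.\<close>

definition gauss_inv :: "real \<Rightarrow> real" where
  "gauss_inv v = sqrt (2 * pi) * exp (v\<^sup>2 / 2)"

definition stein_L :: "real \<Rightarrow> real" where
  "stein_L v = gauss_inv v * Phi v"

text \<open>The Mills ratio; \<open>stein_L\<close> is its mirror image. They solve
  \<open>f' = v f - 1\<close> and \<open>f' = v f + 1\<close>.\<close>

definition stein_U :: "real \<Rightarrow> real" where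
  "stein_U v = gauss_inv v * (1 - Phi v)"

lemma gauss_inv_pos: "0 < gauss_inv v"
  by (simp add: gauss_inv_def)

lemma gauss_inv_density: "gauss_inv v * std_normal_density v = 1"
  by (simp add: gauss_inv_def std_normal_density_def flip: exp_add)

lemma gauss_inv_le: "gauss_inv v \<le> 3 * exp (v\<^sup>2 / 2)"
proof -
  have "2 * pi \<le> 3\<^sup>2"
    using pi_less_4 by simp
  then have "sqrt (2 * pi) \<le> 3"
    by (intro real_le_lsqrt) auto
  then show ?thesis
    by (simp add: gauss_inv_def)
qed

lemma gauss_inv_DERIV: "(gauss_inv has_real_derivative v * gauss_inv v) (at v)"
  unfolding gauss_inv_def by (auto intro!: derivative_eq_intros)

lemma stein_L_DERIV: "(stein_L has_real_derivative v * stein_L v + 1) (at v)"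
  unfolding stein_L_def
  using gauss_inv_density[of v]
  by (auto intro!: derivative_eq_intros gauss_inv_DERIV simp: mult.commute[of _ "gauss_inv v"])

lemma stein_U_DERIV: "(stein_U has_real_derivative v * stein_U v - 1) (at v)"
  unfolding stein_U_def
  using gauss_inv_density[of v]
  by (auto intro!: derivative_eq_intros gauss_inv_DERIV simp: mult.commute[of _ "gauss_inv v"])

lemma stein_L_minus: "stein_L v = stein_U (- v)"
  by (simp add: stein_L_def stein_U_def gauss_inv_def Phi_minus)

lemma stein_U_ge: "v / (1 + v\<^sup>2) \<le> stein_U v"
proof -
  have "gauss_inv v * (v / (1 + v\<^sup>2) * std_normal_density v) \<le> stein_U v"
    unfolding stein_U_def using Mills_lower[of v] gauss_inv_pos[of v] by (intro mult_left_mono) auto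
  then show ?thesis
    using gauss_inv_density[of v] by (simp add: mult.left_commute)
qed

lemma stein_U_le:
  assumes "0 < v"
  shows "stein_U v \<le> 1 / v"
proof -
  have "stein_U v \<le> gauss_inv v * (std_normal_density v / v)"
    unfolding stein_U_def using Mills_upper[OF assms] gauss_inv_pos[of v] by (intro mult_left_mono) auto
  then show ?thesis
    using gauss_inv_density[of v] by simp
qed

text \<open>The expression is the derivative of \<open>v * stein_L v\<close>. Since
  \<open>stein_L v = stein_U (- v)\<close>, the Mills bounds at \<open>- v\<close> give its sign
  everywhere and the bound 1 far to the left. Right of -1 only \<open>Phi v \<le> 1\<close> is used,
  which leaves the Gaussian growth.\<close>

lemma stein_L_bounds:
  shows "0 \<le> (1 + v\<^sup>2) * stein_L v + v"
    and "-1 \<le> v \<Longrightarrow> (1 + v\<^sup>2) * stein_L v + v \<le> 4 * ((1 + v\<^sup>2) * exp (v\<^sup>2 / 2))"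
    and "v < -1 \<Longrightarrow> (1 + v\<^sup>2) * stein_L v + v \<le> 1"
proof -
  have pos: "1 + v\<^sup>2 > 0"
    by (simp add: add_pos_nonneg)
  have "(1 + v\<^sup>2) * (- v / (1 + v\<^sup>2)) \<le> (1 + v\<^sup>2) * stein_L v"
    using stein_U_ge[of "- v"] pos unfolding stein_L_minus by (intro mult_left_mono) auto
  then show "0 \<le> (1 + v\<^sup>2) * stein_L v + v"
    using pos by simp
  have "stein_L v \<le> gauss_inv v"
    unfolding stein_L_def using gauss_inv_pos[of v] Phi_le_1[of v] by (simp add: mult_left_le)
  then have "(1 + v\<^sup>2) * stein_L v \<le> (1 + v\<^sup>2) * (3 * exp (v\<^sup>2 / 2))"
    using gauss_inv_le[of v] pos by (intro mult_left_mono) auto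
  moreover have "v \<le> (1 + v\<^sup>2) * exp (v\<^sup>2 / 2)"
  proof -
    have "v \<le> 1 + v\<^sup>2"
      using sum_squares_ge_zero[of "v - 1" v] by (simp add: power2_eq_square algebra_simps)
    also have "\<dots> \<le> (1 + v\<^sup>2) * exp (v\<^sup>2 / 2)"
      using pos by simp
    finally show ?thesis .
  qed
  ultimately show "(1 + v\<^sup>2) * stein_L v + v \<le> 4 * ((1 + v\<^sup>2) * exp (v\<^sup>2 / 2))"
    by linarith
  assume v: "v < -1"
  have "(1 + v\<^sup>2) * stein_L v \<le> (1 + v\<^sup>2) * (1 / - v)"
    unfolding stein_L_minus using pos v stein_U_le[of "- v"] by (intro mult_left_mono) auto
  also have "\<dots> = 1 / - v - v"
    using v by (simp add: field_simps power2_eq_square)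
  also have "1 / - v \<le> 1"
    using v by (simp add: field_simps)
  finally show "(1 + v\<^sup>2) * stein_L v + v \<le> 1" by simp
qed

lemma stein_U_bounds:
  shows "0 \<le> (1 + v\<^sup>2) * stein_U v - v"
    and "1 \<le> v \<Longrightarrow> (1 + v\<^sup>2) * stein_U v - v \<le> 1"
proof -
  have pos: "1 + v\<^sup>2 > 0"
    by (simp add: add_pos_nonneg)
  have "(1 + v\<^sup>2) * (v / (1 + v\<^sup>2)) \<le> (1 + v\<^sup>2) * stein_U v"
    using stein_U_ge[of v] pos by (intro mult_left_mono) auto
  then show "0 \<le> (1 + v\<^sup>2) * stein_U v - v"
    using pos by simp
  assume v: "1 \<le> v"
  have "(1 + v\<^sup>2) * stein_U v \<le> (1 + v\<^sup>2) * (1 / v)"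
    using pos v stein_U_le[of v] by (intro mult_left_mono) auto
  also have "\<dots> = 1 / v + v"
    using v by (simp add: field_simps power2_eq_square)
  also have "1 / v \<le> 1"
    using v by simp
  finally show "(1 + v\<^sup>2) * stein_U v - v \<le> 1" by simp
qed

text \<open>The solution of Stein's equation \<open>f' v - v f v = 1{v \<le> x} - Phi x\<close>.\<close>
definition stein_f :: "real \<Rightarrow> real \<Rightarrow> real" where
  "stein_f x v = (if v \<le> x then (1 - Phi x) * stein_L v else Phi x * stein_U v)"

lemma stein_f_continuous: "continuous_on S (stein_f x)"
proof -
  have c: "isCont stein_L v" "isCont stein_U v" for v
    using stein_L_DERIV stein_U_DERIV DERIV_isCont by blast+
  have "continuous_on UNIV (\<lambda>v. if v \<le> x then (1 - Phi x) * stein_L v else Phi x * stein_U v)"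
    by (rule continuous_on_cases_le)
      (auto intro!: continuous_at_imp_continuous_on c continuous_on_mult_left
        simp: stein_L_def[of x] stein_U_def[of x])
  then have "continuous_on UNIV (stein_f x)"
    by (simp add: stein_f_def[abs_def])
  then show ?thesis
    using continuous_on_subset by blast
qed

lemma stein_f_DERIV:
  assumes "v \<noteq> x"
  shows "(stein_f x has_real_derivative v * stein_f x v + of_bool (v \<le> x) - Phi x) (at v)"
proof (cases "v < x")
  case True
  have "((\<lambda>v. (1 - Phi x) * stein_L v) has_real_derivative (1 - Phi x) * (v * stein_L v + 1)) (at v)"
    by (intro DERIV_cmult stein_L_DERIV)
  moreover have "eventually (\<lambda>w. (1 - Phi x) * stein_L w = stein_f x w) (nhds v)"
    using eventually_nhds_in_open[of "{..<x}" v] True by (auto elim!: eventually_mono simp: stein_f_def)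
  ultimately have "(stein_f x has_real_derivative (1 - Phi x) * (v * stein_L v + 1)) (at v)"
    using DERIV_cong_ev[of v v "\<lambda>w. (1 - Phi x) * stein_L w" "stein_f x" "(1 - Phi x) * (v * stein_L v + 1)" "(1 - Phi x) * (v * stein_L v + 1)"]
    by simp
  then show ?thesis
    using True by (elim DERIV_cong) (simp add: stein_f_def algebra_simps)
next
  case False
  then have v: "x < v" using assms by simp
  have "((\<lambda>v. Phi x * stein_U v) has_real_derivative Phi x * (v * stein_U v - 1)) (at v)"
    by (intro DERIV_cmult stein_U_DERIV)
  moreover have "eventually (\<lambda>w. Phi x * stein_U w = stein_f x w) (nhds v)"
    using eventually_nhds_in_open[of "{x<..}" v] v by (auto elim!: eventually_mono simp: stein_f_def)
  ultimately have "(stein_f x has_real_derivative Phi x * (v * stein_U v - 1)) (at v)"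
    using DERIV_cong_ev[of v v "\<lambda>w. Phi x * stein_U w" "stein_f x" "Phi x * (v * stein_U v - 1)" "Phi x * (v * stein_U v - 1)"]
    by simp
  then show ?thesis
    using v by (elim DERIV_cong) (simp add: stein_f_def algebra_simps)
qed

text \<open>By Stein's equation the derivative of \<open>stein_f x\<close> is this function plus a
  bounded step. As it is monotone, increments of \<open>stein_f x\<close> over an interval are
  controlled by its value at one endpoint.\<close>

definition stein_g :: "real \<Rightarrow> real \<Rightarrow> real" where
  "stein_g x v = v * stein_f x v"

definition stein_g' :: "real \<Rightarrow> real \<Rightarrow> real" where
  "stein_g' x v = (if v \<le> x then (1 - Phi x) * ((1 + v\<^sup>2) * stein_L v + v)
     else Phi x * ((1 + v\<^sup>2) * stein_U v - v))"

lemma stein_g_continuous: "continuous_on S (stein_g x)"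
  unfolding stein_g_def[abs_def] by (intro continuous_intros stein_f_continuous)

lemma stein_g_DERIV:
  assumes "v \<noteq> x"
  shows "(stein_g x has_real_derivative stein_g' x v) (at v)"
proof -
  have "((\<lambda>v. v * stein_f x v) has_real_derivative
      1 * stein_f x v + (v * stein_f x v + of_bool (v \<le> x) - Phi x) * v) (at v)"
    by (intro DERIV_mult DERIV_ident stein_f_DERIV assms)
  then show ?thesis
    unfolding stein_g_def[abs_def]
    by (elim DERIV_cong) (simp add: stein_g'_def stein_f_def power2_eq_square algebra_simps)
qed

lemma stein_g'_nonneg: "0 \<le> stein_g' x v"
  using stein_L_bounds(1)[of v] stein_U_bounds(1)[of v] Phi_nonneg[of x] Phi_le_1[of x]
  by (simp add: stein_g'_def)

text \<open>A mean value inequality with one exceptional point \<open>x\<close>, where the interval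
  is split. Stein's solution has such a kink at its threshold.\<close>

lemma increment_le:
  fixes f f' :: "real \<Rightarrow> real"
  assumes "u \<le> w" "continuous_on {u..w} f"
    and der: "\<And>v. u < v \<Longrightarrow> v < w \<Longrightarrow> v \<noteq> x \<Longrightarrow> (f has_real_derivative f' v) (at v)"
    and le: "\<And>v. u < v \<Longrightarrow> v < w \<Longrightarrow> v \<noteq> x \<Longrightarrow> f' v \<le> M"
  shows "f w - f u \<le> M * (w - u)"
proof -
  have *: "f w' - f u' \<le> M * (w' - u')" if "u \<le> u'" "u' \<le> w'" "w' \<le> w" "x \<notin> {u'<..<w'}" for u' w'
  proof (cases "u' = w'")
    case False
    then have "u' < w'" using that by simp
    moreover have "continuous_on {u'..w'} f"
      using assms(2) that by (auto intro: continuous_on_subset)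
    moreover have "f differentiable (at v)" if "u' < v" "v < w'" for v
      using der[of v] that \<open>u \<le> u'\<close> \<open>w' \<le> w\<close> \<open>x \<notin> _\<close> real_differentiable_def by force
    ultimately obtain l z where z: "u' < z" "z < w'" "(f has_real_derivative l) (at z)"
        "f w' - f u' = (w' - u') * l"
      using MVT by blast
    have z': "u < z" "z < w" "z \<noteq> x"
      using z that by auto
    then have "l = f' z"
      using DERIV_unique[OF z(3) der] by blast
    then have "l \<le> M"
      using le z' by blast
    then show ?thesis
      using z that by (simp add: mult.commute mult_left_mono)
  qed simp
  show ?thesis
  proof (cases "x \<in> {u<..<w}")
    case True
    then show ?thesis
      using *[of u x] *[of x w] by (auto simp: algebra_simps)
  next
    case False
    then show ?thesis
      using *[of u w] assms(1) by simp
  qed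
qed

lemma increment_ge:
  fixes f f' :: "real \<Rightarrow> real"
  assumes "u \<le> w" "continuous_on {u..w} f"
    and "\<And>v. u < v \<Longrightarrow> v < w \<Longrightarrow> v \<noteq> x \<Longrightarrow> (f has_real_derivative f' v) (at v)"
    and "\<And>v. u < v \<Longrightarrow> v < w \<Longrightarrow> v \<noteq> x \<Longrightarrow> M \<le> f' v"
  shows "M * (w - u) \<le> f w - f u"
proof -
  have "- f w - - f u \<le> - M * (w - u)"
  proof (rule increment_le[of u w "\<lambda>v. - f v" x "\<lambda>v. - f' v"])
    show "((\<lambda>v. - f v) has_real_derivative - f' v) (at v)" if "u < v" "v < w" "v \<noteq> x" for v
      using assms(3)[OF that] by (rule DERIV_minus)
  qed (use assms in \<open>auto intro!: continuous_on_minus\<close>)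
  then show ?thesis by simp
qed

lemma stein_g_mono:
  assumes "u \<le> w"
  shows "stein_g x u \<le> stein_g x w"
proof -
  have "0 * (w - u) \<le> stein_g x w - stein_g x u"
    by (rule increment_ge[OF assms stein_g_continuous stein_g_DERIV stein_g'_nonneg])
  then show ?thesis by simp
qed

text \<open>For either sign of \<open>u\<close> the left-hand side is \<open>u\<^sup>2\<close> times
  a mean slope of \<open>stein_f x\<close> between \<open>w - |u|\<close> and
  \<open>w + |u|\<close>. Monotonicity of \<open>stein_g x\<close> bounds the slope by its right
  end; widening the indicator by \<delta> makes it valid on the whole interval.\<close>

lemma stein_increment_le:
  assumes "\<bar>u\<bar> \<le> \<delta>"
  shows "u * (stein_f x (w + u) - stein_f x w)
    \<le> u\<^sup>2 * (stein_g x (w + \<bar>u\<bar>) + of_bool (w \<le> x + \<delta>) - Phi x)"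
proof -
  define M where "M = stein_g x (w + \<bar>u\<bar>) + of_bool (w \<le> x + \<delta>) - Phi x"
  have M: "v * stein_f x v + of_bool (v \<le> x) - Phi x \<le> M" if "w - \<bar>u\<bar> \<le> v" "v \<le> w + \<bar>u\<bar>" for v
    using stein_g_mono[OF that(2), of x] that assms by (auto simp: M_def stein_g_def)
  have "u * (stein_f x (w + u) - stein_f x w) \<le> u * (u * M)"
  proof (cases "u \<ge> 0")
    case True
    have "stein_f x (w + u) - stein_f x w \<le> M * (w + u - w)"
      by (rule increment_le[OF _ stein_f_continuous stein_f_DERIV]) (use True M in auto)
    then show ?thesis
      using True by (intro mult_left_mono) (auto simp: mult.commute)
  next
    case False
    have "stein_f x w - stein_f x (w + u) \<le> M * (w - (w + u))"
      by (rule increment_le[OF _ stein_f_continuous stein_f_DERIV]) (use False M in auto)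
    then show ?thesis
      using False by (intro mult_left_mono_neg) (auto simp: algebra_simps)
  qed
  then show ?thesis
    by (simp add: M_def power2_eq_square)
qed

lemma stein_increment_ge:
  assumes "\<bar>u\<bar> \<le> \<delta>"
  shows "u\<^sup>2 * (stein_g x (w - \<bar>u\<bar>) + of_bool (w \<le> x - \<delta>) - Phi x)
    \<le> u * (stein_f x (w + u) - stein_f x w)"
proof -
  define M where "M = stein_g x (w - \<bar>u\<bar>) + of_bool (w \<le> x - \<delta>) - Phi x"
  have M: "M \<le> v * stein_f x v + of_bool (v \<le> x) - Phi x" if "w - \<bar>u\<bar> \<le> v" "v \<le> w + \<bar>u\<bar>" for v
    using stein_g_mono[OF that(1), of x] that assms by (auto simp: M_def stein_g_def)
  have "u * (u * M) \<le> u * (stein_f x (w + u) - stein_f x w)"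
  proof (cases "u \<ge> 0")
    case True
    have "M * (w + u - w) \<le> stein_f x (w + u) - stein_f x w"
      by (rule increment_ge[OF _ stein_f_continuous stein_f_DERIV]) (use True M in auto)
    then show ?thesis
      using True by (intro mult_left_mono) (auto simp: mult.commute)
  next
    case False
    have "M * (w - (w + u)) \<le> stein_f x w - stein_f x (w + u)"
      by (rule increment_ge[OF _ stein_f_continuous stein_f_DERIV]) (use False M in auto)
    then show ?thesis
      using False by (intro mult_left_mono_neg) (auto simp: algebra_simps)
  qed
  then show ?thesis
    by (simp add: M_def power2_eq_square)
qed

text \<open>A local bound for the derivative of \<open>stein_g x\<close> whose mean can be estimated from the
  moment generating function alone: the Gaussian factor \<open>exp (v\<^sup>2 / 2)\<close> for
  \<open>j \<le> v < j + 1\<close> is replaced by \<open>exp (j v - j\<^sup>2 / 2)\<close>.\<close>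
definition stein_h :: "real \<Rightarrow> real \<Rightarrow> real \<Rightarrow> real" where
  "stein_h x \<delta> w = 20 * (1 - Phi x) * (1 + x\<^sup>2) * (\<Sum>j\<le>nat \<lfloor>x\<rfloor>. exp (real j * w - (real j)\<^sup>2 / 2))
      + exp (x * (w - x + \<delta>))"

lemma stein_h_nonneg: "0 \<le> stein_h x \<delta> w"
  unfolding stein_h_def using Phi_le_1[of x]
  by (intro add_nonneg_nonneg mult_nonneg_nonneg sum_nonneg) auto

text \<open>There are three ranges. Left of -1 the derivative is at most \<open>1 - Phi x\<close>,
  paid for by the slice \<open>j = 0\<close>. From -1 to \<open>x\<close> the slice containing
  \<open>v\<close> bounds the Gaussian growth. Right of \<open>x\<close> the derivative is at most
  1, and the last exponential is at least 1 because \<open>w\<close> exceeds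
  \<open>x - \<delta>\<close>.\<close>

lemma stein_g'_le_h:
  assumes x: "1 \<le> x" "x * \<delta> \<le> 1" and vw: "\<bar>v - w\<bar> \<le> \<delta>" and "v \<noteq> x"
  shows "stein_g' x v \<le> stein_h x \<delta> w"
proof (cases "v < x")
  case True
  let ?t = "\<lambda>j. exp (real j * w - (real j)\<^sup>2 / 2)"
  define s where "s = (\<Sum>j\<le>nat \<lfloor>x\<rfloor>. ?t j)"
  have t_le: "?t j \<le> s" if "real j \<le> x" for j
    unfolding s_def using that by (intro member_le_sum) (auto simp: le_nat_floor)
  have "(1 + v\<^sup>2) * stein_L v + v \<le> 20 * (1 + x\<^sup>2) * s"
  proof (cases "v < -1")
    case True
    have "1 \<le> s"
      using t_le[of 0] x by simp
    moreover have "1 \<le> 20 * (1 + x\<^sup>2)"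
      by simp
    ultimately have "1 * 1 \<le> 20 * (1 + x\<^sup>2) * s"
      by (intro mult_mono) auto
    then show ?thesis
      using stein_L_bounds(3)[OF True] by simp
  next
    case v: False
    \<comment> \<open>\<open>nat\<close> puts negative \<open>v\<close> into slice 0, still at
      distance at most 1.\<close>
    define j where "j = nat \<lfloor>v\<rfloor>"
    have j: "real j \<le> x" "(v - real j)\<^sup>2 \<le> 1"
    proof -
      show "real j \<le> x"
        unfolding j_def using \<open>v < x\<close> x(1) by linarith
      have "\<bar>v - real j\<bar> \<le> 1"
        unfolding j_def using v by linarith
      then show "(v - real j)\<^sup>2 \<le> 1"
        by (simp add: abs_square_le_1)
    qed
    have "real j * v \<le> real j * w + real j * \<delta>"
      using vw by (simp add: abs_le_iff mult_left_mono flip: distrib_left)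
    also have "real j * \<delta> \<le> x * \<delta>"
      using j vw by (intro mult_right_mono) auto
    finally have jv: "real j * v \<le> real j * w + 1"
      using x by simp
    \<comment> \<open>Completing the square: passing from \<open>v\<close> to \<open>w\<close> costs
      at most \<open>x * \<delta> \<le> 1\<close> and the square at most 1/2, hence the factor
      \<open>exp (3 / 2) \<le> 5\<close>. Times the 4 of \<open>stein_L_bounds\<close>, this is the
      20 in \<open>stein_h\<close>.\<close>
    have "v\<^sup>2 / 2 = real j * v - (real j)\<^sup>2 / 2 + (v - real j)\<^sup>2 / 2"
      by (simp add: power2_eq_square field_simps)
    also have "\<dots> \<le> 3 / 2 + (real j * w - (real j)\<^sup>2 / 2)"
      using jv j by simp
    finally have "exp (v\<^sup>2 / 2) \<le> exp (3 / 2) * ?t j"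
      by (simp flip: exp_add)
    also have "exp (3 / 2 :: real) \<le> 5"
    proof -
      have "exp (3 / 2 :: real) ^ 2 = exp 1 ^ 3"
        by (simp flip: exp_of_nat_mult)
      also have "\<dots> \<le> (272 / 100) ^ 3"
        using e_less_272 by (intro power_mono) auto
      also have "\<dots> \<le> (5::real) ^ 2"
        by (simp add: power_divide)
      finally show ?thesis
        by (rule power2_le_imp_le) simp
    qed
    then have "exp (3 / 2) * ?t j \<le> 5 * s"
      using t_le[OF j(1)] by (intro mult_mono) auto
    finally have ev: "exp (v\<^sup>2 / 2) \<le> 5 * s" .
    have "v\<^sup>2 \<le> x\<^sup>2"
      using v \<open>v < x\<close> x by (intro abs_le_square_iff[THEN iffD1]) auto
    then have "(1 + v\<^sup>2) * exp (v\<^sup>2 / 2) \<le> (1 + x\<^sup>2) * (5 * s)"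
      using ev by (intro mult_mono) auto
    moreover have "(1 + v\<^sup>2) * stein_L v + v \<le> 4 * ((1 + v\<^sup>2) * exp (v\<^sup>2 / 2))"
      by (rule stein_L_bounds(2)) (use v in simp)
    ultimately show ?thesis by (simp add: algebra_simps)
  qed
  then have "(1 - Phi x) * ((1 + v\<^sup>2) * stein_L v + v) \<le> (1 - Phi x) * (20 * (1 + x\<^sup>2) * s)"
    using Phi_le_1[of x] by (intro mult_left_mono) auto
  also have "\<dots> \<le> stein_h x \<delta> w"
    unfolding stein_h_def s_def[symmetric] by (simp add: algebra_simps)
  finally show ?thesis
    using True by (simp add: stein_g'_def)
next
  case False
  then have v: "x < v" using assms by simp
  have "Phi x * ((1 + v\<^sup>2) * stein_U v - v) \<le> 1 * 1"
    by (rule mult_mono) (use stein_U_bounds[of v] Phi_le_1[of x] v x(1) in linarith)+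
  also have "1 * 1 \<le> exp (x * (w - x + \<delta>))"
    using v vw x by simp
  also have "\<dots> \<le> stein_h x \<delta> w"
    unfolding stein_h_def using Phi_le_1[of x]
    by (simp add: sum_nonneg)
  finally show ?thesis
    using v by (simp add: stein_g'_def)
qed

lemma stein_g_increments:
  assumes x: "1 \<le> x" "x * \<delta> \<le> 1" and u: "0 \<le> u" "u \<le> \<delta>"
  shows "stein_g x (w + u) \<le> stein_g x w + u * stein_h x \<delta> w"
    and "stein_g x w - u * stein_h x \<delta> w \<le> stein_g x (w - u)"
proof -
  have "stein_g x (w + u) - stein_g x w \<le> stein_h x \<delta> w * (w + u - w)"
    by (rule increment_le[OF _ stein_g_continuous stein_g_DERIV stein_g'_le_h]) (use assms in auto)
  then show "stein_g x (w + u) \<le> stein_g x w + u * stein_h x \<delta> w"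
    by (simp add: mult.commute)
  have "stein_g x w - stein_g x (w - u) \<le> stein_h x \<delta> w * (w - (w - u))"
    by (rule increment_le[OF _ stein_g_continuous stein_g_DERIV stein_g'_le_h]) (use assms in auto)
  then show "stein_g x w - u * stein_h x \<delta> w \<le> stein_g x (w - u)"
    by (simp add: mult.commute)
qed

text \<open>Converts Gaussian factors left over from exponential moments into multiples of the tail.
  The 6 is 3, a bound for \<open>sqrt (2 * pi)\<close>, times 2 from
  \<open>x / (1 + x\<^sup>2) \<ge> 1 / (2 * x)\<close>.\<close>

lemma exp_le_1_minus_Phi:
  assumes "1 \<le> x"
  shows "exp (- x\<^sup>2 / 2) \<le> 6 * x * (1 - Phi x)"
proof -
  have "gauss_inv x * (1 - Phi x) \<ge> x / (1 + x\<^sup>2)"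
    using stein_U_ge[of x] by (simp add: stein_U_def)
  moreover have "gauss_inv x * (1 - Phi x) \<le> 3 * exp (x\<^sup>2 / 2) * (1 - Phi x)"
    using gauss_inv_le[of x] Phi_le_1[of x] by (intro mult_right_mono) auto
  moreover have "1 / (2 * x) \<le> x / (1 + x\<^sup>2)"
  proof -
    have "1 * 1 \<le> x * x"
      using assms by (intro mult_mono) auto
    moreover have "0 < 1 + x\<^sup>2"
      by (simp add: add_pos_nonneg)
    ultimately show ?thesis
      using assms by (simp add: field_simps power2_eq_square)
  qed
  ultimately have "1 / (2 * x) \<le> 3 * exp (x\<^sup>2 / 2) * (1 - Phi x)"
    by linarith
  then have "1 \<le> 6 * x * (1 - Phi x) * exp (x\<^sup>2 / 2)"
    using assms by (simp add: field_simps)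
  then have "exp (- x\<^sup>2 / 2) * 1 \<le> exp (- x\<^sup>2 / 2) * (6 * x * (1 - Phi x) * exp (x\<^sup>2 / 2))"
    by (intro mult_left_mono) auto
  also have "\<dots> = 6 * x * (1 - Phi x) * (exp (- x\<^sup>2 / 2) * exp (x\<^sup>2 / 2))"
    by (simp only: mult_ac)
  also have "exp (- x\<^sup>2 / 2) * exp (x\<^sup>2 / 2) = 1"
    by (simp flip: exp_add)
  finally show ?thesis by simp
qed

section \<open>Moderate deviations of independent sums\<close>

lemma exp_cubic_bound:
  fixes y :: real
  assumes "\<bar>y\<bar> \<le> 1"
  shows "exp y \<le> 1 + y + y\<^sup>2 / 2 + \<bar>y\<bar> ^ 3"
proof -
  obtain t where t: "\<bar>t\<bar> \<le> \<bar>y\<bar>" "exp y = (\<Sum>m<3. y ^ m / fact m) + exp t / fact 3 * y ^ 3"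
    using Maclaurin_exp_le[of y 3] by blast
  have "exp t \<le> exp 1"
    using t assms by simp
  also have "exp 1 \<le> (6::real)"
    using e_less_272 by simp
  finally have "exp t / fact 3 \<le> 1"
    by (simp add: fact_numeral)
  then have "exp t / fact 3 * \<bar>y\<bar> ^ 3 \<le> 1 * \<bar>y\<bar> ^ 3"
    by (intro mult_right_mono) auto
  moreover have "exp t / fact 3 * y ^ 3 \<le> exp t / fact 3 * \<bar>y\<bar> ^ 3"
    using abs_ge_self[of "y ^ 3"] by (intro mult_left_mono) (auto simp: power_abs)
  ultimately have "exp t / fact 3 * y ^ 3 \<le> \<bar>y\<bar> ^ 3"
    by linarith
  then show ?thesis
    using t(2) by (simp add: numeral_3_eq_3 numeral_2_eq_2)
qed

text \<open>A correlation inequality, from averaging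
  \<open>(|f S| - t)\<^sup>2 * (|f S| + t) \<ge> 0\<close> with \<open>t\<close> the mean of
  \<open>|f|\<close>. It charges the error of leaving one summand out of a sum to third
  moments.\<close>

lemma avg_abs_mult_square_le:
  assumes "finite A"
  shows "avg A (\<lambda>S. \<bar>f S\<bar>) * avg A (\<lambda>S. (f S)\<^sup>2) \<le> avg A (\<lambda>S. \<bar>f S\<bar> ^ 3)"
proof -
  define t where "t = avg A (\<lambda>S. \<bar>f S\<bar>)"
  have t: "0 \<le> t"
    unfolding t_def by (rule avg_nonneg) auto
  have "0 \<le> avg A (\<lambda>S. \<bar>f S\<bar> ^ 3 - t\<^sup>2 * \<bar>f S\<bar> - t * (f S)\<^sup>2 + t ^ 3)"
  proof (rule avg_nonneg)
    fix S
    have "0 \<le> (\<bar>f S\<bar> - t)\<^sup>2 * (\<bar>f S\<bar> + t)"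
      using t by simp
    also have "\<dots> = \<bar>f S\<bar> ^ 3 - t\<^sup>2 * \<bar>f S\<bar> - t * \<bar>f S\<bar>\<^sup>2 + t ^ 3"
      by (simp add: power2_eq_square power3_eq_cube algebra_simps)
    finally show "0 \<le> \<bar>f S\<bar> ^ 3 - t\<^sup>2 * \<bar>f S\<bar> - t * (f S)\<^sup>2 + t ^ 3"
      by simp
  qed
  also have "\<dots> = avg A (\<lambda>S. \<bar>f S\<bar> ^ 3) - t\<^sup>2 * t - t * avg A (\<lambda>S. (f S)\<^sup>2) + t ^ 3"
    using assms by (simp add: avg_add avg_diff avg_cmult t_def)
  finally show ?thesis
    by (simp add: t_def power2_eq_square power3_eq_cube)
qed

text \<open>The two parameters enter the conclusions differently: \<delta> moves the threshold,
  while the third-moment sum \<beta> gives the relative error.\<close>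

locale small_indep_sum =
  fixes A :: "'e set" and I :: "'i set" and F :: "'i \<Rightarrow> 'e set"
    and \<xi> :: "'i \<Rightarrow> 'e set \<Rightarrow> real" and \<delta> \<beta> :: real
  assumes finite_A: "finite A" and finite_I: "finite I"
    and dep: "\<And>i. i \<in> I \<Longrightarrow> depends_on (F i) (\<xi> i)"
    and disj: "disjoint_family_on F I"
    and mean: "\<And>i. i \<in> I \<Longrightarrow> avg A (\<xi> i) = 0"
    and variance: "(\<Sum>i\<in>I. avg A (\<lambda>S. (\<xi> i S)\<^sup>2)) = 1"
    and small: "\<And>i S. i \<in> I \<Longrightarrow> \<bar>\<xi> i S\<bar> \<le> \<delta>"
    and third: "(\<Sum>i\<in>I. avg A (\<lambda>S. \<bar>\<xi> i S\<bar> ^ 3)) \<le> \<beta>"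
begin

definition W :: "'e set \<Rightarrow> real" where "W S = (\<Sum>i\<in>I. \<xi> i S)"
definition W' :: "'i \<Rightarrow> 'e set \<Rightarrow> real" where "W' i S = (\<Sum>j\<in>I - {i}. \<xi> j S)"
definition \<sigma>2 :: "'i \<Rightarrow> real" where "\<sigma>2 i = avg A (\<lambda>S. (\<xi> i S)\<^sup>2)"
definition \<tau> :: "'i \<Rightarrow> real" where "\<tau> i = avg A (\<lambda>S. \<bar>\<xi> i S\<bar> ^ 3)"

lemma I_nonempty: "I \<noteq> {}"
  using variance by auto

lemma delta_nonneg: "0 \<le> \<delta>"
  using I_nonempty small by (metis abs_ge_zero all_not_in_conv order_trans)

lemma W_eq: "i \<in> I \<Longrightarrow> W S = W' i S + \<xi> i S"
  unfolding W_def W'_def using finite_I by (subst sum.remove) auto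

lemma sigma2_nonneg: "0 \<le> \<sigma>2 i"
  unfolding \<sigma>2_def by (rule avg_nonneg) auto

lemma tau_nonneg: "0 \<le> \<tau> i"
  unfolding \<tau>_def by (rule avg_nonneg) auto

lemma beta_nonneg: "0 \<le> \<beta>"
  using third sum_nonneg[of I \<tau>] tau_nonneg by (simp add: \<tau>_def)

lemma sum_sigma2: "sum \<sigma>2 I = 1"
  using variance by (simp add: \<sigma>2_def)

lemma sum_tau: "sum \<tau> I \<le> \<beta>"
  using third by (simp add: \<tau>_def)

lemma indep_W':
  assumes "i \<in> I"
  shows "avg A (\<lambda>S. p (\<xi> i S) * q (W' i S)) = avg A (\<lambda>S. p (\<xi> i S)) * avg A (\<lambda>S. q (W' i S))"
proof (rule avg_mult_indep[OF finite_A])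
  show "depends_on (F i) (\<lambda>S. p (\<xi> i S))"
    by (rule depends_on_comp) (rule dep[OF assms])
  have "depends_on (\<Union>j\<in>I - {i}. F j) (W' i)"
    unfolding W'_def[abs_def]
    by (rule depends_on_sum, rule depends_on_mono[OF dep]) auto
  then show "depends_on (\<Union>j\<in>I - {i}. F j) (\<lambda>S. q (W' i S))"
    by (rule depends_on_comp)
  show "F i \<inter> (\<Union>j\<in>I - {i}. F j) = {}"
    using disj assms by (fastforce simp: disjoint_family_on_def)
qed

lemma mgf_component:
  assumes "i \<in> I" "0 \<le> s" "s * \<delta> \<le> 1"
  shows "avg A (\<lambda>S. exp (s * \<xi> i S)) \<le> exp (s\<^sup>2 / 2 * \<sigma>2 i + s ^ 3 * \<tau> i)"
proof -
  have "avg A (\<lambda>S. exp (s * \<xi> i S)) \<le>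
      avg A (\<lambda>S. 1 + s * \<xi> i S + s\<^sup>2 / 2 * (\<xi> i S)\<^sup>2 + s ^ 3 * \<bar>\<xi> i S\<bar> ^ 3)"
  proof (rule avg_mono)
    fix S
    have "\<bar>s * \<xi> i S\<bar> \<le> s * \<delta>"
      using assms small by (simp add: abs_mult mult_left_mono)
    then have "\<bar>s * \<xi> i S\<bar> \<le> 1"
      using assms by simp
    from exp_cubic_bound[OF this] assms(2)
    show "exp (s * \<xi> i S) \<le> 1 + s * \<xi> i S + s\<^sup>2 / 2 * (\<xi> i S)\<^sup>2 + s ^ 3 * \<bar>\<xi> i S\<bar> ^ 3"
      by (simp add: abs_mult power_mult_distrib)
  qed
  also have "\<dots> = 1 + (s\<^sup>2 / 2 * \<sigma>2 i + s ^ 3 * \<tau> i)"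
    unfolding avg_add avg_cmult \<sigma>2_def \<tau>_def using finite_A mean[OF assms(1)] by simp
  also have "\<dots> \<le> exp (s\<^sup>2 / 2 * \<sigma>2 i + s ^ 3 * \<tau> i)"
    by (rule exp_ge_add_one_self)
  finally show ?thesis .
qed

lemma mgf_W':
  assumes "0 \<le> s" "s * \<delta> \<le> 1" "s ^ 3 * \<beta> \<le> 1"
  shows "avg A (\<lambda>S. exp (s * W' i S)) \<le> exp (s\<^sup>2 / 2 + 1)"
proof -
  have "avg A (\<lambda>S. exp (s * W' i S)) = (\<Prod>j\<in>I - {i}. avg A (\<lambda>S. exp (s * \<xi> j S)))"
    unfolding W'_def sum_distrib_left
    by (rule avg_exp_sum_indep[where F = F])
      (use finite_A finite_I disj in \<open>auto intro!: depends_on_comp[OF dep] simp: disjoint_family_on_def\<close>)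
  also have "\<dots> \<le> (\<Prod>j\<in>I - {i}. exp (s\<^sup>2 / 2 * \<sigma>2 j + s ^ 3 * \<tau> j))"
    using assms by (intro prod_mono conjI mgf_component avg_nonneg) auto
  also have "\<dots> = exp (\<Sum>j\<in>I - {i}. s\<^sup>2 / 2 * \<sigma>2 j + s ^ 3 * \<tau> j)"
    using finite_I by (simp add: exp_sum)
  also have "\<dots> \<le> exp (s\<^sup>2 / 2 * sum \<sigma>2 I + s ^ 3 * sum \<tau> I)"
    unfolding sum_distrib_left sum.distrib[symmetric] exp_le_cancel_iff
    using finite_I assms sigma2_nonneg tau_nonneg
    by (intro sum_mono2) auto
  also have "\<dots> \<le> exp (s\<^sup>2 / 2 + 1)"
    using assms mult_left_mono[OF sum_tau, of "s ^ 3"] by (simp add: sum_sigma2)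
  finally show ?thesis .
qed

text \<open>In each slice the shift by half of the square of \<open>j\<close> cancels the Gaussian
  moment generating function and leaves at most e. There are at most \<open>2 * x\<close> slices, so
  with the prefactor their order is \<open>(1 - Phi x) * x ^ 3\<close>. The remaining exponential
  has mean of order \<open>exp (- x\<^sup>2 / 2)\<close>, again comparable to the tail.\<close>

lemma avg_stein_h:
  assumes x: "1 \<le> x" "x * \<delta> \<le> 1" "x ^ 3 * \<beta> \<le> 1"
  shows "avg A (\<lambda>S. stein_h x \<delta> (W' i S)) \<le> 300 * (1 - Phi x) * x ^ 3"
proof -
  define q where "q = 1 - Phi x"
  have q: "0 \<le> q"
    using Phi_le_1 by (simp add: q_def)
  have mgf: "avg A (\<lambda>S. exp (s * W' i S)) \<le> exp (s\<^sup>2 / 2 + 1)" if "0 \<le> s" "s \<le> x" for s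
  proof (rule mgf_W')
    show "s * \<delta> \<le> 1"
      using mult_right_mono[OF that(2) delta_nonneg] x by simp
    show "s ^ 3 * \<beta> \<le> 1"
      using mult_right_mono[OF power_mono[OF that(2,1), of 3] beta_nonneg] x by simp
  qed (rule that)
  have e: "exp 1 \<le> (3::real)"
    using e_less_272 by simp
  have slice: "avg A (\<lambda>S. exp (real j * W' i S - (real j)\<^sup>2 / 2)) \<le> 3" if "j \<le> nat \<lfloor>x\<rfloor>" for j
  proof -
    have "real j \<le> x"
      using that x by linarith
    have "avg A (\<lambda>S. exp (real j * W' i S - (real j)\<^sup>2 / 2))
        = exp (- (real j)\<^sup>2 / 2) * avg A (\<lambda>S. exp (real j * W' i S))"
      unfolding avg_cmult[symmetric] by (intro avg_cong) (simp flip: exp_add)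
    also have "\<dots> \<le> exp (- (real j)\<^sup>2 / 2) * exp ((real j)\<^sup>2 / 2 + 1)"
      using mgf[of "real j"] \<open>real j \<le> x\<close> by (intro mult_left_mono) auto
    also have "\<dots> = exp 1"
      by (simp flip: exp_add)
    finally show ?thesis using e by simp
  qed
  have "(\<Sum>j\<le>nat \<lfloor>x\<rfloor>. avg A (\<lambda>S. exp (real j * W' i S - (real j)\<^sup>2 / 2))) \<le> real (card {..nat \<lfloor>x\<rfloor>}) * 3"
    by (rule sum_bounded_above) (use slice in auto)
  also have "\<dots> \<le> (2 * x) * 3"
    using x(1) by simp linarith
  finally have 1: "(\<Sum>j\<le>nat \<lfloor>x\<rfloor>. avg A (\<lambda>S. exp (real j * W' i S - (real j)\<^sup>2 / 2))) \<le> 6 * x"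
    by simp
  have "avg A (\<lambda>S. exp (x * (W' i S - x + \<delta>))) = exp (x * (\<delta> - x)) * avg A (\<lambda>S. exp (x * W' i S))"
    unfolding avg_cmult[symmetric] by (intro avg_cong) (simp add: algebra_simps flip: exp_add)
  also have "\<dots> \<le> exp (x * (\<delta> - x)) * exp (x\<^sup>2 / 2 + 1)"
    using x by (intro mult_left_mono mgf) auto
  also have "\<dots> = exp (x * \<delta> + 1 - x\<^sup>2 / 2)"
    by (simp add: algebra_simps power2_eq_square flip: exp_add)
  also have "\<dots> \<le> exp (2 + - x\<^sup>2 / 2)"
    using x by simp
  also have "\<dots> = exp 1 * exp 1 * exp (- x\<^sup>2 / 2)"
    unfolding exp_add by (simp flip: exp_add)
  also have "\<dots> \<le> 3 * 3 * (6 * x * q)"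
    unfolding q_def by (intro mult_mono e exp_le_1_minus_Phi x(1)) auto
  finally have 2: "avg A (\<lambda>S. exp (x * (W' i S - x + \<delta>))) \<le> 54 * q * x"
    by (simp add: mult_ac)
  have "avg A (\<lambda>S. stein_h x \<delta> (W' i S)) = 20 * q * (1 + x\<^sup>2) *
      (\<Sum>j\<le>nat \<lfloor>x\<rfloor>. avg A (\<lambda>S. exp (real j * W' i S - (real j)\<^sup>2 / 2)))
      + avg A (\<lambda>S. exp (x * (W' i S - x + \<delta>)))"
    unfolding stein_h_def avg_add avg_cmult avg_sum q_def ..
  also have "\<dots> \<le> 20 * q * (1 + x\<^sup>2) * (6 * x) + 54 * q * x"
    using 1 2 q by (intro add_mono mult_left_mono) auto
  also have "\<dots> = q * (120 * (x * x\<^sup>2) + 174 * x)"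
    by (simp add: algebra_simps)
  \<comment> \<open>120 + 174 = 294, as \<open>x \<le> x ^ 3\<close>.\<close>
  also have "\<dots> \<le> q * (300 * x ^ 3)"
  proof -
    have "x * 1 \<le> x * x\<^sup>2"
      using x(1) by (intro mult_left_mono one_le_power) auto
    then show ?thesis
      using q x(1) by (intro mult_left_mono) (auto simp: power2_eq_square power3_eq_cube)
  qed
  finally show ?thesis
    by (simp add: q_def algebra_simps)
qed

text \<open>The subtracted term has mean zero, because \<open>\<xi> i\<close> is centred and
  independent of \<open>W' i\<close>.\<close>

lemma avg_W_stein_f: "avg A (\<lambda>S. stein_g x (W S))
    = (\<Sum>i\<in>I. avg A (\<lambda>S. \<xi> i S * (stein_f x (W' i S + \<xi> i S) - stein_f x (W' i S))))"
proof -
  have "avg A (\<lambda>S. stein_g x (W S)) = (\<Sum>i\<in>I. avg A (\<lambda>S. \<xi> i S * stein_f x (W S)))"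
    unfolding avg_sum[symmetric] stein_g_def W_def sum_distrib_right ..
  also have "\<dots> = (\<Sum>i\<in>I. avg A (\<lambda>S. \<xi> i S * (stein_f x (W' i S + \<xi> i S) - stein_f x (W' i S))))"
  proof (rule sum.cong[OF refl])
    fix i assume i: "i \<in> I"
    have "avg A (\<lambda>S. \<xi> i S * stein_f x (W' i S)) = 0"
      using indep_W'[OF i, of "\<lambda>u. u" "stein_f x"] mean[OF i] by simp
    then show "avg A (\<lambda>S. \<xi> i S * stein_f x (W S)) =
        avg A (\<lambda>S. \<xi> i S * (stein_f x (W' i S + \<xi> i S) - stein_f x (W' i S)))"
      by (simp add: right_diff_distrib avg_diff W_eq[OF i])
  qed
  finally show ?thesis .
qed

definition err :: "real \<Rightarrow> real" where
  "err x = 600 * \<beta> * ((1 - Phi x) * x ^ 3)"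

text \<open>The first term is the remainder of an increment, the second the price of exchanging
  \<open>W' i\<close> and \<open>W\<close>. The correlation inequality bounds the second by
  \<open>\<tau> i\<close> as well, whence 600 = 2 * 300.\<close>

lemma sum_error_le:
  assumes x: "1 \<le> x" "x * \<delta> \<le> 1" "x ^ 3 * \<beta> \<le> 1"
  shows "(\<Sum>i\<in>I. (\<tau> i + \<sigma>2 i * avg A (\<lambda>S. \<bar>\<xi> i S\<bar>)) * avg A (\<lambda>S. stein_h x \<delta> (W' i S))) \<le> err x"
proof -
  define H where "H = 300 * (1 - Phi x) * x ^ 3"
  have H: "0 \<le> H"
    using x Phi_le_1[of x] by (simp add: H_def)
  have "(\<Sum>i\<in>I. (\<tau> i + \<sigma>2 i * avg A (\<lambda>S. \<bar>\<xi> i S\<bar>)) * avg A (\<lambda>S. stein_h x \<delta> (W' i S))) \<le> (\<Sum>i\<in>I. (2 * H) * \<tau> i)"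
  proof (rule sum_mono)
    fix i assume "i \<in> I"
    have "\<sigma>2 i * avg A (\<lambda>S. \<bar>\<xi> i S\<bar>) \<le> \<tau> i"
      using avg_abs_mult_square_le[OF finite_A, of "\<xi> i"] by (simp add: \<sigma>2_def \<tau>_def mult.commute)
    then have "(\<tau> i + \<sigma>2 i * avg A (\<lambda>S. \<bar>\<xi> i S\<bar>)) * avg A (\<lambda>S. stein_h x \<delta> (W' i S)) \<le> (2 * \<tau> i) * H"
      unfolding H_def using tau_nonneg[of i] avg_stein_h[OF x]
      by (intro mult_mono avg_nonneg stein_h_nonneg) auto
    then show "(\<tau> i + \<sigma>2 i * avg A (\<lambda>S. \<bar>\<xi> i S\<bar>)) * avg A (\<lambda>S. stein_h x \<delta> (W' i S)) \<le> (2 * H) * \<tau> i"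
      by (simp add: mult_ac)
  qed
  also have "\<dots> = (2 * H) * sum \<tau> I"
    by (simp add: sum_distrib_left)
  also have "\<dots> \<le> (2 * H) * \<beta>"
    using H sum_tau by (intro mult_left_mono) auto
  finally show ?thesis
    by (simp add: H_def err_def algebra_simps)
qed

text \<open>The unknown mean \<open>G\<close> of \<open>stein_g x (W S)\<close> occurs on both
  sides: on the left by Stein's identity, on the right because the variances sum to 1. It cancels,
  and only \<open>Phi x - P\<close> and the error remain. One \<delta> of the shift comes from the
  indicator in the increment bound, the other from replacing \<open>W' i\<close> by
  \<open>W\<close>.\<close>

lemma lower_shift:
  assumes x: "1 \<le> x" "x * \<delta> \<le> 1" "x ^ 3 * \<beta> \<le> 1"
  shows "Phi x - err x \<le> avg A (\<lambda>S. of_bool (W S \<le> x + 2 * \<delta>))"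
proof -
  define P where "P = avg A (\<lambda>S. of_bool (W S \<le> x + 2 * \<delta>))"
  define G where "G = avg A (\<lambda>S. stein_g x (W S))"
  define h where "h = (\<lambda>i. avg A (\<lambda>S. stein_h x \<delta> (W' i S)))"
  define a where "a = (\<lambda>i. avg A (\<lambda>S. \<bar>\<xi> i S\<bar>))"
  have "G = (\<Sum>i\<in>I. avg A (\<lambda>S. \<xi> i S * (stein_f x (W' i S + \<xi> i S) - stein_f x (W' i S))))"
    unfolding G_def by (rule avg_W_stein_f)
  also have "\<dots> \<le> (\<Sum>i\<in>I. \<sigma>2 i * (G + P - Phi x) + (\<tau> i + \<sigma>2 i * a i) * h i)"
  proof (rule sum_mono)
    fix i assume i: "i \<in> I"
    let ?w = "W' i" and ?u = "\<xi> i"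
    define g where "g = avg A (\<lambda>S. stein_g x (?w S))"
    define p where "p = avg A (\<lambda>S. of_bool (?w S \<le> x + \<delta>))"
    have "avg A (\<lambda>S. ?u S * (stein_f x (?w S + ?u S) - stein_f x (?w S)))
        \<le> avg A (\<lambda>S. (?u S)\<^sup>2 * (stein_g x (?w S) + of_bool (?w S \<le> x + \<delta>) - Phi x)
            + \<bar>?u S\<bar> ^ 3 * stein_h x \<delta> (?w S))"
    proof (rule avg_mono)
      fix S
      have "?u S * (stein_f x (?w S + ?u S) - stein_f x (?w S))
          \<le> (?u S)\<^sup>2 * (stein_g x (?w S + \<bar>?u S\<bar>) + of_bool (?w S \<le> x + \<delta>) - Phi x)"
        by (rule stein_increment_le) (rule small[OF i])
      also have "\<dots> \<le> (?u S)\<^sup>2 * (stein_g x (?w S) + \<bar>?u S\<bar> * stein_h x \<delta> (?w S) + of_bool (?w S \<le> x + \<delta>) - Phi x)"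
        using stein_g_increments(1)[OF x(1,2), of "\<bar>?u S\<bar>" "?w S"] small[OF i]
        by (intro mult_left_mono) auto
      also have "\<dots> = (?u S)\<^sup>2 * (stein_g x (?w S) + of_bool (?w S \<le> x + \<delta>) - Phi x)
            + (\<bar>?u S\<bar>\<^sup>2 * \<bar>?u S\<bar>) * stein_h x \<delta> (?w S)"
        by (simp add: algebra_simps)
      finally show "?u S * (stein_f x (?w S + ?u S) - stein_f x (?w S)) \<le>
          (?u S)\<^sup>2 * (stein_g x (?w S) + of_bool (?w S \<le> x + \<delta>) - Phi x)
            + \<bar>?u S\<bar> ^ 3 * stein_h x \<delta> (?w S)"
        by (simp add: power3_eq_cube power2_eq_square)
    qed
    also have "\<dots> = \<sigma>2 i * (g + p - Phi x) + \<tau> i * h i"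
      unfolding avg_add
      using indep_W'[OF i, of "\<lambda>u. u\<^sup>2" "\<lambda>w. stein_g x w + of_bool (w \<le> x + \<delta>) - Phi x"]
        indep_W'[OF i, of "\<lambda>u. \<bar>u\<bar> ^ 3" "stein_h x \<delta>"] finite_A
      by (simp add: avg_add avg_diff \<sigma>2_def \<tau>_def g_def p_def h_def)
    also have "\<dots> \<le> \<sigma>2 i * (G + a i * h i + P - Phi x) + \<tau> i * h i"
    proof -
      have "p \<le> P"
        unfolding p_def P_def using small[OF i]
        by (intro avg_mono) (use small[OF i] in \<open>auto simp: W_eq[OF i] abs_le_iff, smt (verit)\<close>)
      \<comment> \<open>Independence factors the mean of \<open>|\<xi> i|\<close> times
        \<open>stein_h\<close> at \<open>W' i\<close>.\<close>
      moreover have "g \<le> G + a i * h i"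
      proof -
        have "g - a i * h i = avg A (\<lambda>S. stein_g x (?w S) - \<bar>?u S\<bar> * stein_h x \<delta> (?w S))"
          unfolding avg_diff using indep_W'[OF i, of abs "stein_h x \<delta>"] by (simp add: g_def a_def h_def)
        also have "\<dots> \<le> G"
          unfolding G_def
        proof (rule avg_mono)
          fix S
          have "stein_g x (?w S) - \<bar>?u S\<bar> * stein_h x \<delta> (?w S) \<le> stein_g x (?w S - \<bar>?u S\<bar>)"
            by (rule stein_g_increments(2)[OF x(1,2)]) (use small[OF i] in auto)
          also have "\<dots> \<le> stein_g x (W S)"
            by (rule stein_g_mono) (auto simp: W_eq[OF i])
          finally show "stein_g x (?w S) - \<bar>?u S\<bar> * stein_h x \<delta> (?w S) \<le> stein_g x (W S)" .
        qed
        finally show ?thesis by simp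
      qed
      ultimately show ?thesis
        using sigma2_nonneg[of i] by (intro add_right_mono mult_left_mono) auto
    qed
    finally show "avg A (\<lambda>S. ?u S * (stein_f x (?w S + ?u S) - stein_f x (?w S)))
        \<le> \<sigma>2 i * (G + P - Phi x) + (\<tau> i + \<sigma>2 i * a i) * h i"
      by (simp add: algebra_simps)
  qed
  also have "\<dots> = (G + P - Phi x) + (\<Sum>i\<in>I. (\<tau> i + \<sigma>2 i * a i) * h i)"
    unfolding sum.distrib sum_distrib_right[symmetric] sum_sigma2 by simp
  finally show ?thesis
    using sum_error_le[OF x] by (simp add: P_def a_def h_def)
qed

text \<open>The mirror image, with the lower increment bound; again \<open>G\<close>
  cancels.\<close>

lemma upper_shift:
  assumes x: "1 \<le> x" "x * \<delta> \<le> 1" "x ^ 3 * \<beta> \<le> 1"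
  shows "avg A (\<lambda>S. of_bool (W S \<le> x - 2 * \<delta>)) \<le> Phi x + err x"
proof -
  define P where "P = avg A (\<lambda>S. of_bool (W S \<le> x - 2 * \<delta>))"
  define G where "G = avg A (\<lambda>S. stein_g x (W S))"
  define h where "h = (\<lambda>i. avg A (\<lambda>S. stein_h x \<delta> (W' i S)))"
  define a where "a = (\<lambda>i. avg A (\<lambda>S. \<bar>\<xi> i S\<bar>))"
  have "(\<Sum>i\<in>I. \<sigma>2 i * (G + P - Phi x) - (\<tau> i + \<sigma>2 i * a i) * h i)
      \<le> (\<Sum>i\<in>I. avg A (\<lambda>S. \<xi> i S * (stein_f x (W' i S + \<xi> i S) - stein_f x (W' i S))))"
  proof (rule sum_mono)
    fix i assume i: "i \<in> I"
    let ?w = "W' i" and ?u = "\<xi> i"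
    define g where "g = avg A (\<lambda>S. stein_g x (?w S))"
    define p where "p = avg A (\<lambda>S. of_bool (?w S \<le> x - \<delta>))"
    have "\<sigma>2 i * (G + P - Phi x) - (\<tau> i + \<sigma>2 i * a i) * h i
        = \<sigma>2 i * (G - a i * h i + P - Phi x) - \<tau> i * h i"
      by (simp add: algebra_simps)
    also have "\<dots> \<le> \<sigma>2 i * (g + p - Phi x) - \<tau> i * h i"
    proof -
      have "P \<le> p"
        unfolding p_def P_def using small[OF i]
        by (intro avg_mono) (use small[OF i] in \<open>auto simp: W_eq[OF i] abs_le_iff, smt (verit)\<close>)
      moreover have "G \<le> g + a i * h i"
      proof -
        have "G \<le> avg A (\<lambda>S. stein_g x (?w S) + \<bar>?u S\<bar> * stein_h x \<delta> (?w S))"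
          unfolding G_def
        proof (rule avg_mono)
          fix S
          have "stein_g x (W S) \<le> stein_g x (?w S + \<bar>?u S\<bar>)"
            by (rule stein_g_mono) (auto simp: W_eq[OF i])
          also have "\<dots> \<le> stein_g x (?w S) + \<bar>?u S\<bar> * stein_h x \<delta> (?w S)"
            by (rule stein_g_increments(1)[OF x(1,2)]) (use small[OF i] in auto)
          finally show "stein_g x (W S) \<le> stein_g x (?w S) + \<bar>?u S\<bar> * stein_h x \<delta> (?w S)" .
        qed
        also have "\<dots> = g + a i * h i"
          unfolding avg_add using indep_W'[OF i, of abs "stein_h x \<delta>"] by (simp add: g_def a_def h_def)
        finally show ?thesis by simp
      qed
      ultimately show ?thesis
        using sigma2_nonneg[of i] by (intro diff_right_mono mult_left_mono) auto
    qed
    also have "\<dots> = avg A (\<lambda>S. (?u S)\<^sup>2 * (stein_g x (?w S) + of_bool (?w S \<le> x - \<delta>) - Phi x)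
            - \<bar>?u S\<bar> ^ 3 * stein_h x \<delta> (?w S))"
      unfolding avg_diff
      using indep_W'[OF i, of "\<lambda>u. u\<^sup>2" "\<lambda>w. stein_g x w + of_bool (w \<le> x - \<delta>) - Phi x"]
        indep_W'[OF i, of "\<lambda>u. \<bar>u\<bar> ^ 3" "stein_h x \<delta>"] finite_A
      by (simp add: avg_add avg_diff \<sigma>2_def \<tau>_def g_def p_def h_def)
    also have "\<dots> \<le> avg A (\<lambda>S. ?u S * (stein_f x (?w S + ?u S) - stein_f x (?w S)))"
    proof (rule avg_mono)
      fix S
      have "(?u S)\<^sup>2 * (stein_g x (?w S) + of_bool (?w S \<le> x - \<delta>) - Phi x)
            - \<bar>?u S\<bar> ^ 3 * stein_h x \<delta> (?w S)
          = (?u S)\<^sup>2 * (stein_g x (?w S) - \<bar>?u S\<bar> * stein_h x \<delta> (?w S) + of_bool (?w S \<le> x - \<delta>) - Phi x)"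
      proof -
        have "\<bar>?u S\<bar> ^ 3 = (?u S)\<^sup>2 * \<bar>?u S\<bar>"
          by (simp add: power3_eq_cube power2_eq_square)
        then show ?thesis by (simp add: algebra_simps)
      qed
      also have "\<dots> \<le> (?u S)\<^sup>2 * (stein_g x (?w S - \<bar>?u S\<bar>) + of_bool (?w S \<le> x - \<delta>) - Phi x)"
        using stein_g_increments(2)[OF x(1,2), of "\<bar>?u S\<bar>" "?w S"] small[OF i]
        by (intro mult_left_mono) auto
      also have "\<dots> \<le> ?u S * (stein_f x (?w S + ?u S) - stein_f x (?w S))"
        by (rule stein_increment_ge) (rule small[OF i])
      finally show "(?u S)\<^sup>2 * (stein_g x (?w S) + of_bool (?w S \<le> x - \<delta>) - Phi x)
            - \<bar>?u S\<bar> ^ 3 * stein_h x \<delta> (?w S) \<le> ?u S * (stein_f x (?w S + ?u S) - stein_f x (?w S))" .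
    qed
    finally show "\<sigma>2 i * (G + P - Phi x) - (\<tau> i + \<sigma>2 i * a i) * h i
        \<le> avg A (\<lambda>S. ?u S * (stein_f x (?w S + ?u S) - stein_f x (?w S)))"
      .
  qed
  moreover have "(\<Sum>i\<in>I. avg A (\<lambda>S. \<xi> i S * (stein_f x (W' i S + \<xi> i S) - stein_f x (W' i S)))) = G"
    unfolding G_def by (rule avg_W_stein_f[symmetric])
  moreover have "(\<Sum>i\<in>I. \<sigma>2 i * (G + P - Phi x) - (\<tau> i + \<sigma>2 i * a i) * h i)
      = (G + P - Phi x) - (\<Sum>i\<in>I. (\<tau> i + \<sigma>2 i * a i) * h i)"
    unfolding sum_subtractf sum_distrib_right[symmetric] sum_sigma2 by simp
  ultimately show ?thesis
    using sum_error_le[OF x] by (simp add: P_def a_def h_def)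
qed

lemma avg_not: "avg A (\<lambda>S. of_bool (\<not> P S)) = 1 - avg A (\<lambda>S. of_bool (P S))"
  using finite_A by (simp add: of_bool_not_iff avg_diff)

theorem tail_upper:
  assumes x: "1 \<le> x" "x * \<delta> \<le> 1" "x ^ 3 * \<beta> \<le> 1"
  shows "avg A (\<lambda>S. of_bool (x + 2 * \<delta> < W S)) \<le> (1 - Phi x) * (1 + 600 * \<beta> * x ^ 3)"
  using lower_shift[OF x] avg_not[of "\<lambda>S. W S \<le> x + 2 * \<delta>"]
  by (simp add: err_def not_le algebra_simps)

theorem tail_lower:
  assumes x: "1 \<le> x" "x * \<delta> \<le> 1" "x ^ 3 * \<beta> \<le> 1"
  shows "(1 - Phi x) * (1 - 600 * \<beta> * x ^ 3) \<le> avg A (\<lambda>S. of_bool (x - 2 * \<delta> < W S))"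
  using upper_shift[OF x] avg_not[of "\<lambda>S. W S \<le> x - 2 * \<delta>"]
  by (simp add: err_def not_le algebra_simps)

end

section \<open>Perturbed independent sums\<close>

text \<open>Lets the concentration bound see only the edges of one block instead of all of
  \<open>A\<close>.\<close>

lemma avg_restrict:
  assumes "finite A" "depends_on F f"
  shows "avg A f = avg (A \<inter> F) f"
proof -
  have "avg (B \<union> C) f = avg B f" if "finite B" "finite C" "B \<inter> C = {}" "C \<inter> F = {}" for B C
    using that(2,3,4)
  proof (induction C rule: finite_induct)
    case (insert e C)
    have "f (insert e S) = f S" for S
      using depends_on_insert_iff[OF assms(2)] insert.prems by auto
    then have "avg (insert e (B \<union> C)) f = avg (B \<union> C) f"
      using insert that(1) by (subst avg_insert) auto
    then show ?case
      using insert by auto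
  qed simp
  from this[of "A \<inter> F" "A - F"] assms(1) have "avg (A \<inter> F \<union> (A - F)) f = avg (A \<inter> F) f"
    by blast
  moreover have "A \<inter> F \<union> (A - F) = A"
    by auto
  ultimately show ?thesis by simp
qed

definition sd :: "'e set \<Rightarrow> ('e set \<Rightarrow> real) \<Rightarrow> real" where
  "sd A f = sqrt (avg A (\<lambda>S. (f S - avg A f)\<^sup>2))"

lemma sd_square: "(sd A f)\<^sup>2 = avg A (\<lambda>S. (f S - avg A f)\<^sup>2)"
  unfolding sd_def by (intro real_sqrt_pow2 avg_nonneg) simp

lemma sd_nonneg: "0 \<le> sd A f"
  unfolding sd_def by (intro real_sqrt_ge_zero avg_nonneg) simp

lemma variance_le_second_moment:
  assumes "finite A"
  shows "avg A (\<lambda>S. (f S - avg A f)\<^sup>2) \<le> avg A (\<lambda>S. (f S)\<^sup>2)"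
proof -
  have "avg A (\<lambda>S. (f S - avg A f)\<^sup>2) = avg A (\<lambda>S. (f S)\<^sup>2 - 2 * avg A f * f S + (avg A f)\<^sup>2)"
    by (simp add: power2_diff algebra_simps)
  also have "\<dots> = avg A (\<lambda>S. (f S)\<^sup>2) - (avg A f)\<^sup>2"
    unfolding avg_add avg_diff avg_cmult using assms by (simp add: power2_eq_square)
  finally show ?thesis by simp
qed

text \<open>Minkowski's inequality; centring the difference can only lower its second
  moment.\<close>

lemma sd_triangle:
  assumes "finite A" "avg A (\<lambda>S. (f S - g S)\<^sup>2) \<le> d\<^sup>2" "0 \<le> d"
  shows "sd A f \<le> sd A g + d"
proof -
  let ?u = "\<lambda>S. g S - avg A g" and ?v = "\<lambda>S. (f S - g S) - avg A (\<lambda>S. f S - g S)"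
  have v: "avg A (\<lambda>S. (?v S)\<^sup>2) \<le> d\<^sup>2"
    using variance_le_second_moment[OF assms(1), of "\<lambda>S. f S - g S"] assms(2) by simp
  have "(avg A (\<lambda>S. ?u S * ?v S))\<^sup>2 \<le> (sd A g)\<^sup>2 * avg A (\<lambda>S. (?v S)\<^sup>2)"
    unfolding sd_square by (rule avg_Cauchy_Schwarz)
  also have "\<dots> \<le> (sd A g * d)\<^sup>2"
    unfolding power_mult_distrib using v by (intro mult_left_mono) auto
  finally have uv: "avg A (\<lambda>S. ?u S * ?v S) \<le> sd A g * d"
    using power2_le_imp_le[of "\<bar>avg A (\<lambda>S. ?u S * ?v S)\<bar>"] sd_nonneg[of A g] assms(3) by fastforce
  have "(sd A f)\<^sup>2 = avg A (\<lambda>S. (?u S)\<^sup>2 + 2 * (?u S * ?v S) + (?v S)\<^sup>2)"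
    unfolding sd_square avg_diff by (intro avg_cong) (simp add: power2_eq_square algebra_simps)
  also have "\<dots> = (sd A g)\<^sup>2 + 2 * avg A (\<lambda>S. ?u S * ?v S) + avg A (\<lambda>S. (?v S)\<^sup>2)"
    unfolding avg_add avg_cmult sd_square ..
  also have "\<dots> \<le> (sd A g)\<^sup>2 + 2 * (sd A g * d) + d\<^sup>2"
    using uv v by simp
  also have "\<dots> = (sd A g + d)\<^sup>2"
    by (simp add: power2_sum)
  finally show ?thesis
    by (rule power2_le_imp_le) (use sd_nonneg[of A g] assms(3) in simp)
qed

section \<open>Gaussian tails under a small shift of the threshold\<close>

lemma Phi_increment_le:
  assumes "0 \<le> y" "y \<le> z"
  shows "Phi z - Phi y \<le> (z - y) * std_normal_density y"
proof -
  have "continuous_on {y..z} Phi"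
    using Phi_has_derivative DERIV_isCont by (intro continuous_at_imp_continuous_on) blast
  then have "Phi z - Phi y \<le> std_normal_density y * (z - y)"
    by (rule increment_le[OF assms(2) _ Phi_has_derivative, where x = y])
      (use assms in \<open>auto simp: std_normal_density_def intro!: divide_right_mono power_mono\<close>)
  then show ?thesis
    by (simp add: mult.commute)
qed

text \<open>A bound for the hazard rate, from the lower Mills bound. It makes a shift \<kappa> of
  the threshold cost a relative amount of order \<open>x * \<kappa>\<close> in the tail.\<close>

lemma std_normal_density_le:
  assumes "1 \<le> x"
  shows "std_normal_density x \<le> 2 * x * (1 - Phi x)"
proof -
  have "1 + x\<^sup>2 \<le> x * (2 * x)"
    using one_le_power[OF assms, of 2] by (simp add: power2_eq_square)
  then have "1 \<le> x / (1 + x\<^sup>2) * (2 * x)"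
    by (simp add: field_simps add_pos_nonneg)
  then have "std_normal_density x * 1 \<le> std_normal_density x * (x / (1 + x\<^sup>2) * (2 * x))"
    by (intro mult_left_mono) auto
  also have "\<dots> = (x / (1 + x\<^sup>2) * std_normal_density x) * (2 * x)"
    by simp
  also have "\<dots> \<le> (1 - Phi x) * (2 * x)"
    using Mills_lower[of x] assms by (intro mult_right_mono) auto
  finally show ?thesis
    by (simp add: mult_ac)
qed

lemma one_minus_Phi_shift_up:
  assumes "1 \<le> x" "0 \<le> \<kappa>"
  shows "(1 - Phi x) * (1 - 2 * (x * \<kappa>)) \<le> 1 - Phi (x + \<kappa>)"
proof -
  have "Phi (x + \<kappa>) - Phi x \<le> \<kappa> * std_normal_density x"
    using Phi_increment_le[of x "x + \<kappa>"] assms by simp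
  also have "\<dots> \<le> \<kappa> * (2 * x * (1 - Phi x))"
    using assms by (intro mult_left_mono std_normal_density_le)
  finally show ?thesis
    by (simp add: algebra_simps)
qed

lemma one_minus_Phi_shift_down:
  assumes "1 \<le> x" "0 \<le> \<kappa>" "\<kappa> \<le> x" "x * \<kappa> \<le> 1"
  shows "1 - Phi (x - \<kappa>) \<le> (1 - Phi x) * (1 + 6 * (x * \<kappa>))"
proof -
  \<comment> \<open>The exponent grows by at most \<open>x * \<kappa> \<le> 1\<close>, and e <
    3.\<close>
  have "std_normal_density (x - \<kappa>) \<le> 3 * std_normal_density x"
  proof -
    have "exp (- (x - \<kappa>)\<^sup>2 / 2) \<le> exp (1 + - x\<^sup>2 / 2)"
    proof -
      have "(x - \<kappa>)\<^sup>2 = x\<^sup>2 - 2 * (x * \<kappa>) + \<kappa>\<^sup>2"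
        by (simp add: power2_diff)
      then have "- (x - \<kappa>)\<^sup>2 / 2 \<le> 1 + - x\<^sup>2 / 2"
        using assms(4) zero_le_power2[of \<kappa>] by linarith
      then show ?thesis by simp
    qed
    also have "\<dots> \<le> 3 * exp (- x\<^sup>2 / 2)"
      unfolding exp_add using e_less_272 by (intro mult_right_mono) auto
    finally show ?thesis
      unfolding std_normal_density_def by (simp add: divide_right_mono)
  qed
  also have "\<dots> \<le> 3 * (2 * x * (1 - Phi x))"
    using assms by (intro mult_left_mono std_normal_density_le) auto
  finally have "\<kappa> * std_normal_density (x - \<kappa>) \<le> \<kappa> * (3 * (2 * x * (1 - Phi x)))"
    using assms by (intro mult_left_mono)
  moreover have "Phi x - Phi (x - \<kappa>) \<le> \<kappa> * std_normal_density (x - \<kappa>)"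
    using Phi_increment_le[of "x - \<kappa>" x] assms by simp
  ultimately show ?thesis
    by (simp add: algebra_simps)
qed

text \<open>A function \<open>X\<close> that differs by at most \<open>D\<close> from a sum of independent functions with
  bounded differences. All errors are measured on the scale \<open>\<epsilon> * sd A X\<close>; the summands are
  clamped at distance \<open>K\<close> from their means, where \<open>K\<close> is so large that clamping has probability
  negligible with respect to the Gaussian tail at \<open>x\<close>.\<close>
locale perturbed_indep_sum =
  fixes A :: "'e set" and I :: "'i set" and F :: "'i \<Rightarrow> 'e set"
    and U :: "'i \<Rightarrow> 'e set \<Rightarrow> real" and X :: "'e set \<Rightarrow> real"
    and c V D B p x \<epsilon> :: real
  assumes finite_A: "finite A" and finite_I: "finite I"
    and dep: "\<And>i. i \<in> I \<Longrightarrow> depends_on (F i) (U i)"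
    and disj: "disjoint_family_on F I"
    and differences: "\<And>i e S. i \<in> I \<Longrightarrow> \<bar>U i (insert e S) - U i S\<bar> \<le> c"
    and card_F: "\<And>i. i \<in> I \<Longrightarrow> c\<^sup>2 * card (A \<inter> F i) \<le> V"
    and V_pos: "0 < V" and D_nonneg: "0 \<le> D" and p_pos: "0 < p"
    and U_nonneg: "\<And>i S. i \<in> I \<Longrightarrow> 0 \<le> U i S"
    and sum_U: "\<And>S. (\<Sum>i\<in>I. U i S) \<le> B"
    and X_bounds: "\<And>S. 0 \<le> X S" "\<And>S. X S \<le> B"
    and close: "\<And>S. \<bar>X S - (\<Sum>i\<in>I. U i S)\<bar> \<le> D"
    and x: "2 \<le> x" and eps: "0 < \<epsilon>" "\<epsilon> * x ^ 3 \<le> 1 / 1000"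
    and D_eps: "D + 1 \<le> \<epsilon> * sd A X"
    and V_eps: "sqrt V \<le> \<epsilon> * sd A X" "sqrt (V * p) \<le> \<epsilon> * sd A X"
    and rare: "2 * card I * exp (- 2 * p) \<le> \<epsilon>" "4 * B\<^sup>2 * (2 * card I * exp (- 2 * p)) \<le> 1"
begin

definition K :: real where "K = sqrt (V * (p + x\<^sup>2))"
text \<open>A lower level, for third moments only: bounding them by means of \<open>K\<close> would
  cost an additional factor \<open>x\<close>. It is exceeded with probability at most
  \<open>2 * exp (- 2 * p)\<close>, so rarely that the crude bound \<open>2 * K\<close> suffices
  there.\<close>

definition K1 :: real where "K1 = sqrt (V * p)"
definition \<mu> :: "'i \<Rightarrow> real" where "\<mu> i = avg A (U i)"
definition clamp :: "'i \<Rightarrow> 'e set \<Rightarrow> real" where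
  "clamp i S = max (\<mu> i - K) (min (\<mu> i + K) (U i S))"
definition Z :: "'e set \<Rightarrow> real" where "Z S = (\<Sum>i\<in>I. clamp i S)"
definition atypical :: "'e set \<Rightarrow> bool" where
  "atypical S \<longleftrightarrow> (\<exists>i\<in>I. K < \<bar>U i S - \<mu> i\<bar>)"
definition \<eta> :: real where "\<eta> = 2 * card I * exp (- 2 * p)"
abbreviation \<sigma> :: real where "\<sigma> \<equiv> sd A X"
definition \<sigma>' :: real where "\<sigma>' = sd A Z"

lemma K_nonneg: "0 \<le> K" and K1_nonneg: "0 \<le> K1"
  using V_pos p_pos by (simp_all add: K_def K1_def)

lemma eta_nonneg: "0 \<le> \<eta>"
  by (simp add: \<eta>_def)

lemma x_powers: "x \<le> x\<^sup>2" "x\<^sup>2 \<le> x ^ 3" "1 \<le> x ^ 3" "x \<le> x ^ 3"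
proof -
  have "1 * x \<le> x * x" "x\<^sup>2 * 1 \<le> x\<^sup>2 * x"
    using x by (intro mult_right_mono mult_left_mono; simp)+
  then show "x \<le> x\<^sup>2" "x\<^sup>2 \<le> x ^ 3"
    by (simp_all add: power2_eq_square power3_eq_cube)
  then show "x \<le> x ^ 3" by simp
  then show "1 \<le> x ^ 3" using x by simp
qed

lemma eps_x: "\<epsilon> * x\<^sup>2 \<le> 1 / 1000" "\<epsilon> * x \<le> 1 / 1000" "\<epsilon> \<le> 1 / 1000"
proof -
  have "\<epsilon> * x\<^sup>2 \<le> \<epsilon> * x ^ 3" "\<epsilon> * x \<le> \<epsilon> * x ^ 3" "\<epsilon> * 1 \<le> \<epsilon> * x ^ 3"
    using x_powers eps(1) by (intro mult_left_mono; simp)+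
  then show "\<epsilon> * x\<^sup>2 \<le> 1 / 1000" "\<epsilon> * x \<le> 1 / 1000" "\<epsilon> \<le> 1 / 1000"
    using eps(2) by linarith+
qed

lemma tail_function:
  assumes "i \<in> I" "depends_on (F i) f" "\<And>e S. \<bar>f (insert e S) - f S\<bar> \<le> c" "0 \<le> u"
  shows "avg A (\<lambda>S. of_bool (u < \<bar>f S - avg A f\<bar>)) \<le> 2 * exp (- 2 * u\<^sup>2 / V)"
proof -
  have "avg A f = avg (A \<inter> F i) f"
    by (rule avg_restrict[OF finite_A assms(2)])
  moreover have "avg A (\<lambda>S. of_bool (u < \<bar>f S - m\<bar>)) = avg (A \<inter> F i) (\<lambda>S. of_bool (u < \<bar>f S - m\<bar>))" for m
    by (rule avg_restrict[OF finite_A]) (rule depends_on_comp[OF assms(2)])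
  moreover have "avg (A \<inter> F i) (\<lambda>S. of_bool (u < \<bar>f S - avg (A \<inter> F i) f\<bar>)) \<le> 2 * exp (- 2 * u\<^sup>2 / V)"
    by (rule avg_tail_bounded_differences) (use finite_A assms card_F V_pos in auto)
  ultimately show ?thesis
    by simp
qed

lemma atypical_rare: "avg A (\<lambda>S. of_bool (atypical S)) \<le> \<eta> * exp (- 2 * x\<^sup>2)"
proof -
  have "avg A (\<lambda>S. of_bool (atypical S)) \<le> avg A (\<lambda>S. \<Sum>i\<in>I. of_bool (K < \<bar>U i S - \<mu> i\<bar>))"
  proof (rule avg_mono)
    fix S
    show "of_bool (atypical S) \<le> (\<Sum>i\<in>I. of_bool (K < \<bar>U i S - \<mu> i\<bar>) :: real)"
    proof (cases "atypical S")
      case True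
      then obtain i where "i \<in> I" "K < \<bar>U i S - \<mu> i\<bar>"
        by (auto simp: atypical_def)
      then show ?thesis
        using member_le_sum[of i I "\<lambda>i. of_bool (K < \<bar>U i S - \<mu> i\<bar>) :: real"] finite_I True by simp
    qed (simp add: sum_nonneg)
  qed
  also have "\<dots> \<le> (\<Sum>i\<in>I. 2 * exp (- 2 * K\<^sup>2 / V))"
    unfolding avg_sum \<mu>_def
  proof (rule sum_mono)
    fix i assume i: "i \<in> I"
    show "avg A (\<lambda>S. of_bool (K < \<bar>U i S - avg A (U i)\<bar>)) \<le> 2 * exp (- 2 * K\<^sup>2 / V)"
      by (rule tail_function[OF i dep[OF i] differences[OF i] K_nonneg])
  qed
  also have "\<dots> = \<eta> * exp (- 2 * x\<^sup>2)"
  proof -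
    \<comment> \<open>The part \<open>p\<close> pays for the union bound over the blocks, the part
      \<open>x\<^sup>2\<close> beats the Gaussian tail \<open>exp (- x\<^sup>2 / 2)\<close>.\<close>
    have "K\<^sup>2 = V * (p + x\<^sup>2)"
      using V_pos p_pos by (simp add: K_def)
    then have "- 2 * K\<^sup>2 / V = - 2 * p + - 2 * x\<^sup>2"
      using V_pos by (simp add: field_simps)
    then show ?thesis
      unfolding \<eta>_def by (simp only: exp_add) simp
  qed
  finally show ?thesis .
qed

lemma clamp_eq:
  assumes "\<not> atypical S" "i \<in> I"
  shows "clamp i S = U i S"
  using assms by (auto simp: atypical_def clamp_def)

lemma clamp_bounds:
  assumes "i \<in> I"
  shows "0 \<le> clamp i S" "clamp i S \<le> U i S + \<mu> i" "\<mu> i - K \<le> clamp i S" "clamp i S \<le> \<mu> i + K"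
proof -
  have "0 \<le> \<mu> i"
    unfolding \<mu>_def by (rule avg_nonneg) (rule U_nonneg[OF assms])
  then show "0 \<le> clamp i S" "clamp i S \<le> U i S + \<mu> i" "\<mu> i - K \<le> clamp i S" "clamp i S \<le> \<mu> i + K"
    using U_nonneg[OF assms, of S] K_nonneg by (auto simp: clamp_def)
qed

lemma X_minus_Z:
  shows "\<not> atypical S \<Longrightarrow> \<bar>X S - Z S\<bar> \<le> D" and "\<bar>X S - Z S\<bar> \<le> 2 * B"
proof -
  show "\<bar>X S - Z S\<bar> \<le> D" if "\<not> atypical S"
    using close[of S] clamp_eq[OF that] by (simp add: Z_def)
  have "0 \<le> Z S"
    unfolding Z_def by (intro sum_nonneg clamp_bounds)
  have "Z S \<le> (\<Sum>i\<in>I. U i S + \<mu> i)"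
    unfolding Z_def by (intro sum_mono clamp_bounds)
  also have "\<dots> = (\<Sum>i\<in>I. U i S) + avg A (\<lambda>S. \<Sum>i\<in>I. U i S)"
    by (simp add: sum.distrib \<mu>_def avg_sum)
  also have "\<dots> \<le> B + B"
    using sum_U finite_A by (intro add_mono avg_le_const) auto
  finally show "\<bar>X S - Z S\<bar> \<le> 2 * B"
    using \<open>0 \<le> Z S\<close> X_bounds[of S] by linarith
qed

text \<open>On the atypical event only the crude bound \<open>2 * B\<close> is available. By the
  second half of \<open>rare\<close> it contributes at most 1, hence \<open>D + 1\<close> instead of
  \<open>D\<close>.\<close>

lemma second_moment_X_minus_Z: "avg A (\<lambda>S. (X S - Z S)\<^sup>2) \<le> (D + 1)\<^sup>2"
proof -
  have "avg A (\<lambda>S. (X S - Z S)\<^sup>2) \<le> avg A (\<lambda>S. D\<^sup>2 + 4 * B\<^sup>2 * of_bool (atypical S))"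
  proof (rule avg_mono)
    fix S
    show "(X S - Z S)\<^sup>2 \<le> D\<^sup>2 + 4 * B\<^sup>2 * of_bool (atypical S)"
    proof (cases "atypical S")
      case True
      have "(X S - Z S)\<^sup>2 \<le> (2 * B)\<^sup>2"
        unfolding abs_le_square_iff[symmetric] using X_minus_Z(2)[of S] by simp
      with True show ?thesis
        by (simp add: power_mult_distrib add_increasing)
    next
      case False
      have "(X S - Z S)\<^sup>2 \<le> D\<^sup>2"
        unfolding abs_le_square_iff[symmetric] using X_minus_Z(1)[OF False] by simp
      with False show ?thesis by simp
    qed
  qed
  also have "\<dots> = D\<^sup>2 + 4 * B\<^sup>2 * avg A (\<lambda>S. of_bool (atypical S))"
    unfolding avg_add avg_cmult using finite_A by simp
  also have "\<dots> \<le> D\<^sup>2 + 4 * B\<^sup>2 * (\<eta> * 1)"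
    by (intro add_left_mono mult_left_mono order_trans[OF atypical_rare] eta_nonneg) auto
  also have "\<dots> \<le> D\<^sup>2 + 1"
    using rare(2) by (simp add: \<eta>_def)
  also have "\<dots> \<le> (D + 1)\<^sup>2"
    using D_nonneg by (simp add: power2_sum)
  finally show ?thesis .
qed

lemma sigma_compare: "\<sigma> \<le> \<sigma>' + (D + 1)" "\<sigma>' \<le> \<sigma> + (D + 1)"
  unfolding \<sigma>'_def using second_moment_X_minus_Z D_nonneg
  by (intro sd_triangle finite_A; simp add: power2_commute[of "Z _"])+

lemma sigma_pos: "0 < \<sigma>"
  using D_eps D_nonneg eps(1) zero_less_mult_pos[of \<epsilon> \<sigma>] by simp

lemma sigma'_ge: "\<sigma> \<le> 2 * \<sigma>'" and sigma'_pos: "0 < \<sigma>'"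
proof -
  have "\<epsilon> * \<sigma> \<le> 1 / 1000 * \<sigma>"
    using eps_x(3) sigma_pos by (intro mult_right_mono) auto
  then show "\<sigma> \<le> 2 * \<sigma>'"
    using sigma_compare(1) D_eps sigma_pos by linarith
  then show "0 < \<sigma>'"
    using sigma_pos by linarith
qed

lemma mean_difference: "\<bar>avg A X - avg A Z\<bar> \<le> D + 1"
proof -
  have "(avg A (\<lambda>S. X S - Z S))\<^sup>2 \<le> (D + 1)\<^sup>2"
    using avg_power2_le[OF finite_A] second_moment_X_minus_Z by (rule order_trans)
  then show ?thesis
    unfolding abs_le_square_iff[symmetric] avg_diff using D_nonneg by simp
qed

lemma K_le: "K \<le> 2 * \<epsilon> * x * \<sigma>"
proof -
  have "K \<le> sqrt (V * p) + sqrt (V * x\<^sup>2)"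
    unfolding K_def distrib_left using V_pos p_pos by (intro sqrt_add_le_add_sqrt) auto
  also have "sqrt (V * x\<^sup>2) = x * sqrt V"
    using x by (simp add: real_sqrt_mult mult.commute)
  also have "sqrt (V * p) + x * sqrt V \<le> \<epsilon> * \<sigma> + x * (\<epsilon> * \<sigma>)"
    using V_eps x by (intro add_mono mult_left_mono) auto
  also have "\<dots> \<le> x * (\<epsilon> * \<sigma>) + x * (\<epsilon> * \<sigma>)"
  proof -
    have "1 * (\<epsilon> * \<sigma>) \<le> x * (\<epsilon> * \<sigma>)"
      using x eps sigma_pos by (intro mult_right_mono) auto
    then show ?thesis
      unfolding mult_1 by (rule add_right_mono)
  qed
  finally show ?thesis
    by (simp add: mult_ac)
qed

text \<open>The sign \<open>s\<close>, equal to 1 or -1, selects the tail, so that one argument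
  serves both deviations; it affects neither variances nor absolute third moments.\<close>

definition \<xi> :: "real \<Rightarrow> 'i \<Rightarrow> 'e set \<Rightarrow> real" where
  "\<xi> s i S = s * (clamp i S - avg A (clamp i)) / \<sigma>'"

lemma clamp_dep: "i \<in> I \<Longrightarrow> depends_on (F i) (clamp i)"
  unfolding clamp_def[abs_def] by (rule depends_on_comp) (rule dep)

lemma clamp_centered: "i \<in> I \<Longrightarrow> \<bar>clamp i S - avg A (clamp i)\<bar> \<le> 2 * K"
proof -
  assume i: "i \<in> I"
  have "\<mu> i - K \<le> avg A (clamp i)" "avg A (clamp i) \<le> \<mu> i + K"
    using clamp_bounds[OF i] by (intro avg_ge_const avg_le_const finite_A; blast)+
  then show ?thesis
    using clamp_bounds(3,4)[OF i, of S] by linarith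
qed

text \<open>Cut at \<open>K1\<close>: below, a cube is at most \<open>K1\<close> times a square,
  which the total variance absorbs; above, \<open>2 * K\<close> bounds the cube and bounded
  differences bound the probability.\<close>

lemma clamp_third_moment:
  assumes i: "i \<in> I"
  shows "avg A (\<lambda>S. \<bar>clamp i S - avg A (clamp i)\<bar> ^ 3)
     \<le> K1 * avg A (\<lambda>S. (clamp i S - avg A (clamp i))\<^sup>2) + (2 * K) ^ 3 * (2 * exp (- 2 * p))"
proof -
  let ?z = "\<lambda>S. clamp i S - avg A (clamp i)"
  have "avg A (\<lambda>S. \<bar>?z S\<bar> ^ 3) \<le> avg A (\<lambda>S. K1 * (?z S)\<^sup>2 + (2 * K) ^ 3 * of_bool (K1 < \<bar>?z S\<bar>))"
  proof (rule avg_mono)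
    fix S
    show "\<bar>?z S\<bar> ^ 3 \<le> K1 * (?z S)\<^sup>2 + (2 * K) ^ 3 * of_bool (K1 < \<bar>?z S\<bar>)"
    proof (cases "K1 < \<bar>?z S\<bar>")
      case True
      have "\<bar>?z S\<bar> ^ 3 \<le> (2 * K) ^ 3"
        using clamp_centered[OF i] by (intro power_mono) auto
      with True show ?thesis
        using K1_nonneg by (simp add: add_increasing)
    next
      case False
      have "\<bar>?z S\<bar> ^ 3 = \<bar>?z S\<bar> * (?z S)\<^sup>2"
        by (simp add: power3_eq_cube power2_eq_square)
      also have "\<dots> \<le> K1 * (?z S)\<^sup>2"
        using False by (intro mult_right_mono) auto
      finally show ?thesis
        using False by simp
    qed
  qed
  also have "\<dots> = K1 * avg A (\<lambda>S. (?z S)\<^sup>2) + (2 * K) ^ 3 * avg A (\<lambda>S. of_bool (K1 < \<bar>?z S\<bar>))"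
    unfolding avg_add avg_cmult ..
  also have "\<dots> \<le> K1 * avg A (\<lambda>S. (?z S)\<^sup>2) + (2 * K) ^ 3 * (2 * exp (- 2 * p))"
  proof (intro add_left_mono mult_left_mono)
    \<comment> \<open>Clamping is 1-Lipschitz and so keeps bounded differences.\<close>
    have "\<bar>clamp i (insert e S) - clamp i S\<bar> \<le> c" for e S
      using differences[OF i, of e S] unfolding clamp_def by (auto simp: max_def min_def split: if_splits)
    then have "avg A (\<lambda>S. of_bool (K1 < \<bar>?z S\<bar>)) \<le> 2 * exp (- 2 * K1\<^sup>2 / V)"
      by (intro tail_function[OF i] clamp_dep[OF i] K1_nonneg)
    also have "- 2 * K1\<^sup>2 / V = - 2 * p"
      using V_pos p_pos by (simp add: K1_def)
    finally show "avg A (\<lambda>S. of_bool (K1 < \<bar>?z S\<bar>)) \<le> 2 * exp (- 2 * p)" .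
  qed (use K_nonneg in auto)
  finally show ?thesis .
qed

lemma variance_Z: "(\<Sum>i\<in>I. avg A (\<lambda>S. (clamp i S - avg A (clamp i))\<^sup>2)) = \<sigma>'\<^sup>2"
proof -
  let ?z = "\<lambda>i S. clamp i S - avg A (clamp i)"
  have cross: "avg A (\<lambda>S. ?z i S * ?z j S) = (if i = j then avg A (\<lambda>S. (?z i S)\<^sup>2) else 0)"
    if "i \<in> I" "j \<in> I" for i j
  proof (cases "i = j")
    case False
    have "avg A (\<lambda>S. ?z i S * ?z j S) = avg A (?z i) * avg A (?z j)"
      using disj that False
      by (intro avg_mult_indep[OF finite_A depends_on_comp[OF clamp_dep] depends_on_comp[OF clamp_dep]])
        (auto simp: disjoint_family_on_def)
    then show ?thesis
      using finite_A False by (simp add: avg_diff)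
  qed (simp add: power2_eq_square)
  have "Z S - avg A Z = (\<Sum>i\<in>I. ?z i S)" for S
    unfolding Z_def[abs_def] avg_sum sum_subtractf ..
  then have "(Z S - avg A Z)\<^sup>2 = (\<Sum>i\<in>I. \<Sum>j\<in>I. ?z i S * ?z j S)" for S
    by (simp add: power2_eq_square sum_product)
  then have "\<sigma>'\<^sup>2 = (\<Sum>i\<in>I. \<Sum>j\<in>I. avg A (\<lambda>S. ?z i S * ?z j S))"
    unfolding \<sigma>'_def sd_square avg_sum[symmetric] by simp
  also have "\<dots> = (\<Sum>i\<in>I. avg A (\<lambda>S. (?z i S)\<^sup>2))"
    using finite_I by (simp add: cross)
  finally show ?thesis ..
qed

text \<open>The size bound is \<open>2 * K / \<sigma>'\<close>, estimated with
  \<open>\<sigma> \<le> 2 * \<sigma>'\<close>. In the third moments \<open>K1 / \<sigma>'\<close>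
  gives \<open>2 * \<epsilon>\<close>, and the part above \<open>K1\<close> gives at most
  \<open>\<eta> \<le> \<epsilon>\<close>.\<close>

lemma small_indep_sum:
  assumes s: "s = 1 \<or> s = -1"
  shows "small_indep_sum A I F (\<xi> s) (8 * \<epsilon> * x) (3 * \<epsilon>)"
proof
  show "finite A" "finite I" "disjoint_family_on F I"
    by (fact finite_A finite_I disj)+
  show "depends_on (F i) (\<xi> s i)" if "i \<in> I" for i
    unfolding \<xi>_def[abs_def] by (rule depends_on_comp) (rule clamp_dep[OF that])
  show "avg A (\<xi> s i) = 0" for i
    unfolding \<xi>_def[abs_def] avg_divide avg_cmult avg_diff using finite_A by simp
  have s2: "s\<^sup>2 = 1" "\<bar>s\<bar> = 1"
    using s by auto
  show "(\<Sum>i\<in>I. avg A (\<lambda>S. (\<xi> s i S)\<^sup>2)) = 1"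
    unfolding \<xi>_def power_divide power_mult_distrib s2 avg_divide
    using variance_Z sigma'_pos by (simp flip: sum_divide_distrib)
  have K_sigma: "2 * K / \<sigma>' \<le> 8 * \<epsilon> * x"
  proof -
    have "2 * K \<le> 4 * \<epsilon> * x * \<sigma>"
      using K_le by simp
    also have "\<dots> \<le> 4 * \<epsilon> * x * (2 * \<sigma>')"
      using sigma'_ge eps x by (intro mult_left_mono) auto
    finally show ?thesis
      using sigma'_pos by (simp add: field_simps)
  qed
  show "\<bar>\<xi> s i S\<bar> \<le> 8 * \<epsilon> * x" if "i \<in> I" for i S
  proof -
    have "\<bar>\<xi> s i S\<bar> = \<bar>clamp i S - avg A (clamp i)\<bar> / \<sigma>'"
      unfolding \<xi>_def using s2 sigma'_pos by (simp add: abs_mult)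
    also have "\<dots> \<le> 2 * K / \<sigma>'"
      using clamp_centered[OF that] sigma'_pos by (intro divide_right_mono) auto
    finally show ?thesis using K_sigma by simp
  qed
  have "(\<Sum>i\<in>I. avg A (\<lambda>S. \<bar>\<xi> s i S\<bar> ^ 3)) = (\<Sum>i\<in>I. avg A (\<lambda>S. \<bar>clamp i S - avg A (clamp i)\<bar> ^ 3)) / \<sigma>' ^ 3"
    unfolding \<xi>_def abs_divide abs_mult s2 power_divide avg_divide sum_divide_distrib[symmetric]
    using sigma'_pos by simp
  also have "\<dots> \<le> (\<Sum>i\<in>I. K1 * avg A (\<lambda>S. (clamp i S - avg A (clamp i))\<^sup>2) + (2 * K) ^ 3 * (2 * exp (- 2 * p))) / \<sigma>' ^ 3"
    using sigma'_pos by (intro divide_right_mono sum_mono clamp_third_moment) auto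
  also have "\<dots> = (K1 * \<sigma>'\<^sup>2 + (2 * K) ^ 3 * \<eta>) / \<sigma>' ^ 3"
    unfolding sum.distrib sum_distrib_left[symmetric] variance_Z \<eta>_def by simp
  also have "\<dots> = K1 / \<sigma>' + (2 * K / \<sigma>') ^ 3 * \<eta>"
    using sigma'_pos by (simp add: field_simps power2_eq_square power3_eq_cube)
  also have "\<dots> \<le> 2 * \<epsilon> + 1 * \<epsilon>"
  proof (intro add_mono mult_mono)
    have "K1 \<le> \<epsilon> * \<sigma>"
      using V_eps by (simp add: K1_def)
    also have "\<dots> \<le> \<epsilon> * (2 * \<sigma>')"
      using sigma'_ge eps by (intro mult_left_mono) auto
    finally show "K1 / \<sigma>' \<le> 2 * \<epsilon>"
      using sigma'_pos by (simp add: field_simps)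
    have "2 * K / \<sigma>' \<le> 1"
      using K_sigma eps_x(2) by simp
    then show "(2 * K / \<sigma>') ^ 3 \<le> 1"
      using K_nonneg sigma'_pos by (intro power_le_one) auto
    show "\<eta> \<le> \<epsilon>"
      using rare by (simp add: \<eta>_def)
  qed (use eta_nonneg in auto)
  finally show "(\<Sum>i\<in>I. avg A (\<lambda>S. \<bar>\<xi> s i S\<bar> ^ 3)) \<le> 3 * \<epsilon>" by simp
qed

definition W :: "real \<Rightarrow> 'e set \<Rightarrow> real" where "W s S = (\<Sum>i\<in>I. \<xi> s i S)"

lemma W_eq: "\<sigma>' * W s S = s * (Z S - avg A Z)"
proof -
  have "Z S - avg A Z = (\<Sum>i\<in>I. clamp i S - avg A (clamp i))"
    unfolding Z_def[abs_def] avg_sum sum_subtractf ..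
  then show ?thesis
    unfolding W_def \<xi>_def sum_divide_distrib[symmetric] sum_distrib_left[symmetric]
    using sigma'_pos by simp
qed

lemma W_close:
  assumes "s = 1 \<or> s = -1" "\<not> atypical S"
  shows "\<bar>s * (X S - avg A X) - \<sigma>' * W s S\<bar> \<le> 2 * (D + 1)"
proof -
  have eq: "\<bar>s * (X S - avg A X) - \<sigma>' * W s S\<bar> = \<bar>(X S - Z S) - (avg A X - avg A Z)\<bar>"
    unfolding W_eq using assms(1) by auto
  show ?thesis
    using X_minus_Z(1)[OF assms(2)] mean_difference D_nonneg
      abs_triangle_ineq4[of "X S - Z S" "avg A X - avg A Z"] unfolding eq by simp
qed

lemma shift_le: "x * (D + 1) + 2 * (D + 1) \<le> 4 * \<epsilon> * x * \<sigma>'"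
proof -
  have "x * (D + 1) + 2 * (D + 1) \<le> (2 * x) * (D + 1)"
  proof -
    have "2 * (D + 1) \<le> x * (D + 1)"
      using x D_nonneg by (intro mult_right_mono) auto
    then show ?thesis
      by (simp only: mult.assoc)
  qed
  also have "\<dots> \<le> (2 * x) * (\<epsilon> * \<sigma>)"
    using x D_eps by (intro mult_left_mono) auto
  also have "\<dots> \<le> (2 * x) * (\<epsilon> * (2 * \<sigma>'))"
    using x eps sigma'_ge by (intro mult_left_mono) auto
  finally show ?thesis
    by (simp add: mult_ac)
qed

text \<open>Exchanging \<sigma> and \<open>\<sigma>'\<close> moves the threshold by at most
  \<open>x * (D + 1)\<close>, centring and approximation by at most \<open>2 * (D + 1)\<close>.
  Together this is at most \<open>4 * \<epsilon> * x\<close> in units of \<open>\<sigma>'\<close>;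
  the atypical event is added separately.\<close>

lemma tail_sandwich:
  assumes s: "s = 1 \<or> s = -1"
  defines "P \<equiv> avg A (\<lambda>S. of_bool (x * \<sigma> < s * (X S - avg A X)))"
  shows "P \<le> avg A (\<lambda>S. of_bool (x - 4 * \<epsilon> * x < W s S)) + \<eta> * exp (- 2 * x\<^sup>2)"
    and "avg A (\<lambda>S. of_bool (x + 4 * \<epsilon> * x < W s S)) \<le> P + \<eta> * exp (- 2 * x\<^sup>2)"
proof -
  have x\<sigma>: "x * \<sigma> \<le> x * \<sigma>' + x * (D + 1)" "x * \<sigma>' \<le> x * \<sigma> + x * (D + 1)"
    unfolding distrib_left[symmetric] using sigma_compare x by (intro mult_left_mono; simp)+
  have 1: "x - 4 * \<epsilon> * x < W s S" if "x * \<sigma> < s * (X S - avg A X)" "\<not> atypical S" for S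
  proof -
    have "\<sigma>' * (x - 4 * \<epsilon> * x) \<le> x * \<sigma>' - (x * (D + 1) + 2 * (D + 1))"
      using shift_le by (simp add: algebra_simps)
    also have "\<dots> < \<sigma>' * W s S"
      using W_close[OF s that(2)] that(1) x\<sigma> by linarith
    finally show ?thesis
      using sigma'_pos by simp
  qed
  have 2: "x * \<sigma> < s * (X S - avg A X)" if "x + 4 * \<epsilon> * x < W s S" "\<not> atypical S" for S
  proof -
    have "x * \<sigma>' + (x * (D + 1) + 2 * (D + 1)) \<le> \<sigma>' * (x + 4 * \<epsilon> * x)"
      using shift_le by (simp add: algebra_simps)
    also have "\<dots> < \<sigma>' * W s S"
      using that(1) sigma'_pos by simp
    finally show ?thesis
      using W_close[OF s that(2)] x\<sigma> by linarith
  qed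
  have "P \<le> avg A (\<lambda>S. of_bool (x - 4 * \<epsilon> * x < W s S) + of_bool (atypical S))"
    unfolding P_def using 1 by (intro avg_mono) (auto simp: of_bool_def)
  then show "P \<le> avg A (\<lambda>S. of_bool (x - 4 * \<epsilon> * x < W s S)) + \<eta> * exp (- 2 * x\<^sup>2)"
    unfolding avg_add using atypical_rare by linarith
  have "avg A (\<lambda>S. of_bool (x + 4 * \<epsilon> * x < W s S)) \<le>
      avg A (\<lambda>S. of_bool (x * \<sigma> < s * (X S - avg A X)) + of_bool (atypical S))"
    using 2 by (intro avg_mono) (auto simp: of_bool_def)
  then show "avg A (\<lambda>S. of_bool (x + 4 * \<epsilon> * x < W s S)) \<le> P + \<eta> * exp (- 2 * x\<^sup>2)"
    unfolding avg_add P_def using atypical_rare by linarith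
qed

text \<open>Stein's bound is applied at a nearby threshold \<open>y\<close>, and the Gaussian tail
  at \<open>y\<close> is compared with that at \<open>x\<close>. All errors are multiples of
  \<open>t = \<epsilon> * x ^ 3\<close>; 4000 is a generous bound for the sum of their
  constants.\<close>

theorem moderate_deviation:
  assumes s: "s = 1 \<or> s = -1"
  shows "\<bar>avg A (\<lambda>S. of_bool (x * \<sigma> < s * (X S - avg A X))) - (1 - Phi x)\<bar> \<le> 4000 * (\<epsilon> * x ^ 3) * (1 - Phi x)"
proof -
  interpret S: small_indep_sum A I F "\<xi> s" "8 * \<epsilon> * x" "3 * \<epsilon>"
    by (rule small_indep_sum[OF s])
  have WS: "S.W = W s"
    by (simp add: fun_eq_iff S.W_def W_def)
  define q where "q = 1 - Phi x"
  define t where "t = \<epsilon> * x ^ 3"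
  define P where "P = avg A (\<lambda>S. of_bool (x * \<sigma> < s * (X S - avg A X)))"
  have q: "0 \<le> q"
    using Phi_le_1 by (simp add: q_def)
  have t: "0 \<le> t" "t \<le> 1 / 1000"
    using eps x by (simp_all add: t_def)
  have ex2: "\<epsilon> * x\<^sup>2 \<le> t"
    unfolding t_def using x_powers eps by (intro mult_left_mono) auto
  \<comment> \<open>20 = 4 + 2 * 8: the shift in \<open>tail_sandwich\<close> plus twice the size
    bound \<open>8 * \<epsilon> * x\<close> of the summands.\<close>
  define \<kappa> where "\<kappa> = 20 * \<epsilon> * x"
  have k: "0 \<le> \<kappa>" "\<kappa> \<le> 1 / 50" "x * \<kappa> \<le> 20 * t"
    using eps x eps_x(2) ex2 by (simp_all add: \<kappa>_def power2_eq_square mult_ac)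
  have rem: "\<eta> * exp (- 2 * x\<^sup>2) \<le> 6 * t * q"
  proof -
    have "exp (- 2 * x\<^sup>2) \<le> exp (- x\<^sup>2 / 2)"
      by simp
    also have "\<dots> \<le> 6 * x * q"
      unfolding q_def using x by (intro exp_le_1_minus_Phi) simp
    finally have "\<eta> * exp (- 2 * x\<^sup>2) \<le> \<epsilon> * (6 * x * q)"
      using rare(1) eps by (intro mult_mono) (auto simp: \<eta>_def)
    also have "\<dots> = (\<epsilon> * x) * (6 * q)"
      by simp
    also have "\<dots> \<le> t * (6 * q)"
      unfolding t_def using x_powers eps q by (intro mult_right_mono mult_left_mono) auto
    finally show ?thesis by simp
  qed
  have upper: "P \<le> q * (1 + 4000 * t)"
  proof -
    define y where "y = x - \<kappa>"
    have y: "1 \<le> y" "y \<le> x"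
      using k x by (simp_all add: y_def)
    have "y * (8 * \<epsilon> * x) \<le> x * (8 * \<epsilon> * x)"
      using y eps x by (intro mult_right_mono) auto
    also have "\<dots> \<le> 1"
      using eps_x(1) by (simp add: power2_eq_square mult_ac)
    finally have y1: "y * (8 * \<epsilon> * x) \<le> 1" .
    have y3: "y ^ 3 \<le> x ^ 3"
      using y by (intro power_mono) auto
    then have "y ^ 3 * (3 * \<epsilon>) \<le> x ^ 3 * (3 * \<epsilon>)"
      using eps by (intro mult_right_mono) auto
    then have y2: "3 * \<epsilon> * y ^ 3 \<le> 3 * t"
      by (simp add: t_def mult_ac)
    have "avg A (\<lambda>S. of_bool (y + 2 * (8 * \<epsilon> * x) < W s S)) \<le> (1 - Phi y) * (1 + 600 * (3 * \<epsilon>) * y ^ 3)"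
      unfolding WS[symmetric] by (rule S.tail_upper[OF y(1) y1]) (use y2 t in \<open>simp add: mult_ac\<close>)
    also have "y + 2 * (8 * \<epsilon> * x) = x - 4 * \<epsilon> * x"
      by (simp add: y_def \<kappa>_def)
    \<comment> \<open>120 = 6 * 20 from moving the threshold, 1800 = 600 * 3 from the third
      moments.\<close>
    also have "(1 - Phi y) * (1 + 600 * (3 * \<epsilon>) * y ^ 3) \<le> (q * (1 + 120 * t)) * (1 + 1800 * t)"
    proof (intro mult_mono)
      have "1 - Phi y \<le> q * (1 + 6 * (x * \<kappa>))"
        unfolding y_def q_def using k x t by (intro one_minus_Phi_shift_down) auto
      also have "\<dots> \<le> q * (1 + 120 * t)"
        using k q by (intro mult_left_mono) linarith+
      finally show "1 - Phi y \<le> q * (1 + 120 * t)" .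
      show "1 + 600 * (3 * \<epsilon>) * y ^ 3 \<le> 1 + 1800 * t"
        using y2 by simp
    qed (use q t eps y in auto)
    finally have "P \<le> q * ((1 + 120 * t) * (1 + 1800 * t)) + 6 * t * q"
      using tail_sandwich(1)[OF s] rem by (simp add: P_def)
    also have "\<dots> = q * (1 + 1926 * t + 216000 * (t * t))"
      by (simp add: algebra_simps)
    also have "\<dots> \<le> q * (1 + 4000 * t)"
    proof (rule mult_left_mono[OF _ q])
      have "t * t \<le> t * (1 / 1000)"
        using t by (intro mult_left_mono) auto
      then show "1 + 1926 * t + 216000 * (t * t) \<le> 1 + 4000 * t"
        using t by linarith
    qed
    finally show ?thesis .
  qed
  have lower: "q * (1 - 4000 * t) \<le> P"
  proof -
    define y where "y = x + \<kappa>"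
    have y: "1 \<le> y" "y \<le> 101 / 100 * x"
      using k x by (simp_all add: y_def)
    have "y * (8 * \<epsilon> * x) \<le> (101 / 100 * x) * (8 * \<epsilon> * x)"
      using y eps x by (intro mult_right_mono) auto
    also have "\<dots> \<le> 1"
      using eps_x(1) by (simp add: power2_eq_square mult_ac)
    finally have y1: "y * (8 * \<epsilon> * x) \<le> 1" .
    have "y ^ 3 \<le> (101 / 100 * x) ^ 3"
      using y by (intro power_mono) auto
    also have "\<dots> = (101 / 100) ^ 3 * x ^ 3"
      by (rule power_mult_distrib)
    also have "\<dots> \<le> 2 * x ^ 3"
      using x by (intro mult_right_mono) (auto simp: power3_eq_cube)
    finally have "y ^ 3 * (3 * \<epsilon>) \<le> 2 * x ^ 3 * (3 * \<epsilon>)"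
      using eps by (intro mult_right_mono) auto
    then have y2: "3 * \<epsilon> * y ^ 3 \<le> 6 * t"
      by (simp add: t_def mult_ac)
    have step: "avg A (\<lambda>S. of_bool (y - 2 * (8 * \<epsilon> * x) < W s S)) \<ge> (1 - Phi y) * (1 - 600 * (3 * \<epsilon>) * y ^ 3)"
      unfolding WS[symmetric] by (rule S.tail_lower[OF y(1) y1]) (use y2 t in \<open>simp add: mult_ac\<close>)
    have "q * (1 - 40 * t) \<le> q * (1 - 2 * (x * \<kappa>))"
      using k q by (intro mult_left_mono) linarith+
    also have "\<dots> \<le> 1 - Phi y"
      unfolding y_def q_def using k x by (intro one_minus_Phi_shift_up) auto
    finally have qy: "q * (1 - 40 * t) \<le> 1 - Phi y" .
    have qy': "1 - Phi y \<le> q"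
      using Phi_mono[of x y] k by (simp add: q_def y_def)
    have "(1 - Phi y) * (600 * (3 * \<epsilon>) * y ^ 3) \<le> q * (3600 * t)"
    proof (rule mult_mono[OF qy'])
      show "600 * (3 * \<epsilon>) * y ^ 3 \<le> 3600 * t"
        using y2 by simp
    qed (use q eps y in auto)
    moreover have "u - v \<le> w * (1 - r)" if "w * r \<le> v" "u \<le> w" for u v w r :: real
      using that by (simp add: right_diff_distrib)
    ultimately have "q * (1 - 40 * t) - q * (3600 * t) \<le> (1 - Phi y) * (1 - 600 * (3 * \<epsilon>) * y ^ 3)"
      using qy by blast
    also have "\<dots> \<le> avg A (\<lambda>S. of_bool (x + 4 * \<epsilon> * x < W s S))"
      using step by (simp add: y_def \<kappa>_def algebra_simps)
    also have "\<dots> \<le> P + 6 * t * q"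
      using tail_sandwich(2)[OF s] rem by (simp add: P_def)
    finally have "q * (1 - 40 * t) - q * (3600 * t) - 6 * t * q \<le> P"
      by simp
    moreover have "q * (1 - 4000 * t) \<le> q * (1 - 40 * t) - q * (3600 * t) - 6 * t * q"
    proof -
      have "0 \<le> q * t"
        using q t by simp
      then show ?thesis
        by (simp add: algebra_simps)
    qed
    ultimately show ?thesis
      by linarith
  qed
  show ?thesis
    using upper lower unfolding P_def q_def t_def by (simp add: abs_le_iff algebra_simps)
qed

end

section \<open>Crossing times of rectangles\<close>

definition path_edges :: "vertex list \<Rightarrow> edge list" where
  "path_edges p = map (\<lambda>(u, v). lat_edge u v) (zip p (tl p))"

lemma path_edges_simps [simp]:
  "path_edges [] = []"
  "path_edges [v] = []"
  "path_edges (u # v # p) = lat_edge u v # path_edges (v # p)"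
  by (simp_all add: path_edges_def)

lemma passage_time_eq: "passage_time \<omega> p = sum_list (map \<omega> (path_edges p))"
  by (simp add: passage_time_def path_edges_def o_def case_prod_unfold)

lemma passage_time_simps [simp]:
  "passage_time \<omega> [] = 0"
  "passage_time \<omega> [v] = 0"
  "passage_time \<omega> (u # v # p) = \<omega> (lat_edge u v) + passage_time \<omega> (v # p)"
  by (simp_all add: passage_time_eq)

lemma path_edges_append: "path_edges (xs @ v # ys) = path_edges (xs @ [v]) @ path_edges (v # ys)"
proof (induction xs)
  case (Cons x xs)
  then show ?case by (cases xs) auto
qed simp

lemma passage_time_append:
  "passage_time \<omega> (xs @ v # ys) = passage_time \<omega> (xs @ [v]) + passage_time \<omega> (v # ys)"
  unfolding passage_time_eq path_edges_append[of xs v ys] by simp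

lemma passage_time_nonneg: "(\<And>e. 0 \<le> \<omega> e) \<Longrightarrow> 0 \<le> passage_time \<omega> p"
  unfolding passage_time_eq by (rule sum_list_nonneg) auto

lemma passage_time_mono: "(\<And>e. e \<in> set (path_edges p) \<Longrightarrow> \<omega> e \<le> \<omega>' e) \<Longrightarrow> passage_time \<omega> p \<le> passage_time \<omega>' p"
  unfolding passage_time_eq by (rule sum_list_mono) auto

lemma passage_time_cong: "(\<And>e. e \<in> set (path_edges p) \<Longrightarrow> \<omega> e = \<omega>' e) \<Longrightarrow> passage_time \<omega> p = passage_time \<omega>' p"
  unfolding passage_time_eq by (metis map_eq_conv)

section \<open>Lattice walks\<close>

abbreviation walk :: "vertex list \<Rightarrow> bool" where
  "walk \<equiv> successively adj"

lemma adj_cases: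
  assumes "adj u v"
  shows "v = (fst u + 1, snd u) \<or> v = (fst u - 1, snd u) \<or> v = (fst u, snd u + 1) \<or> v = (fst u, snd u - 1)"
proof -
  define i j where "i = fst v - fst u" and "j = snd v - snd u"
  have "\<bar>i\<bar> + \<bar>j\<bar> = 1"
    using assms unfolding adj_def i_def j_def by (metis abs_minus_commute)
  then have "i = 1 \<and> j = 0 \<or> i = -1 \<and> j = 0 \<or> i = 0 \<and> j = 1 \<or> i = 0 \<and> j = -1"
    by (smt (verit))
  then show ?thesis
    by (auto simp: prod_eq_iff i_def j_def)
qed

definition edge_ends :: "edge \<Rightarrow> vertex set" where
  "edge_ends e = {fst e, if snd e then (fst (fst e) + 1, snd (fst e)) else (fst (fst e), snd (fst e) + 1)}"

lemma edge_ends_lat_edge: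
  assumes "adj u v"
  shows "edge_ends (lat_edge u v) = {u, v}"
proof -
  obtain x y where u: "u = (x, y)"
    by (cases u)
  show ?thesis
    using adj_cases[OF assms] unfolding u
    by (elim disjE) (simp_all add: edge_ends_def lat_edge_def min_def insert_commute)
qed

lemma lat_edge_inj:
  assumes "adj u v" "adj u' v'" "lat_edge u v = lat_edge u' v'"
  shows "{u, v} = {u', v'}"
  using edge_ends_lat_edge assms by metis

lemma path_edges_conv:
  assumes "e \<in> set (path_edges p)" "walk p"
  shows "\<exists>u\<in>set p. \<exists>v\<in>set p. adj u v \<and> e = lat_edge u v"
  using assms by (induction p rule: induct_list012) auto

text \<open>An edge determines its endpoints, so repeating an edge would repeat a vertex. Hence a
  change of one weight is felt at most once by a self-avoiding path.\<close>

lemma distinct_path_edges: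
  assumes "walk p" "distinct p"
  shows "distinct (path_edges p)"
  using assms
proof (induction p rule: induct_list012)
  case (3 x y zs)
  have "lat_edge x y \<notin> set (path_edges (y # zs))"
  proof
    assume "lat_edge x y \<in> set (path_edges (y # zs))"
    moreover have "walk (y # zs)"
      using 3 by simp
    ultimately obtain u v where uv: "u \<in> set (y # zs)" "v \<in> set (y # zs)" "adj u v" "lat_edge x y = lat_edge u v"
      using path_edges_conv by blast
    have "{x, y} = {u, v}"
      by (rule lat_edge_inj) (use uv 3 in auto)
    then have "x \<in> {u, v}" by blast
    with uv 3 show False by auto
  qed
  then show ?case using 3 by simp
qed auto

section \<open>Rectangles, strips and their crossings\<close>

definition rect :: "int \<Rightarrow> int \<Rightarrow> nat \<Rightarrow> vertex set" where
  "rect c d k = {v. c \<le> fst v \<and> fst v \<le> d \<and> 0 \<le> snd v \<and> snd v < int k}"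

definition crossings :: "int \<Rightarrow> int \<Rightarrow> nat \<Rightarrow> vertex list set" where
  "crossings c d k = {p. p \<noteq> [] \<and> walk p \<and> set p \<subseteq> rect c d k \<and> fst (hd p) = c \<and> fst (last p) = d}"

lemma crossing_paths_eq: "crossing_paths n k = crossings 0 (int n) k"
  by (auto simp: crossing_paths_def crossings_def rect_def successively_conv_nth)

text \<open>Half-open: the vertical edges of column \<open>c\<close> are included, those of column
  \<open>d\<close> are not and form \<open>vline d k\<close>. Adjacent strips are thus disjoint, as
  needed for independent blocks.\<close>

definition strip :: "int \<Rightarrow> int \<Rightarrow> nat \<Rightarrow> edge set" where
  "strip c d k = {e. c \<le> fst (fst e) \<and> fst (fst e) < d \<and> 0 \<le> snd (fst e) \<and> snd (fst e) < int k}"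

definition vline :: "int \<Rightarrow> nat \<Rightarrow> edge set" where
  "vline c k = (\<lambda>y. ((c, y), False)) ` {0..<int k}"

lemma mem_vline: "((x, y), h) \<in> vline c k \<longleftrightarrow> x = c \<and> 0 \<le> y \<and> y < int k \<and> \<not> h"
  by (auto simp: vline_def)

lemma strip_eq: "strip c d k = (({c..<d} \<times> {0..<int k}) \<times> UNIV)"
  by (auto simp: strip_def)

lemma finite_strip [simp]: "finite (strip c d k)"
  by (simp add: strip_eq)

lemma card_strip: "card (strip c d k) = 2 * (nat (d - c) * k)"
  by (simp add: strip_eq card_cartesian_product)

lemma finite_vline [simp]: "finite (vline c k)"
  by (simp add: vline_def)

lemma card_vline_le: "card (vline c k) \<le> k"
  unfolding vline_def using card_image_le[of "{0..<int k}"] by fastforce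

lemma finite_rect: "finite (rect c d k)"
proof -
  have "rect c d k \<subseteq> {c..d} \<times> {0..<int k}"
    by (auto simp: rect_def)
  then show ?thesis
    by (rule finite_subset) auto
qed

lemma path_edges_rect:
  assumes "walk p" "set p \<subseteq> rect c d k" "e \<in> set (path_edges p)"
  shows "e \<in> strip c d k \<union> vline d k"
proof -
  obtain u v where uv: "u \<in> set p" "v \<in> set p" "adj u v" "e = lat_edge u v"
    using path_edges_conv[OF assms(3,1)] by blast
  obtain x y where u: "u = (x, y)"
    by (cases u)
  have "u \<in> rect c d k" "v \<in> rect c d k"
    using uv assms by auto
  moreover have "v = (x + 1, y) \<or> v = (x - 1, y) \<or> v = (x, y + 1) \<or> v = (x, y - 1)"
    using adj_cases[OF uv(3)] u by simp
  ultimately show ?thesis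
    unfolding uv(4) u by (elim disjE) (auto simp: rect_def strip_def mem_vline lat_edge_def min_def)
qed

text \<open>Loop erasure: cutting out a closed loop keeps both ends and cannot increase the passage
  time.\<close>

lemma crossings_distinct:
  assumes "p \<in> crossings c d k" "\<And>e. 0 \<le> \<omega> e"
  shows "\<exists>p'\<in>crossings c d k. distinct p' \<and> passage_time \<omega> p' \<le> passage_time \<omega> p"
  using assms(1)
proof (induction "length p" arbitrary: p rule: less_induct)
  case less
  show ?case
  proof (cases "distinct p")
    case False
    then obtain xs ys zs y where p: "p = xs @ [y] @ ys @ [y] @ zs"
      using not_distinct_decomp[OF False] by blast
    define q where "q = xs @ y # zs"
    have "walk (xs @ [y])" "walk (y # zs)"
      using less.prems unfolding crossings_def p
      by (auto simp: successively_append_iff successively_Cons)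
    then have "walk q"
      unfolding q_def by (auto simp: successively_append_iff successively_Cons)
    moreover have "hd q = hd p"
      by (cases xs) (simp_all add: p q_def)
    moreover have "last q = last p"
      by (simp add: p q_def)
    moreover have "set q \<subseteq> set p" "q \<noteq> []"
      by (auto simp: p q_def)
    ultimately have "q \<in> crossings c d k"
      using less.prems by (auto simp: crossings_def)
    moreover have "length q < length p"
      by (simp add: p q_def)
    moreover have "passage_time \<omega> q \<le> passage_time \<omega> p"
      using passage_time_append[of \<omega> xs y "ys @ y # zs"] passage_time_append[of \<omega> "y # ys" y zs]
        passage_time_append[of \<omega> xs y zs] passage_time_nonneg[of \<omega> "y # ys @ [y]"] assms(2)
      by (simp add: p q_def)
    ultimately show ?thesis
      using less.hyps[of q] order_trans by blast
  qed (use less.prems in auto)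
qed

text \<open>A step changes the first coordinate by at most 1, so no column is jumped over.\<close>

lemma first_exit:
  assumes "walk p" "p \<noteq> []" "fst (hd p) \<le> m" "m \<le> fst (last p)"
  obtains xs v ys where "p = xs @ v # ys" "fst v = m" "\<And>u. u \<in> set xs \<Longrightarrow> fst u < m"
proof -
  have "\<exists>v\<in>set p. m \<le> fst v"
    using assms last_in_set by blast
  then obtain xs v ys where p: "p = xs @ v # ys" "m \<le> fst v" "\<forall>u\<in>set xs. \<not> m \<le> fst u"
    using split_list_first_prop[of p "\<lambda>v. m \<le> fst v"] by blast
  have "fst v \<le> m"
  proof (cases xs rule: rev_cases)
    case (snoc zs u)
    then have "adj u v" "fst u < m"
      using assms(1) p by (auto simp: successively_append_iff)
    then show ?thesis
      using adj_cases[of u v] by auto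
  qed (use p assms in simp)
  with p show ?thesis
    using that[of xs v ys] by fastforce
qed

lemma last_entry:
  assumes "walk p" "p \<noteq> []" "fst (hd p) \<le> m" "m \<le> fst (last p)"
  obtains xs v ys where "p = xs @ v # ys" "fst v = m" "\<And>u. u \<in> set ys \<Longrightarrow> m < fst u"
proof -
  have "\<exists>v\<in>set p. fst v \<le> m"
    using assms hd_in_set by blast
  then obtain xs v ys where p: "p = xs @ v # ys" "fst v \<le> m" "\<forall>u\<in>set ys. \<not> fst u \<le> m"
    using split_list_last_prop[of p "\<lambda>v. fst v \<le> m"] by blast
  have "m \<le> fst v"
  proof (cases ys)
    case (Cons u zs)
    then have "adj v u" "m < fst u"
      using assms(1) p by (auto simp: successively_append_iff successively_Cons)
    then show ?thesis
      using adj_cases[of v u] by auto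
  qed (use p assms in simp)
  with p show ?thesis
    using that[of xs v ys] by fastforce
qed

lemma vertical_walk:
  assumes "\<And>z. min y y' \<le> z \<Longrightarrow> z < max y y' \<Longrightarrow> \<omega> ((x, z), False) \<le> M"
  obtains p where "p \<noteq> []" "walk p" "hd p = (x, y)" "last p = (x, y')"
    "set p \<subseteq> {x} \<times> {min y y'..max y y'}" "passage_time \<omega> p \<le> M * \<bar>y' - y\<bar>"
  using assms
proof (induction "nat \<bar>y' - y\<bar>" arbitrary: y thesis)
  case 0
  then show ?case using "0.prems"(1)[of "[(x, y)]"] by auto
next
  case (Suc l)
  define y1 where "y1 = (if y < y' then y + 1 else y - 1)"
  have l: "l = nat \<bar>y' - y1\<bar>" "\<bar>y' - y\<bar> = \<bar>y' - y1\<bar> + 1"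
    using Suc.hyps(2) by (auto simp: y1_def)
  have sub: "{min y1 y'..max y1 y'} \<subseteq> {min y y'..max y y'}" "y \<in> {min y y'..max y y'}"
    using Suc.hyps(2) by (auto simp: y1_def)
  have "\<omega> ((x, z), False) \<le> M" if "min y1 y' \<le> z" "z < max y1 y'" for z
  proof (rule Suc.prems(2))
    show "min y y' \<le> z" "z < max y y'"
      using that Suc.hyps(2) by (auto simp: y1_def split: if_splits)
  qed
  then obtain p where p: "p \<noteq> []" "walk p" "hd p = (x, y1)" "last p = (x, y')"
    "set p \<subseteq> {x} \<times> {min y1 y'..max y1 y'}" "passage_time \<omega> p \<le> M * \<bar>y' - y1\<bar>"
    using Suc.hyps(1)[OF l(1)] by blast
  obtain r where r: "p = (x, y1) # r"
    using p by (cases p) auto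
  have "lat_edge (x, y) (x, y1) = ((x, min y y1), False)"
    by (simp add: lat_edge_def y1_def)
  moreover have "min y y' \<le> min y y1" "min y y1 < max y y'"
    using Suc.hyps(2) by (auto simp: y1_def)
  ultimately have le: "\<omega> (lat_edge (x, y) (x, y1)) \<le> M"
    using Suc.prems(2) by metis
  have "adj (x, y) (x, y1)"
    by (simp add: adj_def y1_def)
  show ?case
  proof (rule Suc.prems(1)[of "(x, y) # p"])
    show "walk ((x, y) # p)"
      using p(2) \<open>adj _ _\<close> by (simp add: r)
    show "set ((x, y) # p) \<subseteq> {x} \<times> {min y y'..max y y'}"
    proof -
      have "set p \<subseteq> {x} \<times> {min y y'..max y y'}"
        using p(5) sub(1) by blast
      then show ?thesis
        using sub(2) by simp
    qed
    have "passage_time \<omega> ((x, y) # p) \<le> M + M * \<bar>y' - y1\<bar>"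
      using le p(6) by (simp add: r)
    also have "\<dots> = M * \<bar>y' - y\<bar>"
      by (simp add: l(2) distrib_left)
    finally show "passage_time \<omega> ((x, y) # p) \<le> M * \<bar>y' - y\<bar>" .
  qed (use p in auto)
qed

lemma horizontal_walk:
  assumes "x \<le> x'" "\<And>z. x \<le> z \<Longrightarrow> z < x' \<Longrightarrow> \<omega> ((z, y), True) \<le> M"
  obtains p where "p \<noteq> []" "walk p" "hd p = (x, y)" "last p = (x', y)"
    "set p \<subseteq> {x..x'} \<times> {y}" "passage_time \<omega> p \<le> M * (x' - x)"
  using assms
proof (induction "nat (x' - x)" arbitrary: x thesis)
  case 0
  then show ?case using "0.prems"(1)[of "[(x, y)]"] by auto
next
  case (Suc l)
  have "l = nat (x' - (x + 1))" "x + 1 \<le> x'"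
    using Suc.hyps(2) by auto
  then obtain p where p: "p \<noteq> []" "walk p" "hd p = (x + 1, y)" "last p = (x', y)"
    "set p \<subseteq> {x + 1..x'} \<times> {y}" "passage_time \<omega> p \<le> M * (x' - (x + 1))"
    using Suc.hyps(1)[of "x + 1"] Suc.prems(3) by auto
  obtain r where r: "p = (x + 1, y) # r"
    using p by (cases p) auto
  have "lat_edge (x, y) (x + 1, y) = ((x, y), True)"
    by (simp add: lat_edge_def)
  then have le: "\<omega> (lat_edge (x, y) (x + 1, y)) \<le> M"
    using Suc.prems(3)[of x] \<open>x + 1 \<le> x'\<close> by simp
  have "adj (x, y) (x + 1, y)"
    by (simp add: adj_def)
  show ?case
  proof (rule Suc.prems(1)[of "(x, y) # p"])
    show "walk ((x, y) # p)"
      using p(2) \<open>adj _ _\<close> by (simp add: r)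
    show "set ((x, y) # p) \<subseteq> {x..x'} \<times> {y}"
      using p(5) \<open>x + 1 \<le> x'\<close> by auto
    have "passage_time \<omega> ((x, y) # p) \<le> M + M * (x' - (x + 1))"
      using le p(6) by (simp add: r)
    then show "passage_time \<omega> ((x, y) # p) \<le> M * (x' - x)"
      by (simp add: algebra_simps)
  qed (use p in auto)
qed

lemma walk_join:
  assumes "walk p" "walk q" "p \<noteq> []" "q \<noteq> []" "last p = hd q"
  shows "walk (p @ tl q)" "hd (p @ tl q) = hd p" "last (p @ tl q) = last q"
    "set (p @ tl q) = set p \<union> set q"
    "passage_time \<omega> (p @ tl q) = passage_time \<omega> p + passage_time \<omega> q"
proof -
  obtain v r where q: "q = v # r"
    using assms by (cases q) auto
  obtain s where p: "p = s @ [v]"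
    using assms q by (cases p rule: rev_cases) auto
  show "walk (p @ tl q)"
    using assms(1,2) by (auto simp: p q successively_append_iff successively_Cons)
  show "hd (p @ tl q) = hd p"
    using assms(3) by simp
  show "last (p @ tl q) = last q" "set (p @ tl q) = set p \<union> set q"
    by (auto simp: p q)
  show "passage_time \<omega> (p @ tl q) = passage_time \<omega> p + passage_time \<omega> q"
    using passage_time_append[of \<omega> s v r] by (simp add: p q)
qed

section \<open>Crossing times for weights a and b\<close>

locale two_weights =
  fixes a b :: real
  assumes a_pos: "0 < a" and a_less_b: "a < b"
begin

definition weights :: "edge set \<Rightarrow> edge \<Rightarrow> real" where
  "weights S e = (if e \<in> S then b else a)"

lemma weights_bounds: "0 \<le> weights S e" "a \<le> weights S e" "weights S e \<le> b"
  using a_pos a_less_b by (auto simp: weights_def)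

definition T :: "int \<Rightarrow> int \<Rightarrow> nat \<Rightarrow> edge set \<Rightarrow> real" where
  "T c d k S = Inf (passage_time (weights S) ` crossings c d k)"

lemma crossing_time_eq: "crossing_time n k (weights S) = T 0 (int n) k S"
  by (simp add: crossing_time_def T_def crossing_paths_eq)

lemma T_le:
  assumes "p \<in> crossings c d k"
  shows "T c d k S \<le> passage_time (weights S) p"
  unfolding T_def
proof (rule cInf_lower)
  show "bdd_below (passage_time (weights S) ` crossings c d k)"
    using passage_time_nonneg[of "weights S"] weights_bounds by (intro bdd_belowI[of _ 0]) auto
qed (use assms in auto)

lemma straight_crossing:
  assumes "0 < k" "c \<le> d"
  obtains p where "p \<in> crossings c d k" "passage_time (weights S) p \<le> b * (d - c)"
proof -
  obtain p where p: "p \<noteq> []" "walk p" "hd p = (c, 0)" "last p = (d, 0)"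
    "set p \<subseteq> {c..d} \<times> {0}" "passage_time (weights S) p \<le> b * (d - c)"
    using horizontal_walk[of c d "weights S" 0 b] assms weights_bounds by auto
  have "p \<in> crossings c d k"
    using p assms by (auto simp: crossings_def rect_def)
  with p that show ?thesis by blast
qed

text \<open>The infimum is attained: loop erasure reduces to self-avoiding crossings, of which there
  are finitely many.\<close>

lemma geodesic:
  assumes "0 < k" "c \<le> d"
  obtains p where "p \<in> crossings c d k" "distinct p" "T c d k S = passage_time (weights S) p"
proof -
  let ?D = "{p \<in> crossings c d k. distinct p}"
  let ?t = "passage_time (weights S)"
  have "?D \<subseteq> {p. set p \<subseteq> rect c d k \<and> distinct p}"
    by (auto simp: crossings_def)
  then have fin: "finite ?D"
    by (rule finite_subset) (rule finite_subset_distinct[OF finite_rect])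
  obtain p0 where "p0 \<in> crossings c d k"
    using straight_crossing[OF assms] by metis
  then have ne: "?D \<noteq> {}"
    using crossings_distinct[of p0 c d k "weights S"] weights_bounds(1) by blast
  define p where "p = arg_min_on ?t ?D"
  have p: "p \<in> ?D"
    unfolding p_def by (rule arg_min_if_finite) (use fin ne in auto)
  have min: "?t p \<le> ?t q" if q: "q \<in> crossings c d k" for q
  proof -
    obtain q' where q': "q' \<in> crossings c d k" "distinct q'" "?t q' \<le> ?t q"
      using crossings_distinct[OF q, of "weights S"] weights_bounds(1) by blast
    have "?t p \<le> ?t q'"
      unfolding p_def by (rule arg_min_least) (use fin ne q' in auto)
    with q' show ?thesis by simp
  qed
  have "T c d k S = ?t p"
    unfolding T_def by (rule cInf_eq_minimum) (use p min in auto)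
  with p that show ?thesis by blast
qed

lemma T_bounds:
  assumes "0 < k" "c \<le> d"
  shows "0 \<le> T c d k S" "T c d k S \<le> b * (d - c)"
proof -
  show "0 \<le> T c d k S"
    using geodesic[OF assms, of S] passage_time_nonneg[of "weights S"] weights_bounds(1) by metis
  show "T c d k S \<le> b * (d - c)"
    by (rule straight_crossing[OF assms, of S]) (use T_le[of _ c d k S] in fastforce)
qed

lemma T_mono:
  assumes "0 < k" "c \<le> d" "S \<subseteq> S'"
  shows "T c d k S \<le> T c d k S'"
proof -
  obtain p where p: "p \<in> crossings c d k" "T c d k S' = passage_time (weights S') p"
    using geodesic[OF assms(1,2)] by metis
  have "passage_time (weights S) p \<le> passage_time (weights S') p"
    using assms(3) a_less_b by (intro passage_time_mono) (auto simp: weights_def)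
  with p T_le[OF p(1), of S] show ?thesis by simp
qed

text \<open>A self-avoiding geodesic for \<open>S\<close> uses \<open>e\<close> at most
  once.\<close>

lemma T_insert_le:
  assumes "0 < k" "c \<le> d"
  shows "T c d k (insert e S) \<le> T c d k S + (b - a)"
proof -
  obtain p where p: "p \<in> crossings c d k" "distinct p" "T c d k S = passage_time (weights S) p"
    using geodesic[OF assms] by metis
  have dist: "distinct (path_edges p)"
    using p distinct_path_edges by (auto simp: crossings_def)
  have "T c d k (insert e S) \<le> passage_time (weights (insert e S)) p"
    by (rule T_le[OF p(1)])
  also have "\<dots> = (\<Sum>e'\<in>set (path_edges p). weights (insert e S) e')"
    by (simp add: passage_time_eq sum_list_distinct_conv_sum_set dist)
  also have "\<dots> \<le> (\<Sum>e'\<in>set (path_edges p). weights S e' + (if e' = e then b - a else 0))"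
    using a_less_b by (intro sum_mono) (auto simp: weights_def)
  also have "\<dots> \<le> (\<Sum>e'\<in>set (path_edges p). weights S e') + (b - a)"
    using a_less_b by (simp add: sum.distrib)
  also have "\<dots> = T c d k S + (b - a)"
    by (simp add: p passage_time_eq sum_list_distinct_conv_sum_set dist)
  finally show ?thesis .
qed

lemma T_diff_insert:
  assumes "0 < k" "c \<le> d"
  shows "\<bar>T c d k (insert e S) - T c d k S\<bar> \<le> b - a"
  using T_insert_le[OF assms, of e S] T_mono[OF assms subset_insertI[of S e]] by linarith

lemma T_union_le:
  assumes "0 < k" "c \<le> d" "finite V"
  shows "T c d k (S \<union> V) \<le> T c d k S + (b - a) * card V"
  using assms(3)
proof (induction V rule: finite_induct)
  case (insert e V)
  have "T c d k (S \<union> insert e V) \<le> T c d k (S \<union> V) + (b - a)"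
    using T_insert_le[OF assms(1,2), of e "S \<union> V"] by simp
  then show ?case
    using insert by (simp add: algebra_simps)
qed simp

lemma depends_on_T: "depends_on (strip c d k \<union> vline d k) (T c d k)"
  unfolding depends_on_def T_def
proof
  fix S
  have "passage_time (weights S) p = passage_time (weights (S \<inter> (strip c d k \<union> vline d k))) p"
    if "p \<in> crossings c d k" for p
  proof (rule passage_time_cong)
    fix e assume "e \<in> set (path_edges p)"
    then have "e \<in> strip c d k \<union> vline d k"
      using path_edges_rect[of p c d k e] that by (simp add: crossings_def)
    then show "weights S e = weights (S \<inter> (strip c d k \<union> vline d k)) e"
      by (simp add: weights_def)
  qed
  then show "Inf (passage_time (weights S) ` crossings c d k)
      = Inf (passage_time (weights (S \<inter> (strip c d k \<union> vline d k))) ` crossings c d k)"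
    by (intro arg_cong[where f = Inf] image_cong refl)
qed

text \<open>The part of a geodesic up to its first visit to column \<open>m\<close> stays in the
  left rectangle, the part after its last visit in the right one; what lies between is
  discarded.\<close>

lemma T_superadditive:
  assumes "0 < k" "c \<le> m" "m \<le> d"
  shows "T c m k S + T m d k S \<le> T c d k S"
proof -
  have cd: "c \<le> d" using assms by simp
  obtain p where p: "p \<in> crossings c d k" "T c d k S = passage_time (weights S) p"
    using geodesic[OF assms(1) cd] by metis
  then have p': "walk p" "p \<noteq> []" "fst (hd p) = c" "fst (last p) = d" "set p \<subseteq> rect c d k"
    by (auto simp: crossings_def)
  obtain xs v ys where 1: "p = xs @ v # ys" "fst v = m" "\<And>u. u \<in> set xs \<Longrightarrow> fst u < m"
    using first_exit[of p m] p' assms by metis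
  have w1: "walk (xs @ [v])" and w2: "walk (v # ys)"
    using p'(1) unfolding 1(1) by (auto simp: successively_append_iff)
  have "hd (xs @ [v]) = hd p"
    by (cases xs) (auto simp: 1)
  then have c1: "xs @ [v] \<in> crossings c m k"
    using w1 p' 1 by (fastforce simp: crossings_def rect_def)
  obtain zs w us where 2: "v # ys = zs @ w # us" "fst w = m" "\<And>u. u \<in> set us \<Longrightarrow> m < fst u"
  proof (rule last_entry[OF w2])
    show "m \<le> fst (last (v # ys))"
      using p'(4) assms by (auto simp: 1)
  qed (use 1 in auto)
  have "last (w # us) = last (v # ys)"
    unfolding 2(1) by simp
  then have "last (w # us) = last p"
    by (simp add: 1)
  moreover have "walk (w # us)"
    using w2 unfolding 2(1) by (auto simp: successively_append_iff)
  moreover have "set (w # us) \<subseteq> set p"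
    using arg_cong[OF 2(1), of set] by (auto simp: 1)
  ultimately have c2: "w # us \<in> crossings m d k"
    using p' 2(2,3) by (fastforce simp: crossings_def rect_def)
  have "passage_time (weights S) p = passage_time (weights S) (xs @ [v]) + passage_time (weights S) (v # ys)"
    unfolding 1(1) by (rule passage_time_append)
  moreover have "passage_time (weights S) (v # ys) = passage_time (weights S) (zs @ [w]) + passage_time (weights S) (w # us)"
    unfolding 2(1) by (rule passage_time_append)
  moreover have "0 \<le> passage_time (weights S) (zs @ [w])"
    by (rule passage_time_nonneg) (rule weights_bounds)
  ultimately show ?thesis
    using T_le[OF c1, of S] T_le[OF c2, of S] p(2) by linarith
qed

text \<open>The two geodesics meet column \<open>m\<close> at different heights. They are joined
  along this column, whose edges are all cheap.\<close>

lemma T_subadditive: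
  assumes "0 < k" "c \<le> m" "m \<le> d" "S \<inter> vline m k = {}"
  shows "T c d k S \<le> T c m k S + T m d k S + a * k"
proof -
  let ?t = "passage_time (weights S)"
  obtain p where p: "p \<in> crossings c m k" "T c m k S = ?t p"
    using geodesic[OF assms(1,2)] by metis
  obtain q where q: "q \<in> crossings m d k" "T m d k S = ?t q"
    using geodesic[OF assms(1,3)] by metis
  define y y' where "y = snd (last p)" and "y' = snd (hd q)"
  have pl: "last p = (m, y)" "0 \<le> y" "y < int k"
  proof -
    have "last p \<in> rect c m k" "fst (last p) = m"
      using p by (auto simp: crossings_def)
    then show "last p = (m, y)" "0 \<le> y" "y < int k"
      by (auto simp: y_def rect_def prod_eq_iff)
  qed
  have qh: "hd q = (m, y')" "0 \<le> y'" "y' < int k"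
  proof -
    have "hd q \<in> rect m d k" "fst (hd q) = m"
      using q by (auto simp: crossings_def)
    then show "hd q = (m, y')" "0 \<le> y'" "y' < int k"
      by (auto simp: y'_def rect_def prod_eq_iff)
  qed
  have "weights S ((m, z), False) \<le> a" if "min y y' \<le> z" "z < max y y'" for z
  proof -
    have "((m, z), False) \<in> vline m k"
      unfolding mem_vline using that pl qh by (auto simp: min_le_iff_disj less_max_iff_disj)
    then show ?thesis
      using assms(4) by (auto simp: weights_def)
  qed
  then obtain r where r: "r \<noteq> []" "walk r" "hd r = (m, y)" "last r = (m, y')"
    "set r \<subseteq> {m} \<times> {min y y'..max y y'}" "?t r \<le> a * \<bar>y' - y\<bar>"
    using vertical_walk[of y y' "weights S" m a] by blast
  have r_rect: "set r \<subseteq> rect c d k"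
    using r(5) pl qh assms by (fastforce simp: rect_def)
  have p': "walk p" "p \<noteq> []" "fst (hd p) = c" "set p \<subseteq> rect c m k"
    and q': "walk q" "q \<noteq> []" "fst (last q) = d" "set q \<subseteq> rect m d k"
    using p q by (auto simp: crossings_def)
  note j1 = walk_join[OF p'(1) r(2) p'(2) r(1)]
  have j1': "last p = hd r" using pl r by simp
  have "last (p @ tl r) = hd q"
    using j1(3)[OF j1'] r qh by simp
  note j2 = walk_join[OF j1(1)[OF j1'] q'(1) _ q'(2) this]
  have "rect c m k \<subseteq> rect c d k" "rect m d k \<subseteq> rect c d k"
    using assms by (auto simp: rect_def)
  then have "(p @ tl r) @ tl q \<in> crossings c d k"
    using j2 j1 j1' p' q' r_rect unfolding crossings_def by auto
  from T_le[OF this, of S] have "T c d k S \<le> ?t p + ?t r + ?t q"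
    using j2(5) j1(5) j1' p'(2) by simp
  also have "?t r \<le> a * k"
  proof -
    have "\<bar>y' - y\<bar> \<le> int k"
      using pl qh by linarith
    then have "a * \<bar>y' - y\<bar> \<le> a * k"
      using a_pos by (intro mult_left_mono) linarith+
    with r(6) show ?thesis by linarith
  qed
  finally show ?thesis
    using p q by simp
qed

text \<open>Intersecting with the half-open strip makes the right side of each block cheap. This
  only lowers the block times and leaves them depending on disjoint edge sets.\<close>

lemma sum_blocks_le_T:
  fixes c :: "nat \<Rightarrow> int"
  assumes "0 < k" "mono c"
  shows "(\<Sum>i<m. T (c i) (c (Suc i)) k (S \<inter> strip (c i) (c (Suc i)) k)) \<le> T (c 0) (c m) k S"
proof (induction m)
  case 0
  then show ?case using T_bounds[OF assms(1), of "c 0" "c 0" S] by simp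
next
  case (Suc m)
  have le: "c 0 \<le> c m" "c m \<le> c (Suc m)"
    using assms(2) by (auto simp: mono_def)
  have "T (c m) (c (Suc m)) k (S \<inter> strip (c m) (c (Suc m)) k) \<le> T (c m) (c (Suc m)) k S"
    by (rule T_mono) (use assms le in auto)
  then show ?case
    using Suc T_superadditive[OF assms(1) le, of S] by simp
qed

text \<open>All cut columns, including the right side of the last block, are made cheap. Restoring
  them costs at most \<open>(b - a) * m * k\<close>, joining the blocks along them at most
  \<open>a * m * k\<close>; together \<open>b * m * k\<close>.\<close>

lemma T_le_sum_blocks:
  fixes c :: "nat \<Rightarrow> int"
  assumes "0 < k" "mono c"
  shows "T (c 0) (c m) k S \<le> (\<Sum>i<m. T (c i) (c (Suc i)) k (S \<inter> strip (c i) (c (Suc i)) k)) + b * m * k"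
proof -
  define V where "V = (\<Union>i\<in>{0<..m}. vline (c i) k)"
  have finV: "finite V"
    by (simp add: V_def)
  have "card V \<le> (\<Sum>i\<in>{0<..m}. card (vline (c i) k))"
    unfolding V_def by (rule card_UN_le) simp
  also have "\<dots> \<le> (\<Sum>i\<in>{0<..m}. k)"
    by (intro sum_mono card_vline_le)
  finally have cardV: "card V \<le> m * k" by simp
  define S' where "S' = S - V"
  have S'V: "S' \<inter> vline (c i) k = {}" if "0 < i" "i \<le> m" for i
    using that by (auto simp: S'_def V_def)
  have le: "c 0 \<le> c i" "c i \<le> c (Suc i)" for i
    using assms(2) by (auto simp: mono_def)
  have join: "T (c 0) (c j) k S' \<le> (\<Sum>i<j. T (c i) (c (Suc i)) k S') + a * j * k" if "j \<le> m" for j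
    using that
  proof (induction j)
    case 0
    then show ?case using T_bounds(2)[OF assms(1), of "c 0" "c 0" S'] by simp
  next
    case (Suc j)
    show ?case
    proof (cases "j = 0")
      case True
      then show ?thesis using a_pos by simp
    next
      case False
      then have "T (c 0) (c (Suc j)) k S' \<le> T (c 0) (c j) k S' + T (c j) (c (Suc j)) k S' + a * k"
        using Suc.prems by (intro T_subadditive assms le S'V) auto
      then show ?thesis
        using Suc by (simp add: algebra_simps)
    qed
  qed
  \<comment> \<open>The right side of each block is already cheap under \<open>S'\<close>, so
    restricting to the half-open strip loses nothing.\<close>
  have block: "T (c i) (c (Suc i)) k S' \<le> T (c i) (c (Suc i)) k (S \<inter> strip (c i) (c (Suc i)) k)" if "i < m" for i
  proof -
    have "T (c i) (c (Suc i)) k S' = T (c i) (c (Suc i)) k (S' \<inter> (strip (c i) (c (Suc i)) k \<union> vline (c (Suc i)) k))"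
      using depends_on_T unfolding depends_on_def by blast
    also have "\<dots> \<le> T (c i) (c (Suc i)) k (S \<inter> strip (c i) (c (Suc i)) k)"
    proof (rule T_mono[OF assms(1) le(2)])
      show "S' \<inter> (strip (c i) (c (Suc i)) k \<union> vline (c (Suc i)) k) \<subseteq> S \<inter> strip (c i) (c (Suc i)) k"
        using S'V[of "Suc i"] that by (auto simp: S'_def)
    qed
    finally show ?thesis .
  qed
  have "T (c 0) (c m) k S \<le> T (c 0) (c m) k (S' \<union> V)"
    using assms le by (intro T_mono) (auto simp: S'_def)
  also have "\<dots> \<le> T (c 0) (c m) k S' + (b - a) * card V"
    using assms le finV by (intro T_union_le)
  also have "(b - a) * card V \<le> (b - a) * (m * k)"
    using a_less_b cardV by (intro mult_left_mono) linarith+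
  also have "T (c 0) (c m) k S' \<le> (\<Sum>i<m. T (c i) (c (Suc i)) k S') + a * m * k"
    by (rule join) simp
  also have "(\<Sum>i<m. T (c i) (c (Suc i)) k S') \<le> (\<Sum>i<m. T (c i) (c (Suc i)) k (S \<inter> strip (c i) (c (Suc i)) k))"
    by (intro sum_mono block) simp
  finally show ?thesis
    by (simp add: algebra_simps)
qed

end

section \<open>A lower bound for the variance\<close>

text \<open>The influence of \<open>e\<close> on \<open>f\<close>, equivalently the difference of
  the conditional means given that \<open>e\<close> is expensive or cheap.\<close>

definition pivotal :: "'e set \<Rightarrow> ('e set \<Rightarrow> real) \<Rightarrow> 'e \<Rightarrow> real" where
  "pivotal A f e = avg A (\<lambda>S. f (insert e S) - f (S - {e}))"

lemma depends_on_mem: "depends_on {e} (\<lambda>S. g (e \<in> S))"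
  by (simp add: depends_on_def)

text \<open>Splitting over the two states of \<open>e\<close>. It turns the covariance with
  \<open>card S\<close> into a sum of influences.\<close>

lemma avg_mem:
  assumes "finite A" "e \<in> A"
  shows "avg A (\<lambda>S. f S * (of_bool (e \<in> S) - 1 / 2)) = avg A (\<lambda>S. f (insert e S) - f (S - {e})) / 4"
proof -
  have "avg A (\<lambda>S. f S * (of_bool (e \<in> S) - 1 / 2))
      = (avg A (\<lambda>S. - (1 / 2) * f (S - {e})) + avg A (\<lambda>S. 1 / 2 * f (insert e S))) / 2"
    by (subst avg_split[OF assms]) (simp add: mult.commute)
  also have "\<dots> = avg A (\<lambda>S. f (insert e S) - f (S - {e})) / 4"
    unfolding avg_cmult avg_diff by (simp add: field_simps)
  finally show ?thesis .
qed

text \<open>Cauchy-Schwarz for the covariance of \<open>f\<close> and \<open>card S\<close>.\<close>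
lemma variance_ge_pivotal:
  assumes "finite A"
  shows "(\<Sum>e\<in>A. pivotal A f e)\<^sup>2 \<le> 4 * card A * avg A (\<lambda>S. (f S - avg A f)\<^sup>2)"
proof -
  define z :: "'a \<Rightarrow> 'a set \<Rightarrow> real" where "z = (\<lambda>e S. of_bool (e \<in> S) - 1 / 2)"
  have z0: "avg A (z e) = 0" if "e \<in> A" for e
    using avg_mem[OF assms that, of "\<lambda>_. 1"] assms by (simp add: z_def)
  have dep: "depends_on {e} (z e)" for e
    unfolding z_def by (rule depends_on_mem)
  have cross: "avg A (\<lambda>S. z e S * z e' S) = of_bool (e = e') / 4" if "e \<in> A" "e' \<in> A" for e e'
  proof (cases "e = e'")
    case True
    have "z e S * z e S = 1 / 4" for S
      by (simp add: z_def)
    then have "avg A (\<lambda>S. z e S * z e S) = 1 / 4"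
      using assms by (simp only: avg_const)
    with True show ?thesis by simp
  next
    case False
    have "avg A (\<lambda>S. z e S * z e' S) = avg A (z e) * avg A (z e')"
      by (rule avg_mult_indep[OF assms dep dep]) (use False in simp)
    with False z0 that show ?thesis by simp
  qed
  define tot where "tot = (\<lambda>S. \<Sum>e\<in>A. z e S)"
  have "avg A (\<lambda>S. (tot S)\<^sup>2) = (\<Sum>e\<in>A. \<Sum>e'\<in>A. avg A (\<lambda>S. z e S * z e' S))"
    unfolding tot_def power2_eq_square sum_product avg_sum ..
  also have "\<dots> = (\<Sum>e\<in>A. \<Sum>e'\<in>A. of_bool (e = e') / 4)"
    by (intro sum.cong refl) (simp add: cross)
  also have "\<dots> = (\<Sum>e\<in>A. 1 / 4)"
    using assms by (intro sum.cong refl) (simp add: of_bool_def flip: sum_divide_distrib)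
  finally have chi: "avg A (\<lambda>S. (tot S)\<^sup>2) = card A / 4"
    by simp
  let ?f = "\<lambda>S. f S - avg A f"
  have "avg A (\<lambda>S. ?f S * tot S) = (\<Sum>e\<in>A. avg A (\<lambda>S. ?f S * z e S))"
    unfolding tot_def sum_distrib_left avg_sum ..
  also have "\<dots> = (\<Sum>e\<in>A. pivotal A f e / 4)"
    by (intro sum.cong refl) (simp add: z_def avg_mem[OF assms, where f = ?f] pivotal_def)
  finally have "avg A (\<lambda>S. ?f S * tot S) = (\<Sum>e\<in>A. pivotal A f e) / 4"
    by (simp add: sum_divide_distrib)
  then have "((\<Sum>e\<in>A. pivotal A f e) / 4)\<^sup>2 \<le> avg A (\<lambda>S. (?f S)\<^sup>2) * (card A / 4)"
    using avg_Cauchy_Schwarz[of A ?f tot] by (simp only: chi)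
  then show ?thesis
    by (simp add: power_divide mult_ac)
qed

text \<open>Removing \<open>B\<close> amounts to conditioning on all its edges being cheap, an event
  of probability \<open>1 / 2 ^ card B\<close>.\<close>

lemma avg_remove_le:
  assumes "finite A" "finite B" "B \<subseteq> A" "\<And>S. 0 \<le> g S"
  shows "avg A (\<lambda>S. g (S - B)) \<le> 2 ^ card B * avg A g"
  using assms(2,3)
proof (induction B rule: finite_induct)
  case (insert e B)
  have nonneg: "0 \<le> avg A (\<lambda>S. h S)" if "\<And>S. 0 \<le> h S" for h :: "'a set \<Rightarrow> real"
    by (rule avg_nonneg) (rule that)
  have "avg A (\<lambda>S. g (S - insert e B)) = avg A (\<lambda>S. g (S - {e} - B))"
    by (intro avg_cong arg_cong[where f = g]) auto
  also have "\<dots> \<le> 2 * avg A (\<lambda>S. g (S - B))"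
    using avg_split[OF assms(1), of e "\<lambda>S. g (S - B)"] insert.prems
      nonneg[of "\<lambda>S. g (insert e S - B)"] assms(4) by simp
  also have "\<dots> \<le> 2 * (2 ^ card B * avg A g)"
    using insert by simp
  finally show ?case
    using insert by simp
qed simp

lemma pivotal_nonneg:
  assumes "\<And>S S'. S \<subseteq> S' \<Longrightarrow> f S \<le> f S'"
  shows "0 \<le> pivotal A f e"
  unfolding pivotal_def by (rule avg_nonneg) (simp add: assms subset_insertI2)

text \<open>The edges of \<open>B\<close> are made cheap one by one. Each drop is at most the effect
  of one edge with others already made cheap, and this conditioning costs a power of 2. For boxes of
  bounded size the factor is a constant.\<close>

lemma avg_drop_le_pivotal:
  assumes "finite A" "finite B" "B \<subseteq> A" and mono: "\<And>S S'. S \<subseteq> S' \<Longrightarrow> f S \<le> f S'"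
  shows "avg A (\<lambda>S. f S - f (S - B)) \<le> 2 ^ card B * (\<Sum>e\<in>B. pivotal A f e)"
  using assms(2,3)
proof (induction B rule: finite_induct)
  case empty
  then show ?case using assms(1) by simp
next
  case (insert e B)
  define g where "g = (\<lambda>S. f (insert e S) - f (S - {e}))"
  have "avg A (\<lambda>S. f S - f (S - insert e B)) =
      avg A (\<lambda>S. f S - f (S - B)) + avg A (\<lambda>S. f (S - B) - f (S - insert e B))"
    unfolding avg_add[symmetric] by simp
  also have "avg A (\<lambda>S. f (S - B) - f (S - insert e B)) \<le> avg A (\<lambda>S. g (S - B))"
  proof (rule avg_mono)
    fix S
    have "f (S - B) \<le> f (insert e (S - B))"
      by (rule mono) auto
    moreover have "S - insert e B = S - B - {e}"
      by auto
    ultimately show "f (S - B) - f (S - insert e B) \<le> g (S - B)"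
      by (simp add: g_def)
  qed
  also have "\<dots> \<le> 2 ^ card B * pivotal A f e"
    unfolding pivotal_def g_def
    by (rule avg_remove_le) (use assms(1) insert in \<open>auto intro!: mono\<close>)
  also have "avg A (\<lambda>S. f S - f (S - B)) \<le> 2 ^ card B * (\<Sum>e\<in>B. pivotal A f e)"
    using insert by simp
  finally have "avg A (\<lambda>S. f S - f (S - insert e B)) \<le> 2 ^ card B * (\<Sum>e\<in>insert e B. pivotal A f e)"
    using insert by (simp add: algebra_simps)
  also have "\<dots> \<le> 2 ^ card (insert e B) * (\<Sum>e\<in>insert e B. pivotal A f e)"
    using insert by (intro mult_right_mono sum_nonneg pivotal_nonneg mono) auto
  finally show ?case .
qed

section \<open>Oriented paths of cheap edges are subcritical\<close>

text \<open>Oriented paths: steps to the right and steps in the vertical direction \<open>d \<in> {1, -1}\<close>;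
  edges outside \<open>S\<close> carry the small weight.\<close>

definition vedge :: "int \<Rightarrow> vertex \<Rightarrow> edge" where
  "vedge d v = ((fst v, min (snd v) (snd v + d)), False)"

fun oriented :: "int \<Rightarrow> nat \<Rightarrow> edge set \<Rightarrow> vertex \<Rightarrow> edge set \<Rightarrow> bool" where
  "oriented d 0 A v S \<longleftrightarrow> True"
| "oriented d (Suc j) A v S \<longleftrightarrow>
     ((v, True) \<in> A - S \<and> oriented d j A (fst v + 1, snd v) S) \<or>
     (vedge d v \<in> A - S \<and> oriented d j A (fst v, snd v + d) S)"

text \<open>The value of \<open>fst + d * snd\<close> at the end from which an oriented path enters
  the edge. For \<open>d = -1\<close> a vertical edge is entered from its upper end but stored by
  its lower one, hence the correction.\<close>

definition level :: "int \<Rightarrow> edge \<Rightarrow> int" where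
  "level d e = fst (fst e) + d * snd (fst e) - of_bool (\<not> snd e \<and> d = -1)"

lemma level_simps [simp]:
  "level d (v, True) = fst v + d * snd v"
  "d = 1 \<or> d = -1 \<Longrightarrow> level d (vedge d v) = fst v + d * snd v"
  by (auto simp: level_def vedge_def)

lemma depends_on_open: "e \<in> C \<Longrightarrow> depends_on C (\<lambda>S. e \<in> A - S)"
  by (simp add: depends_on_def)

text \<open>Each oriented step raises the level by 1, so a continuation is independent of all edges
  below its starting level.\<close>

lemma oriented_depends_level:
  assumes "d = 1 \<or> d = -1"
  shows "depends_on {e. fst v + d * snd v \<le> level d e} (oriented d j A v)"
proof (induction j arbitrary: v)
  case 0
  then show ?case by (simp add: depends_on_def)
next
  case (Suc j)
  let ?C = "{e. fst v + d * snd v \<le> level d e}"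
  have d2: "d * d = 1"
    using assms by auto
  have h: "depends_on ?C (oriented d j A (fst v + 1, snd v))"
    by (rule depends_on_mono[OF Suc.IH]) auto
  have w: "depends_on ?C (oriented d j A (fst v, snd v + d))"
    by (rule depends_on_mono[OF Suc.IH]) (auto simp: algebra_simps d2)
  have 1: "depends_on ?C (\<lambda>S. (v, True) \<in> A - S)" and 2: "depends_on ?C (\<lambda>S. vedge d v \<in> A - S)"
    by (rule depends_on_open; use assms in simp)+
  show ?case
    unfolding oriented.simps
    by (intro depends_on_comp2[where h = "(\<or>)"] depends_on_comp2[where h = "(\<and>)"] h w 1 2)
qed

text \<open>Confinement of paths of length \<open>j\<close> to \<open>j\<close> columns makes the
  events of different strips independent.\<close>

lemma oriented_depends_strip:
  "depends_on {e. fst v \<le> fst (fst e) \<and> fst (fst e) < fst v + int j} (oriented d j A v)"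
proof (induction j arbitrary: v)
  case 0
  then show ?case by (simp add: depends_on_def)
next
  case (Suc j)
  let ?C = "{e :: edge. fst v \<le> fst (fst e) \<and> fst (fst e) < fst v + int (Suc j)}"
  have h: "depends_on ?C (oriented d j A (fst v + 1, snd v))"
    by (rule depends_on_mono[OF Suc.IH]) auto
  have w: "depends_on ?C (oriented d j A (fst v, snd v + d))"
    by (rule depends_on_mono[OF Suc.IH]) auto
  have 1: "depends_on ?C (\<lambda>S. (v, True) \<in> A - S)" and 2: "depends_on ?C (\<lambda>S. vedge d v \<in> A - S)"
    by (rule depends_on_open; simp add: vedge_def)+
  show ?case
    unfolding oriented.simps
    by (intro depends_on_comp2[where h = "(\<or>)"] depends_on_comp2[where h = "(\<and>)"] h w 1 2)
qed

text \<open>Inclusion-exclusion for the middle vertex, which is reachable in two ways. Subtracting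
  the product is what brings the growth factor below 1: without it the probabilities add up to 1/4 +
  1/2 + 1/4.\<close>

lemma two_steps_bound:
  fixes a1 a2 a3 a4 a5 a6 r1 r2 r3 :: bool
  shows "of_bool (a1 \<and> (a2 \<and> r1 \<or> a3 \<and> r2) \<or> a4 \<and> (a5 \<and> r2 \<or> a6 \<and> r3))
    \<le> (of_bool a1 * of_bool a2) * of_bool r1
      + (of_bool a1 * of_bool a3 + of_bool a4 * of_bool a5
          - (of_bool a1 * of_bool a3) * (of_bool a4 * of_bool a5)) * of_bool r2
      + (of_bool a4 * of_bool a6) * (of_bool r3 :: real)"
  by (cases r1; cases r2; cases r3; cases a1; cases a4; cases a3; cases a5; cases a2; cases a6) simp_all

lemma avg_open_le:
  assumes "finite A"
  shows "avg A (\<lambda>S. of_bool (e \<in> A - S)) \<le> 1 / 2"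
proof (cases "e \<in> A")
  case True
  then show ?thesis
    using assms by (subst avg_split[OF assms True]) simp
qed (use assms in simp)

text \<open>Two steps from \<open>v\<close> lead to three vertices, the middle one along two paths, whence
  the growth factor \<open>1/4 + (1 - (3/4)\<^sup>2) + 1/4 = 15/16 < 1\<close>.\<close>
lemma avg_oriented_le:
  assumes "finite A" and d: "d = 1 \<or> d = -1"
  shows "avg A (\<lambda>S. of_bool (oriented d (2 * j) A v S)) \<le> (15 / 16) ^ j"
proof (induction j arbitrary: v)
  case 0
  then show ?case using assms by simp
next
  case (Suc j)
  obtain x y where v: "v = (x, y)" by (cases v)
  define o' :: "edge \<Rightarrow> edge set \<Rightarrow> real" where "o' = (\<lambda>e S. of_bool (e \<in> A - S))"
  define r :: "vertex \<Rightarrow> edge set \<Rightarrow> real" where "r = (\<lambda>v S. of_bool (oriented d (2 * j) A v S))"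
  define e1 where "e1 = ((x, y), True)"
  define e2 where "e2 = ((x + 1, y), True)"
  define e3 where "e3 = vedge d (x + 1, y)"
  define e4 where "e4 = vedge d (x, y)"
  define e5 where "e5 = ((x, y + d), True)"
  define e6 where "e6 = vedge d (x, y + d)"
  note es = e1_def e2_def e3_def e4_def e5_def e6_def
  define q where "q = (\<lambda>S. o' e1 S * o' e3 S + o' e4 S * o' e5 S - (o' e1 S * o' e3 S) * (o' e4 S * o' e5 S))"
  have odep: "depends_on {e} (o' e)" for e
    unfolding o'_def by (rule depends_on_comp[OF depends_on_open]) simp
  have pair_dep: "depends_on {e, e'} (\<lambda>S. o' e S * o' e' S)" for e e'
    by (rule depends_on_comp2[where h = "(*)"]; rule depends_on_mono[OF odep]) auto
  have pair: "avg A (\<lambda>S. o' e S * o' e' S) \<le> 1 / 4" "0 \<le> avg A (\<lambda>S. o' e S * o' e' S)" if "e \<noteq> e'" for e e'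
  proof -
    have "avg A (\<lambda>S. o' e S * o' e' S) = avg A (o' e) * avg A (o' e')"
      by (rule avg_mult_indep[OF assms(1) odep odep]) (use that in simp)
    also have "\<dots> \<le> (1 / 2) * (1 / 2)"
      unfolding o'_def by (intro mult_mono avg_open_le assms avg_nonneg) auto
    finally show "avg A (\<lambda>S. o' e S * o' e' S) \<le> 1 / 4" by simp
    show "0 \<le> avg A (\<lambda>S. o' e S * o' e' S)"
      by (rule avg_nonneg) (simp add: o'_def)
  qed
  have ne: "e1 \<noteq> e2" "e4 \<noteq> e6" "e1 \<noteq> e3" "e4 \<noteq> e5" "{e1, e3} \<inter> {e4, e5} = {}"
    using d by (auto simp: es vedge_def)
  have q_dep: "depends_on {e1, e3, e4, e5} q"
  proof -
    have "depends_on {e1, e3, e4, e5} (\<lambda>S. o' e1 S * o' e3 S)" "depends_on {e1, e3, e4, e5} (\<lambda>S. o' e4 S * o' e5 S)"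
      by (rule depends_on_mono[OF pair_dep]; simp)+
    then show ?thesis
      unfolding q_def by (rule depends_on_comp2[where h = "\<lambda>u w. u + w - u * w"])
  qed
  have q_le: "avg A q \<le> 7 / 16"
  proof -
    define s t where "s = avg A (\<lambda>S. o' e1 S * o' e3 S)" and "t = avg A (\<lambda>S. o' e4 S * o' e5 S)"
    have "avg A q = s + t - s * t"
      unfolding q_def avg_diff avg_add avg_mult_indep[OF assms(1) pair_dep pair_dep ne(5)] s_def t_def ..
    also have "\<dots> = 1 - (1 - s) * (1 - t)"
      by (simp add: algebra_simps)
    also have "\<dots> \<le> 1 - (3 / 4) * (3 / 4)"
      using pair(1)[OF ne(3)] pair(1)[OF ne(4)]
      by (intro diff_left_mono mult_mono) (auto simp: s_def t_def)
    finally show ?thesis by simp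
  qed
  \<comment> \<open>The edges of the first two steps lie at levels below that of \<open>w\<close>,
    those of the continuation from \<open>w\<close> at or above it.\<close>
  have step: "avg A (\<lambda>S. f S * r w S) \<le> p * (15 / 16) ^ j"
    if "depends_on C f" "avg A f \<le> p" "0 \<le> p" "\<forall>e\<in>C. level d e < fst w + d * snd w" "fst w + d * snd w = z" for f C p w z
  proof -
    have "depends_on {e. fst w + d * snd w \<le> level d e} (r w)"
      unfolding r_def by (rule depends_on_comp[OF oriented_depends_level[OF d]])
    then have "avg A (\<lambda>S. f S * r w S) = avg A f * avg A (r w)"
      by (rule avg_mult_indep[OF assms(1) that(1)]) (use that(4) in force)
    also have "\<dots> \<le> p * (15 / 16) ^ j"
      using Suc.IH[of w] that by (intro mult_mono avg_nonneg) (auto simp: r_def)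
    finally show ?thesis .
  qed
  have "avg A (\<lambda>S. of_bool (oriented d (2 * Suc j) A v S))
     \<le> avg A (\<lambda>S. (o' e1 S * o' e2 S) * r (x + 2, y) S + q S * r (x + 1, y + d) S + (o' e4 S * o' e6 S) * r (x, y + 2 * d) S)"
  proof (rule avg_mono)
    fix S
    show "of_bool (oriented d (2 * Suc j) A v S) \<le>
        (o' e1 S * o' e2 S) * r (x + 2, y) S + q S * r (x + 1, y + d) S + (o' e4 S * o' e6 S) * r (x, y + 2 * d) S"
    proof -
      have eq: "oriented d (2 * Suc j) A v S \<longleftrightarrow>
          e1 \<in> A - S \<and> (e2 \<in> A - S \<and> oriented d (2 * j) A (x + 2, y) S
            \<or> e3 \<in> A - S \<and> oriented d (2 * j) A (x + 1, y + d) S) \<or>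
          e4 \<in> A - S \<and> (e5 \<in> A - S \<and> oriented d (2 * j) A (x + 1, y + d) S
            \<or> e6 \<in> A - S \<and> oriented d (2 * j) A (x, y + 2 * d) S)"
        by (simp only: v es oriented.simps mult_Suc_right add_2_eq_Suc fst_conv snd_conv)
          (simp only: add.assoc one_add_one mult_2)
      show ?thesis
        unfolding eq o'_def r_def q_def by (rule two_steps_bound)
    qed
  qed
  also have "\<dots> = avg A (\<lambda>S. (o' e1 S * o' e2 S) * r (x + 2, y) S) + avg A (\<lambda>S. q S * r (x + 1, y + d) S)
      + avg A (\<lambda>S. (o' e4 S * o' e6 S) * r (x, y + 2 * d) S)"
    unfolding avg_add ..
  also have "\<dots> \<le> 1 / 4 * (15 / 16) ^ j + 7 / 16 * (15 / 16) ^ j + 1 / 4 * (15 / 16) ^ j"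
  proof (intro add_mono)
    have dd: "d * (y + d) = d * y + 1" "d * (y + 2 * d) = d * y + 2"
      using d by (auto simp: algebra_simps)
    have lev: "level d e1 = x + d * y" "level d e2 = x + 1 + d * y" "level d e3 = x + 1 + d * y"
      "level d e4 = x + d * y" "level d e5 = x + d * y + 1" "level d e6 = x + d * y + 1"
      using d dd by (simp_all add: es)
    show "avg A (\<lambda>S. (o' e1 S * o' e2 S) * r (x + 2, y) S) \<le> 1 / 4 * (15 / 16) ^ j"
      by (rule step[OF pair_dep pair(1)[OF ne(1)]]) (auto simp: lev)
    show "avg A (\<lambda>S. q S * r (x + 1, y + d) S) \<le> 7 / 16 * (15 / 16) ^ j"
      by (rule step[OF q_dep q_le]) (auto simp: lev dd)
    show "avg A (\<lambda>S. (o' e4 S * o' e6 S) * r (x, y + 2 * d) S) \<le> 1 / 4 * (15 / 16) ^ j"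
      by (rule step[OF pair_dep pair(1)[OF ne(2)]]) (auto simp: lev dd)
  qed
  finally show ?case by simp
qed

lemma walk_nth_diff:
  assumes "walk p" "i \<le> j" "j < length p"
  shows "\<bar>fst (p ! j) - fst (p ! i)\<bar> \<le> int (j - i)" "\<bar>snd (p ! j) - snd (p ! i)\<bar> \<le> int (j - i)"
proof -
  have "\<bar>fst (p ! j) - fst (p ! i)\<bar> \<le> int (j - i) \<and> \<bar>snd (p ! j) - snd (p ! i)\<bar> \<le> int (j - i)"
    using assms(2,3)
  proof (induction j rule: dec_induct)
    case (step l)
    then have "adj (p ! l) (p ! Suc l)"
      using assms(1) by (auto simp: successively_conv_nth)
    then have "fst (p ! Suc l) - fst (p ! l) \<in> {-1, 0, 1}" "snd (p ! Suc l) - snd (p ! l) \<in> {-1, 0, 1}"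
      using adj_cases by fastforce+
    moreover have "int (Suc l - i) = int (l - i) + 1"
      using step.hyps by auto
    ultimately show ?case
      using step by auto
  qed simp
  then show "\<bar>fst (p ! j) - fst (p ! i)\<bar> \<le> int (j - i)" "\<bar>snd (p ! j) - snd (p ! i)\<bar> \<le> int (j - i)"
    by auto
qed

lemma walk_level_le:
  assumes "walk (v # zs)" "d = 1 \<or> d = -1"
  shows "fst (last (v # zs)) + d * snd (last (v # zs)) \<le> fst v + d * snd v + int (length zs)"
  using assms(1)
proof (induction zs arbitrary: v)
  case (Cons w zs)
  have "adj v w" "walk (w # zs)"
    using Cons.prems by auto
  moreover have "fst w + d * snd w \<le> fst v + d * snd v + 1"
    using adj_cases[OF \<open>adj v w\<close>] assms(2) by (elim disjE) (auto simp: algebra_simps)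
  ultimately show ?case
    using Cons.IH[of w] by auto
qed simp

text \<open>Every step raises the level by at most 1, so reaching the largest possible level leaves
  only steps that raise it, and these are the oriented ones.\<close>

lemma oriented_of_level:
  assumes "walk (v # zs)" "d = 1 \<or> d = -1" "set (path_edges (v # zs)) \<subseteq> A - S"
    and "fst (last (v # zs)) + d * snd (last (v # zs)) = fst v + d * snd v + int (length zs)"
  shows "oriented d (length zs) A v S"
  using assms(1,3,4)
proof (induction zs arbitrary: v)
  case (Cons w zs)
  have vw: "adj v w" "walk (w # zs)"
    using Cons.prems by auto
  have le: "fst w + d * snd w \<le> fst v + d * snd v + 1"
    using adj_cases[OF vw(1)] assms(2) by (elim disjE) (auto simp: algebra_simps)
  have eq: "fst (last (w # zs)) + d * snd (last (w # zs)) = fst v + d * snd v + int (length zs) + 1"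
    using Cons.prems(3) by simp
  have lev: "fst w + d * snd w = fst v + d * snd v + 1"
    using walk_level_le[OF vw(2) assms(2)] eq le by linarith
  have "oriented d (length zs) A w S"
    using Cons.IH[OF vw(2)] Cons.prems(2) eq lev by simp
  moreover have "w = (fst v + 1, snd v) \<and> lat_edge v w = (v, True) \<or> w = (fst v, snd v + d) \<and> lat_edge v w = vedge d v"
    using adj_cases[OF vw(1)] assms(2) lev
    by (elim disjE) (auto simp: lat_edge_def vedge_def)
  moreover have "lat_edge v w \<in> A - S"
    using Cons.prems(2) by simp
  ultimately show ?case
    by auto
qed simp

section \<open>Shortcuts of geodesics\<close>

lemma length_path_edges: "length (path_edges p) = length p - 1"
  by (simp add: path_edges_def)

text \<open>Bounded in height as well as in width, so that the number of edges has a bound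
  independent of \<open>k\<close>.\<close>

definition height_box :: "int \<Rightarrow> nat \<Rightarrow> int \<Rightarrow> nat \<Rightarrow> edge set" where
  "height_box m L y k = strip m (m + int L) k \<inter> {e. \<bar>snd (fst e) - y\<bar> \<le> int L}"

lemma finite_height_box [simp]: "finite (height_box m L y k)"
  by (simp add: height_box_def)

lemma card_height_box_le: "card (height_box m L y k) \<le> L * (2 * L + 1) * 2"
proof -
  have "height_box m L y k \<subseteq> ({m..<m + int L} \<times> {y - int L..y + int L}) \<times> UNIV"
    by (auto simp: height_box_def strip_def)
  then have "card (height_box m L y k) \<le> card (({m..<m + int L} \<times> {y - int L..y + int L}) \<times> (UNIV :: bool set))"
    by (intro card_mono) auto
  also have "\<dots> = L * (2 * L + 1) * 2"
    by (simp add: card_cartesian_product nat_add_distrib nat_mult_distrib algebra_simps)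
  finally show ?thesis .
qed

context two_weights
begin

lemma passage_time_ge:
  "a * length (path_edges p) + (if set (path_edges p) \<inter> S = {} then 0 else b - a) \<le> passage_time (weights S) p"
proof -
  have "a * length es + (if set es \<inter> S = {} then 0 else b - a) \<le> sum_list (map (weights S) es)" for es
    using a_less_b by (induction es) (auto simp: weights_def algebra_simps split: if_splits)
  then show ?thesis
    by (simp add: passage_time_eq)
qed

text \<open>The \<open>L\<close> steps of the geodesic after its last visit to column \<open>m\<close> are replaced by a vertical
  walk in that column followed by a horizontal one; this gains something unless these steps
  form an oriented path of cheap edges.\<close>
lemma shortcut:
  assumes "0 < k" "0 \<le> m" "0 < L" "m + int L \<le> n"
    and p: "p \<in> crossings 0 n k" "T 0 n k S = passage_time (weights S) p"
    and i: "i < length p" "fst (p ! i) = m" "\<And>j. i < j \<Longrightarrow> j < length p \<Longrightarrow> m < fst (p ! j)"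
    and A: "A = strip 0 (n + 1) k"
    and not_oriented: "\<not> oriented 1 L A (p ! i) S" "\<not> oriented (-1) L A (p ! i) S"
  shows "T 0 n k (S - height_box m L (snd (p ! i)) k) \<le> T 0 n k S - min a (b - a)"
proof -
  define v where "v = p ! i"
  define xs where "xs = take i p"
  define ys where "ys = drop (Suc i) p"
  define zs where "zs = take L ys"
  define us where "us = butlast (v # zs)"
  define w where "w = last (v # zs)"
  define rest where "rest = drop L ys"
  define S' where "S' = S - height_box m L (snd v) k"
  let ?t = "passage_time (weights S)" and ?t' = "passage_time (weights S')"
  have p': "walk p" "p \<noteq> []" "set p \<subseteq> rect 0 n k" "fst (hd p) = 0" "fst (last p) = n"
    using p(1) by (auto simp: crossings_def)
  have pe: "p = xs @ v # ys"
    unfolding xs_def v_def ys_def using i(1) by (rule id_take_nth_drop)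
  have vz: "v # zs = us @ [w]"
    unfolding us_def w_def by (rule append_butlast_last_id[symmetric]) simp
  have vy: "v # ys = us @ w # rest"
  proof -
    have "v # ys = (v # zs) @ rest"
      by (simp add: zs_def rest_def)
    then show ?thesis
      unfolding vz by simp
  qed
  have walks: "walk (xs @ [v])" "walk (v # ys)"
    using p'(1) unfolding pe by (auto simp: successively_append_iff)
  then have walks': "walk (v # zs)" "walk (w # rest)"
    unfolding vz vy by (auto simp: successively_append_iff)
  have "i \<le> length p - 1" "length p - 1 < length p"
    using i(1) by auto
  moreover have "fst (p ! (length p - 1)) = n"
    using p'(5) last_conv_nth[OF p'(2)] by simp
  \<comment> \<open>At least \<open>L\<close> columns remain to be crossed, hence at least
    \<open>L\<close> steps.\<close>
  ultimately have "int L \<le> int (length p - 1 - i)"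
    using walk_nth_diff(1)[OF p'(1), of i "length p - 1"] i(2) assms(4) by linarith
  then have "L \<le> length ys"
    by (simp add: ys_def)
  then have len: "length zs = L"
    by (simp add: zs_def)
  have ys_gt: "m < fst u" if u: "u \<in> set ys" for u
  proof -
    obtain l where "l < length ys" "u = ys ! l"
      using u unfolding in_set_conv_nth by blast
    then show ?thesis
      using i(3)[of "Suc i + l"] by (simp add: ys_def)
  qed
  have v: "fst v = m"
    using i v_def by simp
  have "w \<in> set (v # zs)"
    unfolding w_def by (rule last_in_set) simp
  moreover have zs_ys: "set zs \<subseteq> set ys"
    unfolding zs_def by (rule set_take_subset)
  ultimately have "w = v \<or> w \<in> set ys"
    by auto
  then have w: "m \<le> fst w" "w \<in> set p"
    using ys_gt[of w] v by (auto simp: pe)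
  define d :: int where "d = (if snd v \<le> snd w then 1 else -1)"
  \<comment> \<open>The lattice distance of \<open>v\<close> and \<open>w\<close>, which is the
    length of the replacement.\<close>
  define dd where "dd = (fst w - m) + \<bar>snd w - snd v\<bar>"
  have d: "d = 1 \<or> d = -1"
    by (simp add: d_def)
  have dd: "fst w + d * snd w = fst v + d * snd v + dd"
    using v by (auto simp: dd_def d_def)
  have dd_le: "dd \<le> int L"
    using walk_level_le[OF walks'(1) d] dd by (simp add: w_def len)
  have rv: "0 \<le> snd v" "snd v < int k" "0 \<le> snd w" "snd w < int k" "fst w \<le> n"
    using p'(3) w(2) unfolding pe by (auto simp: rect_def)
  have wn: "fst w \<le> m + int L" "\<bar>snd w - snd v\<bar> \<le> int L"
    using dd_le w by (auto simp: dd_def)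
  \<comment> \<open>The old segment has \<open>L\<close> edges. Either one of them is expensive,
    which gains \<open>b - a\<close>, or the distance is less than \<open>L\<close>, which gains
    \<open>a\<close>; otherwise the segment would be a cheap oriented path.\<close>
  have seg: "a * dd + min a (b - a) \<le> ?t (v # zs)"
  proof (cases "set (path_edges (v # zs)) \<inter> S = {}")
    case False
    have "a * dd \<le> a * int L"
      using dd_le a_pos by (intro mult_left_mono) linarith+
    then show ?thesis
      using passage_time_ge[of "v # zs" S] False by (simp add: length_path_edges len)
  next
    case True
    have "dd \<noteq> int L"
    proof
      assume "dd = int L"
      have "set (v # zs) \<subseteq> rect 0 n k"
        using p'(3) zs_ys unfolding pe by auto
      then have "set (path_edges (v # zs)) \<subseteq> strip 0 n k \<union> vline n k"
        using path_edges_rect[OF walks'(1)] by blast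
      also have "\<dots> \<subseteq> A"
        unfolding A strip_def vline_def using assms(2,4) by auto
      finally have "set (path_edges (v # zs)) \<subseteq> A" .
      with True have "set (path_edges (v # zs)) \<subseteq> A - S"
        by blast
      then have "oriented d (length zs) A v S"
        by (rule oriented_of_level[OF walks'(1) d]) (use dd \<open>dd = int L\<close> in \<open>simp add: w_def len\<close>)
      then show False
        using not_oriented d by (auto simp: v_def len)
    qed
    then have "dd + 1 \<le> int L"
      using dd_le by simp
    then have "a * (dd + 1) \<le> a * int L"
      using a_pos by (intro mult_left_mono) linarith+
    then show ?thesis
      using passage_time_ge[of "v # zs" S] True by (simp add: length_path_edges len distrib_left)
  qed
  have "weights S' ((m, z), False) \<le> a" if "min (snd v) (snd w) \<le> z" "z < max (snd v) (snd w)" for z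
  proof -
    have "0 \<le> z" "z < int k" "\<bar>z - snd v\<bar> \<le> int L"
      using that rv wn by (auto simp: min_def max_def split: if_splits)
    then have "((m, z), False) \<in> height_box m L (snd v) k"
      using \<open>0 < L\<close> by (simp add: height_box_def strip_def)
    then show ?thesis
      by (simp add: weights_def S'_def)
  qed
  then obtain q1 where q1: "q1 \<noteq> []" "walk q1" "hd q1 = (m, snd v)" "last q1 = (m, snd w)"
    "set q1 \<subseteq> {m} \<times> {min (snd v) (snd w)..max (snd v) (snd w)}" "?t' q1 \<le> a * \<bar>snd w - snd v\<bar>"
    using vertical_walk[of "snd v" "snd w" "weights S'" m a] by blast
  have "weights S' ((z, snd w), True) \<le> a" if "m \<le> z" "z < fst w" for z
  proof -
    have "((z, snd w), True) \<in> height_box m L (snd v) k"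
      using that rv wn by (simp add: height_box_def strip_def)
    then show ?thesis
      by (simp add: weights_def S'_def)
  qed
  then obtain q2 where q2: "q2 \<noteq> []" "walk q2" "hd q2 = (m, snd w)" "last q2 = (fst w, snd w)"
    "set q2 \<subseteq> {m..fst w} \<times> {snd w}" "?t' q2 \<le> a * (fst w - m)"
    using horizontal_walk[of m "fst w" "weights S'" "snd w" a] w by blast
  define r1 where "r1 = (xs @ [v]) @ tl q1"
  define r2 where "r2 = r1 @ tl q2"
  define r3 where "r3 = r2 @ tl (w # rest)"
  have ne: "xs @ [v] \<noteq> []" "r1 \<noteq> []" "r2 \<noteq> []" "w # rest \<noteq> []"
    by (simp_all add: r1_def r2_def)
  have l1: "last (xs @ [v]) = hd q1"
    unfolding q1(3) using v by (simp add: prod_eq_iff)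
  note j1 = walk_join[OF walks(1) q1(2) ne(1) q1(1) l1, folded r1_def]
  have l2: "last r1 = hd q2"
    unfolding j1(3) q1(4) q2(3) ..
  note j2 = walk_join[OF j1(1) q2(2) ne(2) q2(1) l2, folded r2_def]
  have l3: "last r2 = hd (w # rest)"
    unfolding j2(3) q2(4) by simp
  note j3 = walk_join[OF j2(1) walks'(2) ne(3,4) l3, folded r3_def]
  have "r3 \<in> crossings 0 n k"
  proof -
    have "hd r3 = hd p"
      unfolding j3(2) j2(2) j1(2) by (cases xs) (simp_all add: pe)
    moreover have "last r3 = last p"
    proof -
      have "last (w # rest) = last (v # ys)"
        unfolding vy by simp
      then show ?thesis
        unfolding j3(3) by (simp add: pe)
    qed
    moreover have "set q1 \<subseteq> rect 0 n k" "set q2 \<subseteq> rect 0 n k"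
    proof -
      have "{m} \<times> {min (snd v) (snd w)..max (snd v) (snd w)} \<subseteq> rect 0 n k"
        using rv assms(2,4) by (auto simp: rect_def min_le_iff_disj le_max_iff_disj)
      then show "set q1 \<subseteq> rect 0 n k"
        using q1(5) by blast
      have "{m..fst w} \<times> {snd w} \<subseteq> rect 0 n k"
        using rv assms(2) by (auto simp: rect_def)
      then show "set q2 \<subseteq> rect 0 n k"
        using q2(5) by blast
    qed
    moreover have "set (xs @ [v]) \<subseteq> set p" "set (w # rest) \<subseteq> set p"
    proof -
      have "set (w # rest) \<subseteq> set (v # ys)"
        unfolding vy by auto
      then show "set (w # rest) \<subseteq> set p" "set (xs @ [v]) \<subseteq> set p"
        by (auto simp: pe)
    qed
    moreover have "r3 \<noteq> []"
      by (simp add: r3_def r2_def r1_def)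
    ultimately show ?thesis
      using j3(1,4) j2(4) j1(4) p' unfolding crossings_def by auto
  qed
  then have "T 0 n k S' \<le> ?t' r3"
    by (rule T_le)
  also have "\<dots> = ?t' (xs @ [v]) + ?t' q1 + ?t' q2 + ?t' (w # rest)"
    unfolding j3(5) j2(5) j1(5) ..
  also have "\<dots> \<le> ?t (xs @ [v]) + a * \<bar>snd w - snd v\<bar> + a * (fst w - m) + ?t (w # rest)"
  proof -
    have "?t' q \<le> ?t q" for q
      using a_less_b by (intro passage_time_mono) (auto simp: weights_def S'_def)
    with q1(6) q2(6) show ?thesis
      by (intro add_mono)
  qed
  also have "\<dots> = ?t (xs @ [v]) + a * dd + ?t (w # rest)"
    by (simp add: dd_def algebra_simps)
  also have "\<dots> \<le> ?t (xs @ [v]) + (?t (v # zs) - min a (b - a)) + ?t (w # rest)"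
    using seg by simp
  also have "\<dots> = ?t p - min a (b - a)"
  proof -
    have "?t p = ?t (xs @ [v]) + ?t (v # ys)"
      unfolding pe by (rule passage_time_append)
    moreover have "?t (v # ys) = ?t (v # zs) + ?t (w # rest)"
      unfolding vy vz by (rule passage_time_append)
    ultimately show ?thesis by simp
  qed
  finally show ?thesis
    by (simp add: p(2) S'_def v_def)
qed

end

section \<open>Counting the heights of a geodesic\<close>

lemma geometric_two_sided:
  fixes r :: real
  assumes "0 \<le> r" "r < 1"
  shows "(\<Sum>y'\<in>{0..<int k}. r ^ nat \<bar>y - y'\<bar>) \<le> 2 / (1 - r)"
proof -
  have half: "(\<Sum>y'\<in>F. r ^ nat \<bar>y - y'\<bar>) \<le> 1 / (1 - r)"
    if "finite F" "inj_on (\<lambda>y'. nat \<bar>y - y'\<bar>) F" for F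
  proof -
    have "(\<Sum>y'\<in>F. r ^ nat \<bar>y - y'\<bar>) = (\<Sum>i\<in>(\<lambda>y'. nat \<bar>y - y'\<bar>) ` F. r ^ i)"
      using that by (simp add: sum.reindex)
    also have "\<dots> \<le> (\<Sum>i. r ^ i)"
      using assms that by (intro sum_le_suminf summable_geometric) auto
    finally show ?thesis
      using assms by (simp add: suminf_geometric)
  qed
  have "{0..<int k} = {y'\<in>{0..<int k}. y' \<le> y} \<union> {y'\<in>{0..<int k}. y < y'}"
    by auto
  then have "(\<Sum>y'\<in>{0..<int k}. r ^ nat \<bar>y - y'\<bar>) =
      (\<Sum>y'\<in>{y'\<in>{0..<int k}. y' \<le> y}. r ^ nat \<bar>y - y'\<bar>) + (\<Sum>y'\<in>{y'\<in>{0..<int k}. y < y'}. r ^ nat \<bar>y - y'\<bar>)"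
    by (metis (no_types, lifting) finite_atLeastLessThan_int finite_Un sum.union_disjoint
        disjoint_iff mem_Collect_eq not_le)
  also have "\<dots> \<le> 1 / (1 - r) + 1 / (1 - r)"
    by (intro add_mono half) (auto simp: inj_on_def intro: rev_finite_subset[of "{0..<int k}"])
  finally show ?thesis by simp
qed

text \<open>\<open>chain g s r k j y\<close> is a weighted count of the height sequences \<open>y\<^sub>0, \<dots>, y\<^sub>j = y\<close>:
  a strip in which \<open>g\<close> fails costs a factor \<open>s\<close>, a vertical displacement \<open>l\<close> between consecutive
  strips a factor \<open>r\<^sup>l\<close>.\<close>
primrec chain :: "(nat \<Rightarrow> int \<Rightarrow> edge set \<Rightarrow> bool) \<Rightarrow> real \<Rightarrow> real \<Rightarrow> nat \<Rightarrow> nat \<Rightarrow> int \<Rightarrow> edge set \<Rightarrow> real" where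
  "chain g s r k 0 y S = (if g 0 y S then 1 else s)"
| "chain g s r k (Suc j) y S = (if g (Suc j) y S then 1 else s) *
     (\<Sum>y'\<in>{0..<int k}. chain g s r k j y' S * r ^ nat \<bar>y - y'\<bar>)"

lemma chain_nonneg: "0 \<le> s \<Longrightarrow> 0 \<le> r \<Longrightarrow> 0 \<le> chain g s r k j y S"
  by (induction j arbitrary: y) (auto intro!: mult_nonneg_nonneg sum_nonneg)

lemma chain_depends:
  assumes "\<And>j y. depends_on (C j) (g j y)"
  shows "depends_on (\<Union>i\<le>j. C i) (chain g s r k j y)"
proof (induction j arbitrary: y)
  case 0
  have "depends_on (C 0) (\<lambda>S. if g 0 y S then 1 else s)"
    by (rule depends_on_comp[OF assms])
  then show ?case by simp
next
  case (Suc j)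
  have "depends_on (C (Suc j)) (\<lambda>S. if g (Suc j) y S then 1 else s)"
    by (rule depends_on_comp[OF assms])
  then have 1: "depends_on (\<Union>i\<le>Suc j. C i) (\<lambda>S. if g (Suc j) y S then 1 else s)"
    by (rule depends_on_mono) auto
  have "depends_on (\<Union>i\<le>Suc j. C i) (chain g s r k j y')" for y'
    by (rule depends_on_mono[OF Suc.IH]) (intro UN_mono, auto)
  then have 2: "depends_on (\<Union>i\<le>Suc j. C i) (\<lambda>S. \<Sum>y'\<in>{0..<int k}. chain g s r k j y' S * r ^ nat \<bar>y - y'\<bar>)"
    by (intro depends_on_sum) (rule depends_on_comp)
  show ?case
    unfolding chain.simps by (rule depends_on_comp2[OF 1 2])
qed

text \<open>The strips are independent: each contributes at most \<open>\<rho> + s\<close>, and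
  summing over the previous height gives a two-sided geometric series. The bound is therefore
  uniform in \<open>k\<close> and in the final height.\<close>

lemma avg_chain_le:
  assumes "finite A" "\<And>j y. depends_on (C j) (g j y)" "disjoint_family C"
    and "\<And>j y. avg A (\<lambda>S. of_bool (g j y S)) \<le> \<rho>" "0 \<le> s" "0 \<le> r" "r < 1"
  shows "avg A (chain g s r k j y) \<le> (\<rho> + s) * ((\<rho> + s) * (2 / (1 - r))) ^ j"
proof -
  have rho: "0 \<le> \<rho>"
    using assms(4)[of 0 0] avg_nonneg[of A "\<lambda>S. of_bool (g 0 0 S)"] by force
  have single: "avg A (\<lambda>S. if g j y S then 1 else s) \<le> \<rho> + s" for j y
  proof -
    have "avg A (\<lambda>S. if g j y S then 1 else s) \<le> avg A (\<lambda>S. of_bool (g j y S) + s)"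
      using assms(5) by (intro avg_mono) auto
    also have "\<dots> \<le> \<rho> + s"
      unfolding avg_add using assms(1,4) by simp
    finally show ?thesis .
  qed
  show ?thesis
  proof (induction j arbitrary: y)
    case 0
    then show ?case using single[of 0 y] by simp
  next
    case (Suc j)
    let ?B = "(\<rho> + s) * ((\<rho> + s) * (2 / (1 - r))) ^ j"
    have B: "0 \<le> ?B"
      using rho assms(5-7) by (intro mult_nonneg_nonneg zero_le_power) auto
    have "chain g s r k (Suc j) y = (\<lambda>S. (if g (Suc j) y S then 1 else s) *
       (\<Sum>y'\<in>{0..<int k}. chain g s r k j y' S * r ^ nat \<bar>y - y'\<bar>))"
      by (rule ext) simp
    then have "avg A (chain g s r k (Suc j) y) = avg A (\<lambda>S. (if g (Suc j) y S then 1 else s) *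
       (\<Sum>y'\<in>{0..<int k}. chain g s r k j y' S * r ^ nat \<bar>y - y'\<bar>))"
      by simp
    also have "\<dots> = avg A (\<lambda>S. if g (Suc j) y S then 1 else s) *
       avg A (\<lambda>S. \<Sum>y'\<in>{0..<int k}. chain g s r k j y' S * r ^ nat \<bar>y - y'\<bar>)"
    proof (rule avg_mult_indep[OF assms(1)])
      show "depends_on (C (Suc j)) (\<lambda>S. if g (Suc j) y S then 1 else s)"
        by (rule depends_on_comp[OF assms(2)])
      show "depends_on (\<Union>i\<le>j. C i) (\<lambda>S. \<Sum>y'\<in>{0..<int k}. chain g s r k j y' S * r ^ nat \<bar>y - y'\<bar>)"
        by (intro depends_on_sum) (rule depends_on_comp[OF chain_depends[OF assms(2)]])
      have "C (Suc j) \<inter> C i = {}" if "i \<le> j" for i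
        using disjoint_family_onD[OF assms(3), of "Suc j" i] that by simp
      then show "C (Suc j) \<inter> (\<Union>i\<le>j. C i) = {}"
        by blast
    qed
    also have "\<dots> \<le> (\<rho> + s) * (?B * (2 / (1 - r)))"
    proof (intro mult_mono single)
      have "avg A (\<lambda>S. \<Sum>y'\<in>{0..<int k}. chain g s r k j y' S * r ^ nat \<bar>y - y'\<bar>)
          = (\<Sum>y'\<in>{0..<int k}. avg A (chain g s r k j y') * r ^ nat \<bar>y - y'\<bar>)"
        unfolding avg_sum avg_multc ..
      also have "\<dots> \<le> (\<Sum>y'\<in>{0..<int k}. ?B * r ^ nat \<bar>y - y'\<bar>)"
        using assms(6) by (intro sum_mono mult_right_mono Suc.IH) auto
      also have "\<dots> \<le> ?B * (2 / (1 - r))"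
        unfolding sum_distrib_left[symmetric] using geometric_two_sided[OF assms(6,7)] B
        by (intro mult_left_mono) auto
      finally show "avg A (\<lambda>S. \<Sum>y'\<in>{0..<int k}. chain g s r k j y' S * r ^ nat \<bar>y - y'\<bar>) \<le> ?B * (2 / (1 - r))" .
      show "0 \<le> avg A (\<lambda>S. \<Sum>y'\<in>{0..<int k}. chain g s r k j y' S * r ^ nat \<bar>y - y'\<bar>)"
        using assms(5,6) by (intro avg_nonneg sum_nonneg mult_nonneg_nonneg chain_nonneg) auto
    qed (use rho assms(5) in auto)
    finally show ?case
      by (simp only: power_Suc mult_ac)
  qed
qed

text \<open>All terms are nonnegative, so the functional dominates the contribution of any single
  height sequence; it will be applied to that of the geodesic.\<close>

lemma chain_ge:
  assumes "\<And>i. i \<le> j \<Longrightarrow> y i \<in> {0..<int k}" "0 \<le> s" "s \<le> 1" "0 \<le> r"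
  shows "s ^ card {i. i \<le> j \<and> \<not> g i (y i) S} * r ^ (\<Sum>i<j. nat \<bar>y (Suc i) - y i\<bar>) \<le> chain g s r k j (y j) S"
  using assms(1)
proof (induction j)
  case 0
  show ?case
  proof (cases "g 0 (y 0) S")
    case True
    then have empty: "{i. i \<le> 0 \<and> \<not> g i (y i) S} = {}" by (auto intro: gr0I)
    show ?thesis unfolding empty using True by simp
  next
    case False
    then have single: "{i. i \<le> 0 \<and> \<not> g i (y i) S} = {0}" by auto
    show ?thesis unfolding single using False by simp
  qed
next
  case (Suc j)
  let ?c = "\<lambda>j. card {i. i \<le> j \<and> \<not> g i (y i) S}" and ?m = "\<lambda>j. \<Sum>i<j. nat \<bar>y (Suc i) - y i\<bar>"
  have "s ^ ?c j * r ^ ?m j * r ^ nat \<bar>y (Suc j) - y j\<bar>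
      \<le> chain g s r k j (y j) S * r ^ nat \<bar>y (Suc j) - y j\<bar>"
    using Suc assms(4) by (intro mult_right_mono) auto
  also have "\<dots> \<le> (\<Sum>y'\<in>{0..<int k}. chain g s r k j y' S * r ^ nat \<bar>y (Suc j) - y'\<bar>)"
    using Suc.prems[of j] assms by (intro member_le_sum mult_nonneg_nonneg chain_nonneg) auto
  finally have 1: "s ^ ?c j * r ^ ?m (Suc j) \<le> (\<Sum>y'\<in>{0..<int k}. chain g s r k j y' S * r ^ nat \<bar>y (Suc j) - y'\<bar>)"
    by (simp add: power_add mult_ac)
  have 2: "s ^ ?c (Suc j) = (if g (Suc j) (y (Suc j)) S then 1 else s) * s ^ ?c j"
  proof (cases "g (Suc j) (y (Suc j)) S")
    case True
    then have "{i. i \<le> Suc j \<and> \<not> g i (y i) S} = {i. i \<le> j \<and> \<not> g i (y i) S}"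
      by (auto simp: le_Suc_eq)
    with True show ?thesis by simp
  next
    case False
    then have "{i. i \<le> Suc j \<and> \<not> g i (y i) S} = insert (Suc j) {i. i \<le> j \<and> \<not> g i (y i) S}"
      by (auto simp: le_Suc_eq)
    with False show ?thesis by simp
  qed
  have "s ^ ?c (Suc j) * r ^ ?m (Suc j) = (if g (Suc j) (y (Suc j)) S then 1 else s) * (s ^ ?c j * r ^ ?m (Suc j))"
    unfolding 2 by simp
  also have "\<dots> \<le> chain g s r k (Suc j) (y (Suc j)) S"
    unfolding chain.simps using 1 assms(2) by (intro mult_left_mono) auto
  finally show ?case .
qed

lemma Suc_mult_le_of_less_div:
  fixes j n L :: nat
  assumes "j < n div L"
  shows "Suc j * L \<le> n"
proof -
  have "Suc j * L \<le> (n div L) * L"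
    using assms by (intro mult_right_mono) auto
  also have "\<dots> \<le> n"
    by (rule div_times_less_eq_dividend)
  finally show ?thesis .
qed

section \<open>Summing the influences over all strips\<close>

context two_weights
begin

lemma geodesic_visits:
  assumes p: "p \<in> crossings 0 (int n) k" and L: "0 < L"
  obtains idx where "\<And>j. j < n div L \<Longrightarrow> idx j < length p"
    "\<And>j. j < n div L \<Longrightarrow> fst (p ! idx j) = int (j * L)"
    "\<And>j i. j < n div L \<Longrightarrow> idx j < i \<Longrightarrow> i < length p \<Longrightarrow> int (j * L) < fst (p ! i)"
proof -
  have p': "walk p" "p \<noteq> []" "fst (hd p) = 0" "fst (last p) = int n"
    using p by (auto simp: crossings_def)
  have "\<exists>l. l < length p \<and> fst (p ! l) = int (j * L) \<and> (\<forall>i. l < i \<longrightarrow> i < length p \<longrightarrow> int (j * L) < fst (p ! i))"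
    if "j < n div L" for j
  proof -
    have "j * L \<le> (n div L) * L"
      using that by (intro mult_right_mono) auto
    also have "\<dots> \<le> n"
      by (rule div_times_less_eq_dividend)
    finally have "int (j * L) \<le> int n"
      by (simp only: of_nat_le_iff)
    then have jL: "int (j * L) \<le> fst (last p)"
      using p'(4) by (simp only:)
    obtain xs v ys where d: "p = xs @ v # ys" "fst v = int (j * L)" "\<And>u. u \<in> set ys \<Longrightarrow> int (j * L) < fst u"
      by (rule last_entry[OF p'(1,2) _ jL]) (use p'(3) in auto)
    have "int (j * L) < fst (p ! i)" if i: "length xs < i" "i < length p" for i
    proof (rule d(3))
      have "p ! i = ys ! (i - Suc (length xs))"
        using i by (simp add: d(1) nth_append nth_Cons')
      then show "p ! i \<in> set ys"
        using i by (simp add: d(1))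
    qed
    then show ?thesis
      using d by (intro exI[of _ "length xs"]) (auto simp: nth_append)
  qed
  then obtain idx where "\<forall>j < n div L. idx j < length p \<and> fst (p ! idx j) = int (j * L) \<and>
      (\<forall>i. idx j < i \<longrightarrow> i < length p \<longrightarrow> int (j * L) < fst (p ! i))"
    by metis
  then show ?thesis
    by (intro that[of idx]) auto
qed

text \<open>Every edge costs at least \<open>a\<close>, while a straight crossing costs at most
  \<open>b * n\<close>.\<close>

lemma geodesic_length:
  assumes "0 < k" "p \<in> crossings 0 (int n) k" "T 0 (int n) k S = passage_time (weights S) p"
  shows "real (length p - 1) \<le> b * n / a"
proof -
  have "a * real (length p - 1) \<le> passage_time (weights S) p"
    using passage_time_ge[of p S] a_less_b by (auto simp: length_path_edges split: if_splits)
  also have "\<dots> \<le> b * n"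
    using T_bounds(2)[of k 0 "int n" S] assms by simp
  finally show ?thesis
    using a_pos by (simp add: field_simps)
qed

text \<open>Last visits to successive columns come in order along the path, and the height changes
  by at most 1 per step.\<close>

lemma visits_total_variation:
  assumes p: "walk p" and idx: "\<And>j. j < J \<Longrightarrow> idx j < length p"
    "\<And>j. j < J \<Longrightarrow> fst (p ! idx j) = int (j * L)"
    "\<And>j i. j < J \<Longrightarrow> idx j < i \<Longrightarrow> i < length p \<Longrightarrow> int (j * L) < fst (p ! i)"
    and L: "0 < L"
  shows "j < J \<Longrightarrow> (\<Sum>i<j. nat \<bar>snd (p ! idx (Suc i)) - snd (p ! idx i)\<bar>) \<le> idx j"
proof (induction j)
  case (Suc j)
  have lt: "idx j \<le> idx (Suc j)"
  proof (rule ccontr)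
    assume "\<not> idx j \<le> idx (Suc j)"
    then have "int (Suc j * L) < fst (p ! idx j)"
      using idx(3)[of "Suc j" "idx j"] idx(1)[of j] Suc.prems by auto
    then show False
      using idx(2)[of j] Suc.prems by simp
  qed
  have "nat \<bar>snd (p ! idx (Suc j)) - snd (p ! idx j)\<bar> \<le> idx (Suc j) - idx j"
    using walk_nth_diff(2)[OF p lt idx(1)[OF Suc.prems]] by linarith
  then show ?case
    using Suc lt by simp
qed simp

text \<open>The heights visited by the geodesic are random, so the drops are summed over all
  heights; the additional terms are nonnegative by monotonicity.\<close>

definition drop_sum :: "nat \<Rightarrow> nat \<Rightarrow> nat \<Rightarrow> edge set \<Rightarrow> real" where
  "drop_sum L n k S = (\<Sum>j<n div L. \<Sum>y\<in>{0..<int k}.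
     T 0 (int n) k S - T 0 (int n) k (S - height_box (int (j * L)) L y k))"

definition good :: "nat \<Rightarrow> nat \<Rightarrow> nat \<Rightarrow> nat \<Rightarrow> int \<Rightarrow> edge set \<Rightarrow> bool" where
  "good L n k j y S \<longleftrightarrow> oriented 1 L (strip 0 (int n + 1) k) (int (j * L), y) S
     \<or> oriented (-1) L (strip 0 (int n + 1) k) (int (j * L), y) S"

text \<open>Either many strips are bad for the geodesic, or the chain functional is large.\<close>
lemma drop_sum_or_chain:
  assumes k: "0 < k" and L: "0 < L" and J: "0 < n div L" and \<theta>: "0 < \<theta>" "\<theta> \<le> 1"
  defines "J \<equiv> n div L"
  defines "c0 \<equiv> min a (b - a)"
  defines "\<kappa> \<equiv> \<theta> ^ J * exp (- (2 * real J * b / a))"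
  shows "c0 * J / 2 \<le> drop_sum L n k S +
     c0 * J / 2 * ((\<Sum>y\<in>{0..<int k}. chain (good L n k) (\<theta>\<^sup>2) (exp (- 1 / L)) k (J - 1) y S) / \<kappa>)"
proof -
  let ?D = "\<lambda>j y. T 0 (int n) k S - T 0 (int n) k (S - height_box (int (j * L)) L y k)"
  let ?ch = "chain (good L n k) (\<theta>\<^sup>2) (exp (- 1 / L)) k"
  have c0: "0 < c0"
    using a_pos a_less_b by (simp add: c0_def)
  have kap: "0 < \<kappa>"
    using \<theta> by (simp add: \<kappa>_def)
  have D0: "0 \<le> ?D j y" for j y
    using T_mono[of k 0 "int n" "S - height_box (int (j * L)) L y k" S] k by simp
  have ch0: "0 \<le> ?ch j y S" for j y
    by (rule chain_nonneg) auto
  obtain p where p: "p \<in> crossings 0 (int n) k" "T 0 (int n) k S = passage_time (weights S) p"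
    using geodesic[OF k, of 0 "int n" S] by auto
  obtain idx where idx: "\<And>j. j < n div L \<Longrightarrow> idx j < length p"
    "\<And>j. j < n div L \<Longrightarrow> fst (p ! idx j) = int (j * L)"
    "\<And>j i. j < n div L \<Longrightarrow> idx j < i \<Longrightarrow> i < length p \<Longrightarrow> int (j * L) < fst (p ! i)"
    using geodesic_visits[OF p(1) L] by blast
  define y where "y = (\<lambda>j. snd (p ! idx j))"
  have y: "y j \<in> {0..<int k}" "p ! idx j = (int (j * L), y j)" if "j < J" for j
  proof -
    have "p ! idx j \<in> rect 0 (int n) k"
      using p(1) nth_mem[OF idx(1)[of j]] that unfolding crossings_def J_def by blast
    then show "y j \<in> {0..<int k}"
      by (simp add: rect_def y_def)
    show "p ! idx j = (int (j * L), y j)"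
      using idx(2)[of j] that by (simp add: y_def J_def prod_eq_iff)
  qed
  define Bad where "Bad = {j. j \<le> J - 1 \<and> \<not> good L n k j (y j) S}"
  have Bad: "finite Bad" "Bad \<subseteq> {..<J}"
    using J by (auto simp: Bad_def J_def)
  have drop: "c0 \<le> ?D j (y j)" if "j \<in> Bad" for j
  proof -
    have j: "j < J" "\<not> good L n k j (y j) S"
      using that Bad by (auto simp: Bad_def)
    have "Suc j * L \<le> n"
      using j(1) unfolding J_def by (rule Suc_mult_le_of_less_div)
    then have "int (j * L) + int L \<le> int n"
      by (simp flip: of_nat_add of_nat_mult)
    moreover note y(2)[OF j(1)]
    ultimately have "T 0 (int n) k (S - height_box (int (j * L)) L (snd (p ! idx j)) k) \<le> T 0 (int n) k S - min a (b - a)"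
      using idx(1-3)[of j] j p
      by (intro shortcut[OF k _ L _ p(1,2), where i = "idx j" and A = "strip 0 (int n + 1) k"])
        (auto simp: J_def good_def)
    then show ?thesis
      by (simp add: y_def c0_def)
  qed
  have "c0 * card Bad = (\<Sum>j\<in>Bad. c0)"
    by simp
  also have "\<dots> \<le> (\<Sum>j\<in>Bad. \<Sum>y\<in>{0..<int k}. ?D j y)"
  proof (rule sum_mono)
    fix j assume j: "j \<in> Bad"
    have "?D j (y j) \<le> (\<Sum>y\<in>{0..<int k}. ?D j y)"
      by (rule member_le_sum) (use y(1)[of j] j Bad D0 in auto)
    then show "c0 \<le> (\<Sum>y\<in>{0..<int k}. ?D j y)"
      using drop[OF j] by simp
  qed
  also have "\<dots> \<le> (\<Sum>j<J. \<Sum>y\<in>{0..<int k}. ?D j y)"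
    using Bad by (intro sum_mono2 sum_nonneg D0) auto
  finally have ds: "c0 * card Bad \<le> drop_sum L n k S"
    by (simp add: drop_sum_def J_def)
  show ?thesis
  proof (cases "J \<le> 2 * card Bad")
    case True
    have "c0 * J \<le> c0 * real (2 * card Bad)"
      using True c0 by (intro mult_left_mono) linarith+
    also have "\<dots> = 2 * (c0 * card Bad)"
      by simp
    finally have "c0 * J / 2 \<le> c0 * card Bad"
      by simp
    moreover have "0 \<le> c0 * J / 2 * ((\<Sum>y\<in>{0..<int k}. ?ch (J - 1) y S) / \<kappa>)"
      using c0 kap ch0 by (intro mult_nonneg_nonneg divide_nonneg_nonneg sum_nonneg) auto
    ultimately show ?thesis
      using ds by linarith
  next
    case False
    define M where "M = (\<Sum>i<J - 1. nat \<bar>y (Suc i) - y i\<bar>)"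
    have "M \<le> idx (J - 1)"
      unfolding M_def y_def
      by (rule visits_total_variation[where J = J and L = L])
        (use p idx J L in \<open>auto simp: crossings_def J_def\<close>)
    also have "\<dots> \<le> length p - 1"
      using idx(1)[of "J - 1"] J by (simp add: J_def)
    finally have "real M \<le> b * n / a"
      using geodesic_length[OF k p] by linarith
    also have "\<dots> \<le> b * (2 * J * L) / a"
    proof -
      have "n < Suc J * L"
        unfolding J_def using L by (simp add: dividend_less_times_div mult.commute)
      also have "\<dots> \<le> 2 * J * L"
        using J by (intro mult_right_mono) (auto simp: J_def)
      finally have "real n \<le> real (2 * J * L)"
        by linarith
      then show ?thesis
        using a_pos a_less_b by (intro divide_right_mono mult_left_mono) auto
    qed
    finally have M: "real M / L \<le> 2 * real J * b / a"
      using L by (simp add: field_simps)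
    \<comment> \<open>Fewer than half of the strips are bad, so
      \<open>(\<theta>\<^sup>2) ^ card Bad\<close> is at least \<open>\<theta> ^ J\<close>. The
      total variation is at most a constant times \<open>J * L\<close>, and the ratio
      \<open>exp (- 1 / L)\<close> is chosen so that it costs only a constant factor per
      strip.\<close>
    have "\<kappa> \<le> (\<theta>\<^sup>2) ^ card Bad * exp (- 1 / L) ^ M"
      unfolding \<kappa>_def
    proof (intro mult_mono)
      show "\<theta> ^ J \<le> (\<theta>\<^sup>2) ^ card Bad"
        unfolding power_mult[symmetric] using False \<theta> by (intro power_decreasing) auto
      have "exp (- 1 / L) ^ M = exp (- (real M / L))"
        by (simp flip: exp_of_nat_mult)
      then show "exp (- (2 * real J * b / a)) \<le> exp (- 1 / L) ^ M"
        using M by simp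
    qed (use \<theta> in auto)
    also have "\<dots> \<le> ?ch (J - 1) (y (J - 1)) S"
      unfolding Bad_def M_def
      by (rule chain_ge) (use y(1) J \<theta> in \<open>auto simp: J_def power_le_one\<close>)
    also have "\<dots> \<le> (\<Sum>y\<in>{0..<int k}. ?ch (J - 1) y S)"
      by (rule member_le_sum) (use y(1)[of "J - 1"] J ch0 in \<open>auto simp: J_def\<close>)
    finally have "1 \<le> (\<Sum>y\<in>{0..<int k}. ?ch (J - 1) y S) / \<kappa>"
      using kap by simp
    then have "c0 * J / 2 * 1 \<le> c0 * J / 2 * ((\<Sum>y\<in>{0..<int k}. ?ch (J - 1) y S) / \<kappa>)"
      using c0 by (intro mult_left_mono) auto
    moreover have "0 \<le> drop_sum L n k S"
      using ds c0 by (smt (verit) mult_nonneg_nonneg of_nat_0_le_iff)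
    ultimately show ?thesis by simp
  qed
qed

text \<open>The drop of a box is paid for by the influences of its edges, and an edge lies in at
  most \<open>2 * L + 1\<close> boxes: those of one strip with height within distance
  \<open>L\<close>.\<close>

lemma avg_drop_sum_le:
  fixes L n k :: nat
  assumes k: "0 < k" and L: "0 < L"
  defines "A \<equiv> strip 0 (int n + 1) k"
  shows "avg A (drop_sum L n k) \<le> 2 ^ (L * (2 * L + 1) * 2) * (2 * real L + 1) * (\<Sum>e\<in>A. pivotal A (T 0 (int n) k) e)"
proof -
  let ?t = "T 0 (int n) k"
  let ?B = "\<lambda>j y. height_box (int (j * L)) L y k"
  define C where "C = L * (2 * L + 1) * 2"
  define P where "P = {..<n div L} \<times> {0..<int k}"
  have mono: "?t S \<le> ?t S'" if "S \<subseteq> S'" for S S'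
    using T_mono[OF k _ that, of 0 "int n"] by simp
  have piv: "0 \<le> pivotal A ?t e" for e
    by (rule pivotal_nonneg) (rule mono)
  have BA: "?B j y \<subseteq> A" if "j < n div L" for j y
  proof -
    have "Suc j * L \<le> n"
      using that by (rule Suc_mult_le_of_less_div)
    then have "int (j * L) + int L \<le> int n"
      by (simp flip: of_nat_add of_nat_mult)
    moreover have "0 \<le> int (j * L)"
      by simp
    ultimately show ?thesis
      unfolding A_def by (auto simp: height_box_def strip_def simp del: of_nat_mult)
  qed
  have finA: "finite A"
    by (simp add: A_def)
  have "avg A (drop_sum L n k) = (\<Sum>j<n div L. \<Sum>y\<in>{0..<int k}. avg A (\<lambda>S. ?t S - ?t (S - ?B j y)))"
    unfolding drop_sum_def[abs_def] avg_sum ..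
  also have "\<dots> \<le> (\<Sum>j<n div L. \<Sum>y\<in>{0..<int k}. 2 ^ C * (\<Sum>e\<in>?B j y. pivotal A ?t e))"
  proof (intro sum_mono)
    fix j y assume "j \<in> {..<n div L}"
    then have "avg A (\<lambda>S. ?t S - ?t (S - ?B j y)) \<le> 2 ^ card (?B j y) * (\<Sum>e\<in>?B j y. pivotal A ?t e)"
      by (intro avg_drop_le_pivotal finA BA mono) auto
    also have "\<dots> \<le> 2 ^ C * (\<Sum>e\<in>?B j y. pivotal A ?t e)"
      unfolding C_def by (intro mult_right_mono sum_nonneg piv power_increasing card_height_box_le) auto
    finally show "avg A (\<lambda>S. ?t S - ?t (S - ?B j y)) \<le> 2 ^ C * (\<Sum>e\<in>?B j y. pivotal A ?t e)" .
  qed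
  also have "\<dots> = 2 ^ C * (\<Sum>(j, y)\<in>P. \<Sum>e\<in>?B j y. pivotal A ?t e)"
    by (simp add: P_def sum.cartesian_product sum_distrib_left case_prod_unfold)
  also have "(\<Sum>(j, y)\<in>P. \<Sum>e\<in>?B j y. pivotal A ?t e)
      = (\<Sum>(j, y)\<in>P. \<Sum>e\<in>A. if e \<in> ?B j y then pivotal A ?t e else 0)"
  proof (intro sum.cong refl, clarify)
    fix j y assume "(j, y) \<in> P"
    then have "?B j y \<subseteq> A"
      by (intro BA) (simp add: P_def)
    then show "(\<Sum>e\<in>?B j y. pivotal A ?t e) = (\<Sum>e\<in>A. if e \<in> ?B j y then pivotal A ?t e else 0)"
      using finA by (simp add: sum.If_cases Int_absorb1 flip: sum.inter_restrict)
  qed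
  also have "\<dots> = (\<Sum>e\<in>A. \<Sum>(j, y)\<in>P. if e \<in> ?B j y then pivotal A ?t e else 0)"
    unfolding case_prod_unfold by (rule sum.swap)
  also have "\<dots> \<le> (\<Sum>e\<in>A. (2 * real L + 1) * pivotal A ?t e)"
  proof (rule sum_mono)
    fix e :: edge assume "e \<in> A"
    obtain u z h where e: "e = ((u, z), h)"
      by (cases e) auto
    define Q where "Q = {q \<in> P. e \<in> ?B (fst q) (snd q)}"
    have "Q \<subseteq> {nat (u div int L)} \<times> {z - int L..z + int L}"
    proof
      fix q assume q: "q \<in> Q"
      obtain j y where jy: "q = (j, y)"
        by (cases q)
      have "int j * int L \<le> u" "u < int j * int L + int L" "z - int L \<le> y" "y \<le> z + int L"
        using q unfolding jy by (auto simp: Q_def e height_box_def strip_def)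
      moreover from this have "u div int L = int j"
        using L by (intro int_div_pos_eq[where r = "u - int j * int L"]) (auto simp: mult.commute)
      ultimately show "q \<in> {nat (u div int L)} \<times> {z - int L..z + int L}"
        by (simp add: jy)
    qed
    then have "card Q \<le> card ({nat (u div int L)} \<times> {z - int L..z + int L})"
      by (intro card_mono) auto
    also have "\<dots> = 2 * L + 1"
      by (simp add: card_cartesian_product nat_add_distrib nat_mult_distrib)
    finally have cQ: "real (card Q) \<le> real (2 * L + 1)"
      by linarith
    have "(\<Sum>(j, y)\<in>P. if e \<in> ?B j y then pivotal A ?t e else 0) = (\<Sum>q\<in>Q. pivotal A ?t e)"
      unfolding Q_def case_prod_unfold by (subst sum.inter_filter) (auto simp: P_def)
    also have "\<dots> = card Q * pivotal A ?t e"
      by simp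
    also have "\<dots> \<le> (2 * real L + 1) * pivotal A ?t e"
      using cQ piv by (intro mult_right_mono) auto
    finally show "(\<Sum>(j, y)\<in>P. if e \<in> ?B j y then pivotal A ?t e else 0) \<le> (2 * real L + 1) * pivotal A ?t e" .
  qed
  also have "\<dots> = (2 * real L + 1) * (\<Sum>e\<in>A. pivotal A ?t e)"
    by (simp add: sum_distrib_left)
  finally show ?thesis
    by (simp add: C_def algebra_simps)
qed

text \<open>A strip is good with probability at most \<open>2 * \<theta>\<^sup>2\<close>, and a bad
  one is weighted by \<open>\<theta>\<^sup>2\<close>, so the chain has mean at most
  \<open>(3 * \<theta>\<^sup>2 * Z) ^ J\<close>; a geodesic with few bad strips would force it up to
  \<open>(\<theta> / B) ^ J\<close>. The quotient is \<open>(3 * \<theta> * Z * B) ^ J\<close>. As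
  \<open>Z\<close> grows at most linearly in \<open>h\<close> and \<theta> decays exponentially, a
  large \<open>h\<close> wins. The power of 2 in the hypothesis pays for the \<open>k\<close> final
  heights.\<close>

lemma variance_lower_bound:
  obtains c :: real and L :: nat where "0 < c" "0 < L"
    "\<And>n k. 0 < k \<Longrightarrow> 2 * k \<le> 2 ^ (n div L) \<Longrightarrow>
      c * n / k \<le> avg (strip 0 (int n + 1) k)
        (\<lambda>S. (T 0 (int n) k S - avg (strip 0 (int n + 1) k) (T 0 (int n) k))\<^sup>2)"
proof -
  define B where "B = exp (2 * b / a)"
  have "((\<lambda>h::nat. 6 * (4 * real h + 1) * (15 / 16) ^ h * B) \<longlongrightarrow> 0) at_top"
    by real_asymp
  then have "eventually (\<lambda>h. 6 * (4 * real h + 1) * (15 / 16) ^ h * B < 1 / 2) sequentially"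
    by (rule order_tendstoD) simp
  then have "eventually (\<lambda>h. 6 * (4 * real h + 1) * (15 / 16) ^ h * B < 1 / 2 \<and> 0 < h) sequentially"
    using eventually_gt_at_top[of 0] by eventually_elim simp
  then obtain h where h: "6 * (4 * real h + 1) * (15 / 16) ^ h * B < 1 / 2" "0 < h"
    unfolding eventually_sequentially by blast
  \<comment> \<open>4 = 2 * 2: a factor 15/16 takes two steps, and \<open>2 * h\<close> such factors
    give \<open>\<theta>\<^sup>2\<close>.\<close>
  define L where "L = 4 * h"
  define \<theta> :: real where "\<theta> = (15 / 16) ^ h"
  define Z where "Z = 2 / (1 - exp (- 1 / real L))"
  define c0 where "c0 = min a (b - a)"
  have L: "0 < L"
    using h by (simp add: L_def)
  have \<theta>: "0 < \<theta>" "\<theta> \<le> 1"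
    by (simp_all add: \<theta>_def power_le_one)
  have c0: "0 < c0"
    using a_pos a_less_b by (simp add: c0_def)
  have r1: "exp (- 1 / real L) < 1"
    using L by simp
  have Z: "1 \<le> Z" "Z \<le> 2 * (4 * real h + 1)"
  proof -
    show "1 \<le> Z"
      using r1 by (simp add: Z_def field_simps)
    have "1 + 1 / L \<le> exp (1 / L)"
      by (rule exp_ge_add_one_self)
    then have "exp (- (1 / L)) \<le> 1 / (1 + 1 / L)"
      using L by (simp add: exp_minus field_simps)
    then have "1 / (L + 1) \<le> 1 - exp (- 1 / L)"
      using L by (simp add: field_simps)
    then have "Z \<le> 2 / (1 / (L + 1))"
      unfolding Z_def using L by (intro divide_left_mono mult_pos_pos) auto
    then show "Z \<le> 2 * (4 * real h + 1)"
      by (simp add: L_def)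
  qed
  have small: "3 * \<theta> * Z * B \<le> 1 / 2"
  proof -
    have "3 * \<theta> * Z * B \<le> 3 * \<theta> * (2 * (4 * real h + 1)) * B"
      using Z \<theta> by (intro mult_right_mono mult_left_mono) (auto simp: B_def)
    also have "\<dots> \<le> 1 / 2"
      using h(1) by (simp add: \<theta>_def algebra_simps)
    finally show ?thesis .
  qed
  define C where "C = 2 ^ (L * (2 * L + 1) * 2) * (2 * real L + 1)"
  have C: "0 < C"
    by (simp add: C_def)
  define c1 where "c1 = c0 / (8 * L * C)"
  have c1: "0 < c1"
    using c0 L C by (simp add: c1_def)
  show thesis
  proof (rule that[of "c1\<^sup>2 / 16" L])
    fix n k :: nat
    assume k: "0 < k" and kn: "2 * k \<le> 2 ^ (n div L)"
    define J where "J = n div L"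
    define A where "A = strip 0 (int n + 1) k"
    let ?t = "T 0 (int n) k"
    have finA: "finite A"
      by (simp add: A_def)
    have J: "0 < J"
      using k kn by (cases "J = 0") (auto simp: J_def)
    have n: "real n \<le> 2 * L * J" "0 < n"
    proof -
      have "n < Suc J * L"
        unfolding J_def using L by (simp add: dividend_less_times_div mult.commute)
      also have "\<dots> \<le> 2 * J * L"
        using J by (intro mult_right_mono) auto
      finally have "n \<le> 2 * J * L" by simp
      then have "real n \<le> real (2 * J * L)"
        by (rule of_nat_mono)
      then show "real n \<le> 2 * L * J"
        by (simp add: mult_ac)
      show "0 < n"
        using J unfolding J_def by (cases n) auto
    qed
    define \<kappa> where "\<kappa> = \<theta> ^ J * exp (- (2 * real J * b / a))"
    have kap: "0 < \<kappa>"
      using \<theta> by (simp add: \<kappa>_def)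
    have kB: "\<kappa> = (\<theta> / B) ^ J"
      by (simp add: \<kappa>_def B_def power_divide exp_minus field_simps flip: exp_of_nat_mult)
    have good_prob: "avg A (\<lambda>S. of_bool (good L n k j y S)) \<le> 2 * \<theta>\<^sup>2" for j y
    proof -
      have "avg A (\<lambda>S. of_bool (good L n k j y S)) \<le>
          avg A (\<lambda>S. of_bool (oriented 1 (2 * (2 * h)) A (int (j * L), y) S)
            + of_bool (oriented (-1) (2 * (2 * h)) A (int (j * L), y) S))"
        by (intro avg_mono) (auto simp: good_def A_def L_def)
      also have "\<dots> \<le> (15 / 16) ^ (2 * h) + (15 / 16) ^ (2 * h)"
        unfolding avg_add by (intro add_mono avg_oriented_le finA) auto
      finally show ?thesis
        by (simp add: \<theta>_def mult.commute[of 2] flip: power_mult)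
    qed
    define col where "col = (\<lambda>j. {e :: edge. int (j * L) \<le> fst (fst e) \<and> fst (fst e) < int (j * L) + int L})"
    have good_dep: "depends_on (col j) (good L n k j y)" for j y
      unfolding good_def[abs_def]
      by (rule depends_on_comp2[where h = "(\<or>)"];
          rule depends_on_mono[OF oriented_depends_strip]; simp add: col_def)
    have col_disj: "disjoint_family col"
      unfolding disjoint_family_on_def
    proof (intro ballI impI)
      fix i j :: nat assume "i \<noteq> j"
      have "i * L + L \<le> j * L \<or> j * L + L \<le> i * L"
      proof (cases "i < j")
        case True
        then have "Suc i * L \<le> j * L" by (intro mult_right_mono) auto
        then show ?thesis by simp
      next
        case False
        then have "Suc j * L \<le> i * L" using \<open>i \<noteq> j\<close> by (intro mult_right_mono) auto
        then show ?thesis by simp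
      qed
      then have "int (i * L + L) \<le> int (j * L) \<or> int (j * L + L) \<le> int (i * L)"
        by (simp only: of_nat_le_iff)
      then show "col i \<inter> col j = {}"
        by (auto simp: col_def)
    qed
    let ?ch = "chain (good L n k) (\<theta>\<^sup>2) (exp (- 1 / L)) k"
    have "avg A (?ch (J - 1) y) \<le> (2 * \<theta>\<^sup>2 + \<theta>\<^sup>2) * ((2 * \<theta>\<^sup>2 + \<theta>\<^sup>2) * Z) ^ (J - 1)" for y
      unfolding Z_def
      by (rule avg_chain_le[OF finA good_dep col_disj good_prob]) (use r1 in auto)
    also have "(2 * \<theta>\<^sup>2 + \<theta>\<^sup>2) * ((2 * \<theta>\<^sup>2 + \<theta>\<^sup>2) * Z) ^ (J - 1) \<le> ((2 * \<theta>\<^sup>2 + \<theta>\<^sup>2) * Z) ^ J"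
    proof -
      have "(2 * \<theta>\<^sup>2 + \<theta>\<^sup>2) * ((2 * \<theta>\<^sup>2 + \<theta>\<^sup>2) * Z) ^ (J - 1)
          \<le> ((2 * \<theta>\<^sup>2 + \<theta>\<^sup>2) * Z) * ((2 * \<theta>\<^sup>2 + \<theta>\<^sup>2) * Z) ^ (J - 1)"
        using Z \<theta> by (intro mult_right_mono zero_le_power) (auto simp: mult_le_cancel_left1)
      also have "\<dots> = ((2 * \<theta>\<^sup>2 + \<theta>\<^sup>2) * Z) ^ J"
        using J by (cases J) auto
      finally show ?thesis .
    qed
    finally have ch: "avg A (?ch (J - 1) y) \<le> (3 * \<theta>\<^sup>2 * Z) ^ J" for y
      by simp
    have "avg A (\<lambda>S. (\<Sum>y\<in>{0..<int k}. ?ch (J - 1) y S) / \<kappa>) \<le> k * (3 * \<theta>\<^sup>2 * Z) ^ J / \<kappa>"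
    proof -
      have "(\<Sum>y\<in>{0..<int k}. avg A (?ch (J - 1) y)) \<le> (\<Sum>y\<in>{0..<int k}. (3 * \<theta>\<^sup>2 * Z) ^ J)"
        by (intro sum_mono ch)
      then show ?thesis
        unfolding avg_divide avg_sum using kap by (intro divide_right_mono) auto
    qed
    also have "\<dots> = k * (3 * \<theta> * Z * B) ^ J"
    proof -
      have "(3 * \<theta>\<^sup>2 * Z) ^ J = (3 * \<theta> * Z * B) ^ J * \<kappa>"
      proof -
        have "3 * \<theta>\<^sup>2 * Z = (3 * \<theta> * Z * B) * (\<theta> / B)"
          by (simp add: power2_eq_square B_def)
        then show ?thesis
          unfolding kB by (simp only: power_mult_distrib)
      qed
      then show ?thesis
        using kap by simp
    qed
    also have "\<dots> \<le> k * (1 / 2) ^ J"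
      using small \<theta> Z by (intro mult_left_mono power_mono) (auto simp: B_def)
    also have "\<dots> \<le> 1 / 2"
    proof -
      have "real (2 * k) \<le> real (2 ^ J)"
        using kn by (simp only: J_def of_nat_le_iff)
      then show ?thesis
        by (simp add: power_divide field_simps)
    qed
    finally have half: "avg A (\<lambda>S. (\<Sum>y\<in>{0..<int k}. ?ch (J - 1) y S) / \<kappa>) \<le> 1 / 2" .
    \<comment> \<open>The dichotomy is averaged; the chain term takes at most half of the left-hand
      side.\<close>
    have "c0 * J / 2 \<le> avg A (\<lambda>S. drop_sum L n k S + c0 * J / 2 * ((\<Sum>y\<in>{0..<int k}. ?ch (J - 1) y S) / \<kappa>))"
      using drop_sum_or_chain[OF k L _ \<theta>, of n] J finA
      unfolding J_def \<kappa>_def c0_def by (intro avg_ge_const) auto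
    also have "\<dots> = avg A (drop_sum L n k) + c0 * J / 2 * avg A (\<lambda>S. (\<Sum>y\<in>{0..<int k}. ?ch (J - 1) y S) / \<kappa>)"
      unfolding avg_add avg_cmult ..
    also have "\<dots> \<le> avg A (drop_sum L n k) + c0 * J / 2 * (1 / 2)"
      using half c0 by (intro add_left_mono mult_left_mono) auto
    also have "avg A (drop_sum L n k) \<le> C * (\<Sum>e\<in>A. pivotal A ?t e)"
      using avg_drop_sum_le[OF k L, of n] by (simp add: C_def A_def)
    finally have "c0 * J / 4 \<le> C * (\<Sum>e\<in>A. pivotal A ?t e)"
      by simp
    moreover have "c1 * n * C \<le> c0 * J / 4"
    proof -
      have "c1 * n * C = c0 / (8 * L) * n"
        using C by (simp add: c1_def)
      also have "\<dots> \<le> c0 / (8 * L) * (2 * L * J)"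
        using n c0 by (intro mult_left_mono) auto
      also have "\<dots> = c0 * J / 4"
        using L by simp
      finally show ?thesis .
    qed
    ultimately have "C * (c1 * n) \<le> C * (\<Sum>e\<in>A. pivotal A ?t e)"
      by (simp add: mult_ac)
    then have "c1 * n \<le> (\<Sum>e\<in>A. pivotal A ?t e)"
      using C by simp
    then have "(c1 * n)\<^sup>2 \<le> (\<Sum>e\<in>A. pivotal A ?t e)\<^sup>2"
      using c1 by (intro power_mono) auto
    also have "\<dots> \<le> 4 * real (card A) * avg A (\<lambda>S. (?t S - avg A ?t)\<^sup>2)"
      using variance_ge_pivotal[OF finA, of ?t] by simp
    \<comment> \<open>There are of order \<open>n * k\<close> edges, so Cauchy-Schwarz gives a
      variance of order at least \<open>n\<^sup>2 / (n * k)\<close>.\<close>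
    also have "\<dots> \<le> 16 * real n * real k * avg A (\<lambda>S. (?t S - avg A ?t)\<^sup>2)"
    proof (rule mult_right_mono)
      have "card A = 2 * ((n + 1) * k)"
        by (simp add: A_def card_strip nat_add_distrib)
      also have "\<dots> \<le> 2 * ((2 * n) * k)"
        using n(2) by (intro mult_left_mono mult_right_mono) auto
      finally have "real (card A) \<le> real (4 * n * k)"
        unfolding of_nat_le_iff by simp
      then show "4 * real (card A) \<le> 16 * real n * real k"
        by (simp add: mult_ac)
      show "0 \<le> avg A (\<lambda>S. (?t S - avg A ?t)\<^sup>2)"
        by (rule avg_nonneg) simp
    qed
    finally have "(c1 * n)\<^sup>2 \<le> 16 * real n * real k * avg A (\<lambda>S. (?t S - avg A ?t)\<^sup>2)" .
    then show "c1\<^sup>2 / 16 * n / k \<le> avg (strip 0 (int n + 1) k) (\<lambda>S. (?t S - avg (strip 0 (int n + 1) k) ?t)\<^sup>2)"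
      using k n(2) unfolding A_def[symmetric] by (simp add: power_mult_distrib power2_eq_square field_simps)
  qed (use c1 L in auto)
qed

end

section \<open>Moderate deviations of crossing times\<close>

lemma weight_space_component:
  "(\<lambda>\<omega>. \<omega> e) \<in> borel_measurable (weight_space a b)"
proof -
  have "(\<lambda>\<omega>. \<omega> e) \<in> measurable (weight_space a b) (measure_pmf (pmf_of_set {a, b}))"
    unfolding weight_space_def by (rule measurable_component_singleton) simp
  then show ?thesis
    by (rule measurable_compose) simp
qed

lemma prob_space_weight_space: "prob_space (weight_space a b)"
  unfolding weight_space_def by (rule prob_space_PiM) (rule prob_space_measure_pmf)

lemma passage_time_measurable: "(\<lambda>\<omega>. passage_time \<omega> p) \<in> borel_measurable (weight_space a b)"
  by (induction p rule: induct_list012) (auto intro!: borel_measurable_add weight_space_component)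

lemma crossing_time_measurable: "crossing_time n k \<in> borel_measurable (weight_space a b)"
proof -
  have "(\<lambda>\<omega>. INF p\<in>crossing_paths n k. passage_time \<omega> p) \<in> borel_measurable (weight_space a b)"
    by (rule borel_measurable_cINF_real) (auto intro: passage_time_measurable)
  then show ?thesis
    unfolding crossing_time_def[abs_def] .
qed

text \<open>The strip extends to \<open>n + 1\<close> in order to contain the vertical edges on the
  right side of the rectangle.\<close>

lemma crossing_time_cong:
  assumes "\<And>e. e \<in> strip 0 (int n + 1) k \<Longrightarrow> \<omega> e = \<omega>' e"
  shows "crossing_time n k \<omega> = crossing_time n k \<omega>'"
proof -
  have "passage_time \<omega> p = passage_time \<omega>' p" if "p \<in> crossing_paths n k" for p
  proof (rule passage_time_cong)
    fix e assume e: "e \<in> set (path_edges p)"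
    have "e \<in> strip 0 (int n) k \<union> vline (int n) k"
      using that e path_edges_rect[of p 0 "int n" k e] by (simp add: crossing_paths_eq crossings_def)
    also have "\<dots> \<subseteq> strip 0 (int n + 1) k"
      by (auto simp: strip_def vline_def)
    finally show "\<omega> e = \<omega>' e"
      by (rule assms)
  qed
  then show ?thesis
    unfolding crossing_time_def by (intro arg_cong[where f = Inf] image_cong refl)
qed

context two_weights
begin

lemma cylinder_measure:
  fixes S :: "edge set"
  assumes "finite A"
  defines "C \<equiv> {\<omega> \<in> space (weight_space a b). \<forall>e\<in>A. \<omega> e = weights S e}"
  shows "C \<in> sets (weight_space a b)" "measure (weight_space a b) C = 1 / 2 ^ card A"
proof -
  let ?p = "measure_pmf (pmf_of_set {a, b})"
  interpret product_prob_space "\<lambda>_. ?p" UNIV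
    by unfold_locales
  show "C \<in> sets (weight_space a b)"
    unfolding C_def by (intro sets.sets_Collect_finite_All assms borel_measurable_eq weight_space_component) auto
  have "C = prod_emb UNIV (\<lambda>_. ?p) A (\<Pi>\<^sub>E e\<in>A. {weights S e})"
    unfolding C_def weight_space_def by (auto simp: prod_emb_def space_PiM PiE_iff)
  then have "measure (weight_space a b) C = (\<Prod>e\<in>A. measure ?p {weights S e})"
    unfolding weight_space_def using measure_PiM_emb[of A "\<lambda>e. {weights S e}"] assms(1) by simp
  also have "\<dots> = (\<Prod>e\<in>A. 1 / 2)"
    using a_less_b by (intro prod.cong refl) (auto simp: weights_def measure_pmf_single pmf_of_set)
  finally show "measure (weight_space a b) C = 1 / 2 ^ card A"
    by (simp add: power_divide)
qed

lemma AE_weights: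
  assumes "finite A"
  shows "AE \<omega> in weight_space a b. \<forall>e\<in>A. \<omega> e = weights {e \<in> A. \<omega> e = b} e"
proof -
  let ?p = "measure_pmf (pmf_of_set {a, b})"
  interpret product_prob_space "\<lambda>_. ?p" UNIV
    by unfold_locales
  have "AE \<omega> in weight_space a b. \<omega> e \<in> {a, b}" for e
    unfolding weight_space_def
    by (rule AE_component) (auto simp: AE_measure_pmf_iff set_pmf_of_set)
  then have "AE \<omega> in weight_space a b. \<forall>e\<in>A. \<omega> e \<in> {a, b}"
    using assms by (simp add: AE_finite_all)
  then show ?thesis
    by eventually_elim (auto simp: weights_def)
qed

text \<open>The weights on \<open>A\<close> almost surely take only the values a and b, so
  \<open>f\<close> is almost surely a finite combination of cylinder indicators, each of probability
  \<open>1 / 2 ^ card A\<close>.\<close>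

lemma integral_weight_space:
  fixes f :: "(edge \<Rightarrow> real) \<Rightarrow> real"
  assumes A: "finite A" and f: "f \<in> borel_measurable (weight_space a b)"
    and cong: "\<And>\<omega> \<omega>'. (\<And>e. e \<in> A \<Longrightarrow> \<omega> e = \<omega>' e) \<Longrightarrow> f \<omega> = f \<omega>'"
  shows "integral\<^sup>L (weight_space a b) f = avg A (\<lambda>S. f (weights S))"
proof -
  interpret prob_space "weight_space a b"
    by (rule prob_space_weight_space)
  let ?M = "weight_space a b"
  define C where "C = (\<lambda>S. {\<omega> \<in> space ?M. \<forall>e\<in>A. \<omega> e = weights S e})"
  have C: "C S \<in> sets ?M" "measure ?M (C S) = 1 / 2 ^ card A" for S
    unfolding C_def using cylinder_measure[OF A] by auto
  have "integral\<^sup>L ?M f = integral\<^sup>L ?M (\<lambda>\<omega>. \<Sum>S\<in>Pow A. f (weights S) * indicator (C S) \<omega>)"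
  proof (rule integral_cong_AE[OF f])
    show "(\<lambda>\<omega>. \<Sum>S\<in>Pow A. f (weights S) * indicator (C S) \<omega>) \<in> borel_measurable ?M"
      using C by (intro borel_measurable_sum borel_measurable_times) auto
    have "AE \<omega> in ?M. \<omega> \<in> space ?M"
      by simp
    then show "AE \<omega> in ?M. f \<omega> = (\<Sum>S\<in>Pow A. f (weights S) * indicator (C S) \<omega>)"
      using AE_weights[OF A]
    proof eventually_elim
      case (elim \<omega>)
      define S0 where "S0 = {e \<in> A. \<omega> e = b}"
      have "\<omega> \<in> C S \<longleftrightarrow> S = S0" if "S \<subseteq> A" for S
      proof -
        have "\<omega> \<in> C S \<longleftrightarrow> (\<forall>e\<in>A. weights S0 e = weights S e)"
          unfolding C_def S0_def using elim by simp
        also have "\<dots> \<longleftrightarrow> (\<forall>e\<in>A. e \<in> S0 \<longleftrightarrow> e \<in> S)"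
          using a_less_b by (auto simp: weights_def)
        also have "\<dots> \<longleftrightarrow> S = S0"
          using that by (auto simp: S0_def)
        finally show ?thesis .
      qed
      then have "(\<Sum>S\<in>Pow A. f (weights S) * indicator (C S) \<omega>) = (\<Sum>S\<in>Pow A. if S = S0 then f (weights S0) else 0)"
        by (intro sum.cong refl) (auto simp: indicator_def)
      also have "\<dots> = f (weights S0)"
        using A by (simp add: S0_def)
      also have "\<dots> = f \<omega>"
        using elim by (intro cong) (simp add: S0_def)
      finally show ?case ..
    qed
  qed
  also have "\<dots> = (\<Sum>S\<in>Pow A. f (weights S) * measure ?M (C S))"
    using C by (subst Bochner_Integration.integral_sum) (auto intro!: integrable_real_indicator simp: emeasure_eq_measure)
  also have "\<dots> = avg A (\<lambda>S. f (weights S))"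
    by (simp add: C avg_def sum_divide_distrib)
  finally show ?thesis .
qed

lemma measure_weight_space:
  fixes f :: "(edge \<Rightarrow> real) \<Rightarrow> real"
  assumes A: "finite A" and f: "f \<in> borel_measurable (weight_space a b)"
    and cong: "\<And>\<omega> \<omega>'. (\<And>e. e \<in> A \<Longrightarrow> \<omega> e = \<omega>' e) \<Longrightarrow> f \<omega> = f \<omega>'"
  shows "measure (weight_space a b) {\<omega> \<in> space (weight_space a b). z < f \<omega>}
    = avg A (\<lambda>S. of_bool (z < f (weights S)))"
proof -
  let ?M = "weight_space a b"
  have eq: "{\<omega> \<in> space ?M. z < f \<omega>} \<inter> space ?M = {\<omega> \<in> space ?M. z < f \<omega>}"
    by auto
  have "measure ?M {\<omega> \<in> space ?M. z < f \<omega>} = integral\<^sup>L ?M (indicator {\<omega> \<in> space ?M. z < f \<omega>})"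
    by (simp add: eq)
  also have "\<dots> = integral\<^sup>L ?M (\<lambda>\<omega>. of_bool (z < f \<omega>))"
    by (rule Bochner_Integration.integral_cong) (auto simp: indicator_def)
  also have "\<dots> = avg A (\<lambda>S. of_bool (z < f (weights S)))"
  proof (rule integral_weight_space[OF A])
    have "{\<omega> \<in> space ?M. z < f \<omega>} \<in> sets ?M"
      by (rule borel_measurable_less[OF borel_measurable_const f])
    then show "(\<lambda>\<omega>. of_bool (z < f \<omega>)) \<in> borel_measurable ?M"
      unfolding of_bool_def by (intro measurable_If) auto
  qed (use cong in metis)
  finally show ?thesis .
qed

text \<open>A non-asymptotic form: the number \<open>m\<close> of blocks and the tail parameter
  \<open>p\<close> remain free, to be balanced afterwards.\<close>

lemma crossing_moderate_deviation:
  fixes n k m :: nat and V p x \<epsilon> :: real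
  defines "M \<equiv> weight_space a b"
    and "A \<equiv> strip 0 (int n + 1) k"
  defines "E \<equiv> integral\<^sup>L M (crossing_time n k)"
  defines "Var \<equiv> integral\<^sup>L M (\<lambda>\<omega>. (crossing_time n k \<omega> - E)\<^sup>2)"
    and "\<sigma> \<equiv> sd A (T 0 (int n) k)"
  assumes "0 < k" "0 < m" "0 < p"
    and V: "(b - a)\<^sup>2 * (2 * (n / m + 1) * k) \<le> V"
    and x: "2 \<le> x" and eps: "0 < \<epsilon>" "\<epsilon> * x ^ 3 \<le> 1 / 1000"
    and D: "b * m * k + 1 \<le> \<epsilon> * \<sigma>"
    and V_eps: "sqrt V \<le> \<epsilon> * \<sigma>" "sqrt (V * p) \<le> \<epsilon> * \<sigma>"
    and rare: "2 * real m * exp (- 2 * p) \<le> \<epsilon>" "4 * (b * n)\<^sup>2 * (2 * real m * exp (- 2 * p)) \<le> 1"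
    and s: "s = 1 \<or> s = -1"
  shows "\<bar>measure M {\<omega> \<in> space M. x * sqrt Var < s * (crossing_time n k \<omega> - E)} - (1 - Phi x)\<bar>
    \<le> 4000 * (\<epsilon> * x ^ 3) * (1 - Phi x)"
proof -
  have finA: "finite A"
    by (simp add: A_def)
  have meas: "crossing_time n k \<in> borel_measurable M"
    unfolding M_def by (rule crossing_time_measurable)
  have cong: "crossing_time n k \<omega> = crossing_time n k \<omega>'" if "\<And>e. e \<in> A \<Longrightarrow> \<omega> e = \<omega>' e" for \<omega> \<omega>'
    using that unfolding A_def by (rule crossing_time_cong)
  let ?X = "T 0 (int n) k"
  have E: "E = avg A ?X"
    using integral_weight_space[OF finA meas[unfolded M_def] cong]
    by (simp add: E_def M_def crossing_time_eq)
  have Var: "Var = avg A (\<lambda>S. (?X S - avg A ?X)\<^sup>2)"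
  proof -
    have "Var = avg A (\<lambda>S. (crossing_time n k (weights S) - E)\<^sup>2)"
      unfolding Var_def M_def
    proof (rule integral_weight_space[OF finA])
      show "(\<lambda>\<omega>. (crossing_time n k \<omega> - E)\<^sup>2) \<in> borel_measurable (weight_space a b)"
        using meas unfolding M_def by measurable
      show "(crossing_time n k \<omega> - E)\<^sup>2 = (crossing_time n k \<omega>' - E)\<^sup>2"
        if "\<And>e. e \<in> A \<Longrightarrow> \<omega> e = \<omega>' e" for \<omega> \<omega>'
        using cong[of \<omega> \<omega>', OF that] by simp
    qed
    then show ?thesis
      by (simp only: crossing_time_eq E)
  qed
  have sqrtV: "sqrt Var = \<sigma>"
    by (simp add: Var \<sigma>_def sd_def)
  have prob: "measure M {\<omega> \<in> space M. x * sqrt Var < s * (crossing_time n k \<omega> - E)}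
      = avg A (\<lambda>S. of_bool (x * \<sigma> < s * (?X S - avg A ?X)))"
  proof -
    have "measure M {\<omega> \<in> space M. x * \<sigma> < s * (crossing_time n k \<omega> - E)}
        = avg A (\<lambda>S. of_bool (x * \<sigma> < s * (crossing_time n k (weights S) - E)))"
      unfolding M_def
    proof (rule measure_weight_space[OF finA])
      show "(\<lambda>\<omega>. s * (crossing_time n k \<omega> - E)) \<in> borel_measurable (weight_space a b)"
        using meas unfolding M_def by measurable
      show "s * (crossing_time n k \<omega> - E) = s * (crossing_time n k \<omega>' - E)"
        if "\<And>e. e \<in> A \<Longrightarrow> \<omega> e = \<omega>' e" for \<omega> \<omega>'
        using cong[of \<omega> \<omega>', OF that] by simp
    qed
    then show ?thesis
      by (simp only: crossing_time_eq E sqrtV)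
  qed
  \<comment> \<open>Equally spaced cuts; rounding makes a block at most \<open>n / m + 1\<close>
    wide.\<close>
  define c where "c = (\<lambda>i. int (i * n div m))"
  have c: "mono c" "c 0 = 0" "c m = int n"
    using \<open>0 < m\<close> by (auto simp: c_def mono_def intro!: div_le_mono)
  have c_le: "c i \<le> c (Suc i)" for i
    using c(1) by (auto simp: mono_def)
  have c_nonneg: "0 \<le> c i" for i
    by (simp add: c_def)
  define F where "F = (\<lambda>i. strip (c i) (c (Suc i)) k)"
  define U where "U = (\<lambda>i S. T (c i) (c (Suc i)) k (S \<inter> F i))"
  have Vpos: "0 < V"
  proof -
    have "0 < (b - a)\<^sup>2 * (2 * (n / m + 1) * k)"
      using a_less_b assms(6,7) by (intro mult_pos_pos) (auto intro!: add_nonneg_pos)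
    with V show ?thesis by linarith
  qed
  interpret perturbed_indep_sum A "{..<m}" F U ?X "b - a" V "b * m * k" "b * n" p x \<epsilon>
  proof
    show "depends_on (F i) (U i)" for i
      unfolding depends_on_def U_def by (simp add: Int_assoc)
    show "disjoint_family_on F {..<m}"
      unfolding disjoint_family_on_def
    proof (intro ballI impI)
      fix i j :: nat assume "i \<noteq> j"
      then have "Suc i \<le> j \<or> Suc j \<le> i" by auto
      then have "c (Suc i) \<le> c j \<or> c (Suc j) \<le> c i"
        using c(1) by (auto simp: mono_def)
      then show "F i \<inter> F j = {}"
        by (auto simp: F_def strip_def)
    qed
    show "\<bar>U i (insert e S) - U i S\<bar> \<le> b - a" for i e S
    proof (cases "e \<in> F i")
      case True
      then have "insert e S \<inter> F i = insert e (S \<inter> F i)" by auto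
      then show ?thesis
        unfolding U_def using T_diff_insert[OF \<open>0 < k\<close> c_le] by simp
    next
      case False
      then have "insert e S \<inter> F i = S \<inter> F i" by auto
      then show ?thesis
        unfolding U_def using a_less_b by simp
    qed
    show "(b - a)\<^sup>2 * card (A \<inter> F i) \<le> V" for i
    proof -
      have "c (Suc i) - c i \<le> n / m + 1"
      proof -
        have div: "real l / m - 1 \<le> real (l div m)" "real (l div m) \<le> real l / m" for l
          using floor_divide_of_nat_eq[of l m, where ?'a = real] by linarith+
        have "real_of_int (c (Suc i)) \<le> real (Suc i * n) / m"
          unfolding c_def of_int_of_nat_eq by (rule div)
        moreover have "real (i * n) / m - 1 \<le> real_of_int (c i)"
          unfolding c_def of_int_of_nat_eq by (rule div)
        moreover have "real (Suc i * n) / m = real (i * n) / m + n / m"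
          by (simp add: add_divide_distrib algebra_simps)
        ultimately show ?thesis by simp
      qed
      then have len: "real (nat (c (Suc i) - c i)) \<le> n / m + 1"
        using c_le[of i] by (simp add: of_nat_nat)
      have "card (A \<inter> F i) \<le> card (F i)"
        unfolding F_def by (intro card_mono) auto
      also have "\<dots> = 2 * (nat (c (Suc i) - c i) * k)"
        unfolding F_def by (rule card_strip)
      finally have "real (card (A \<inter> F i)) \<le> 2 * (real (nat (c (Suc i) - c i)) * k)"
        using of_nat_mono by fastforce
      also have "\<dots> \<le> 2 * (n / m + 1) * k"
        unfolding mult.assoc using len by (intro mult_left_mono mult_right_mono) auto
      finally have "(b - a)\<^sup>2 * card (A \<inter> F i) \<le> (b - a)\<^sup>2 * (2 * (n / m + 1) * k)"
        by (intro mult_left_mono) auto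
      with V show ?thesis by linarith
    qed
    show "0 \<le> U i S" for i S
      unfolding U_def by (rule T_bounds[OF \<open>0 < k\<close> c_le])
    have sum_le: "(\<Sum>i<m. U i S) \<le> ?X S" for S
      using sum_blocks_le_T[OF \<open>0 < k\<close> c(1), where m = m and S = S] by (simp add: U_def F_def c)
    show X: "0 \<le> ?X S" "?X S \<le> b * n" for S
      using T_bounds[OF \<open>0 < k\<close>, of 0 "int n" S] by auto
    show "(\<Sum>i<m. U i S) \<le> b * n" for S
      by (rule order_trans[OF sum_le X(2)])
    show "\<bar>?X S - (\<Sum>i<m. U i S)\<bar> \<le> b * m * k" for S
      using sum_le[of S] T_le_sum_blocks[OF \<open>0 < k\<close> c(1), where m = m and S = S] by (simp add: U_def F_def c)
    show "0 \<le> b * m * k"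
      using a_pos a_less_b by simp
  qed (use finA Vpos assms in \<open>simp_all add: \<sigma>_def\<close>)
  show ?thesis
    unfolding prob using moderate_deviation[OF s] by (simp add: \<sigma>_def)
qed

end

lemma powr_exp_decay:
  fixes \<alpha> :: real
  assumes "0 < \<alpha>"
  shows "((\<lambda>n::nat. real n ^ 3 * exp (- 2 * real n powr \<alpha>)) \<longlongrightarrow> 0) sequentially"
  using assms by real_asymp

text \<open>Since \<open>k\<close> is eventually at most \<open>n\<close>, this supplies the growth
  condition of the variance bound.\<close>

lemma linear_le_power_div:
  fixes L :: nat
  assumes "0 < L"
  shows "eventually (\<lambda>n. 2 * n \<le> 2 ^ (n div L)) sequentially"
proof -
  have "((\<lambda>j::nat. 2 * (real j + 1) * real L / 2 ^ j) \<longlongrightarrow> 0) sequentially"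
    by real_asymp
  then have "eventually (\<lambda>j. 2 * (real j + 1) * real L / 2 ^ j < 1) sequentially"
    by (rule order_tendstoD) simp
  then have "eventually (\<lambda>j. 2 * (Suc j * L) \<le> 2 ^ j) sequentially"
  proof eventually_elim
    case (elim j)
    then have "real (2 * (Suc j * L)) \<le> real (2 ^ j)"
      by (simp add: field_simps)
    then show ?case
      by (simp only: of_nat_le_iff)
  qed
  moreover have "filterlim (\<lambda>n. n div L) at_top sequentially"
    unfolding filterlim_at_top
  proof
    fix Z :: nat
    show "eventually (\<lambda>n. Z \<le> n div L) sequentially"
      using eventually_ge_at_top[of "Z * L"]
      by eventually_elim (use assms in \<open>simp add: less_eq_div_iff_mult_less_eq\<close>)
  qed
  ultimately have "eventually (\<lambda>n. 2 * (Suc (n div L) * L) \<le> 2 ^ (n div L)) sequentially"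
    by (rule eventually_compose_filterlim)
  then show ?thesis
  proof eventually_elim
    case (elim n)
    have "n < Suc (n div L) * L"
      using assms by (simp add: dividend_less_times_div mult.commute)
    with elim show ?case by linarith
  qed
qed

text \<open>Here \<kappa> is the height and \<open>sqrt (N / \<kappa>)\<close> the order of the
  lower bound for the standard deviation. The left-hand sides are the cutting error for
  \<open>N powr (1 / 3)\<close> blocks and the block fluctuation enlarged for the union bound. Both
  inequalities lose only in replacing \<kappa> by \<open>N powr \<alpha>\<close>.\<close>

lemma scale_comparison:
  fixes N \<kappa> \<alpha> :: real
  assumes "1 \<le> N" "1 \<le> \<kappa>" "\<kappa> \<le> N powr \<alpha>"
  shows "N powr (1 / 3) * \<kappa> \<le> N powr (- 1 / 6 + 3 * \<alpha> / 2) * sqrt (N / \<kappa>)"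
    and "N powr (1 / 3) * sqrt \<kappa> * N powr (\<alpha> / 2) \<le> N powr (- 1 / 6 + 3 * \<alpha> / 2) * sqrt (N / \<kappa>)"
proof -
  have N: "0 < N" and \<kappa>: "0 < \<kappa>"
    using assms by auto
  have rhs: "N powr (- 1 / 6 + 3 * \<alpha> / 2) * sqrt (N / \<kappa>) = N powr (1 / 3) * N powr (3 * \<alpha> / 2) / sqrt \<kappa>"
  proof -
    have "N powr (- 1 / 6 + 3 * \<alpha> / 2) * N powr (1 / 2) = N powr (1 / 3) * N powr (3 * \<alpha> / 2)"
      by (simp flip: powr_add)
    then show ?thesis
      using N by (simp add: real_sqrt_divide powr_half_sqrt)
  qed
  have sq: "sqrt \<kappa> \<le> N powr (\<alpha> / 2)"
  proof -
    have "sqrt \<kappa> \<le> sqrt (N powr \<alpha>)"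
      using assms by simp
    also have "\<dots> = N powr (\<alpha> / 2)"
      using N by (simp add: powr_half_sqrt[symmetric] powr_powr)
    finally show ?thesis .
  qed
  have k: "\<kappa> * N powr (\<alpha> / 2) \<le> N powr (3 * \<alpha> / 2)"
  proof -
    have "\<kappa> * N powr (\<alpha> / 2) \<le> N powr \<alpha> * N powr (\<alpha> / 2)"
      using assms by (intro mult_right_mono) auto
    also have "\<dots> = N powr (3 * \<alpha> / 2)"
      by (simp flip: powr_add)
    finally show ?thesis .
  qed
  have "\<kappa> * sqrt \<kappa> \<le> \<kappa> * N powr (\<alpha> / 2)"
    using sq \<kappa> by (intro mult_left_mono) auto
  then have "\<kappa> * sqrt \<kappa> \<le> N powr (3 * \<alpha> / 2)"
    using k by simp
  then have "\<kappa> \<le> N powr (3 * \<alpha> / 2) / sqrt \<kappa>"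
    using \<kappa> by (simp add: field_simps)
  then have "N powr (1 / 3) * \<kappa> \<le> N powr (1 / 3) * (N powr (3 * \<alpha> / 2) / sqrt \<kappa>)"
    by (intro mult_left_mono) auto
  then show "N powr (1 / 3) * \<kappa> \<le> N powr (- 1 / 6 + 3 * \<alpha> / 2) * sqrt (N / \<kappa>)"
    unfolding rhs by simp
  have "sqrt \<kappa> * N powr (\<alpha> / 2) * sqrt \<kappa> = (sqrt \<kappa> * sqrt \<kappa>) * N powr (\<alpha> / 2)"
    by (simp only: mult_ac)
  also have "\<dots> \<le> N powr (3 * \<alpha> / 2)"
    using k \<kappa> by simp
  finally have "sqrt \<kappa> * N powr (\<alpha> / 2) \<le> N powr (3 * \<alpha> / 2) / sqrt \<kappa>"
    using \<kappa> by (simp add: pos_le_divide_eq)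
  then have "N powr (1 / 3) * (sqrt \<kappa> * N powr (\<alpha> / 2)) \<le> N powr (1 / 3) * (N powr (3 * \<alpha> / 2) / sqrt \<kappa>)"
    by (intro mult_left_mono) auto
  then show "N powr (1 / 3) * sqrt \<kappa> * N powr (\<alpha> / 2) \<le> N powr (- 1 / 6 + 3 * \<alpha> / 2) * sqrt (N / \<kappa>)"
    unfolding rhs by (simp add: mult.assoc)
qed

lemma (in two_weights) relative_error_eventually:
  fixes \<alpha> :: real and k :: "nat \<Rightarrow> nat" and x :: "nat \<Rightarrow> real"
  assumes \<alpha>: "0 < \<alpha>" "\<alpha> < 1 / 10"
    and k_pos: "\<And>n. 0 < k n"
    and k_lim: "(\<lambda>n. real (k n) / real n powr \<alpha>) \<longlonglongrightarrow> 0"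
    and x_top: "filterlim x at_top sequentially"
    and x_lim: "(\<lambda>n. x n / real n powr ((1 - 10 * \<alpha>) / 18)) \<longlonglongrightarrow> 0"
  defines "M \<equiv> weight_space a b"
  defines "E \<equiv> \<lambda>n. integral\<^sup>L M (crossing_time n (k n))"
  defines "Var \<equiv> \<lambda>n. integral\<^sup>L M (\<lambda>\<omega>. (crossing_time n (k n) \<omega> - E n)\<^sup>2)"
  shows "\<exists>C. eventually (\<lambda>n. \<forall>s\<in>{1, -1}.
     \<bar>measure M {\<omega> \<in> space M. x n * sqrt (Var n) < s * (crossing_time n (k n) \<omega> - E n)} / (1 - Phi (x n)) - 1\<bar>
       \<le> C * (real n powr (- 1 / 6 + 3 * \<alpha> / 2) * x n ^ 3)) sequentially"
proof -
  obtain c :: real and L :: nat where cL: "0 < c" "0 < L"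
    and var: "\<And>n k. 0 < k \<Longrightarrow> 2 * k \<le> 2 ^ (n div L) \<Longrightarrow>
      c * n / k \<le> avg (strip 0 (int n + 1) k)
        (\<lambda>S. (T 0 (int n) k S - avg (strip 0 (int n + 1) k) (T 0 (int n) k))\<^sup>2)"
    using variance_lower_bound by blast
  \<comment> \<open>\<open>2 * b + 1\<close> serves the cutting error \<open>b * m * k + 1\<close>,
    and \<open>2 * (b - a)\<close> the clamping level \<open>sqrt (V * p)\<close>.\<close>
  define C where "C = (2 * b + 1 + 2 * (b - a)) / sqrt c"
  have b: "0 < b" "0 < b - a"
    using a_pos a_less_b by auto
  have C: "0 < C" "2 * b + 1 \<le> C * sqrt c" "2 * (b - a) \<le> C * sqrt c"
    using b cL by (auto simp: C_def intro!: divide_pos_pos)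
  define \<rho> where "\<rho> = (\<lambda>n::nat. real n powr (- 1 / 6 + 3 * \<alpha> / 2))"
  have x3: "(\<lambda>n. \<rho> n * x n ^ 3) \<longlonglongrightarrow> 0"
  proof -
    \<comment> \<open>The exponent of \<rho> is
      \<open>- \<alpha> / 6 - (1 - 10 * \<alpha>) / 6\<close>: the hypothesis on \<open>x\<close>
      handles the second part, and the first leaves a vanishing factor.\<close>
    have "(\<lambda>n. (x n / real n powr ((1 - 10 * \<alpha>) / 18)) ^ 3 * real n powr (- \<alpha> / 6)) \<longlonglongrightarrow> 0 ^ 3 * 0"
    proof (intro tendsto_mult tendsto_power x_lim)
      show "(\<lambda>n::nat. real n powr (- \<alpha> / 6)) \<longlonglongrightarrow> 0"
        using \<alpha> by real_asymp
    qed
    moreover have "eventually (\<lambda>n. (x n / real n powr ((1 - 10 * \<alpha>) / 18)) ^ 3 * real n powr (- \<alpha> / 6) = \<rho> n * x n ^ 3) sequentially"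
      using eventually_gt_at_top[of 0]
    proof eventually_elim
      case (elim n)
      have cube: "(real n powr ((1 - 10 * \<alpha>) / 18)) ^ 3 = real n powr ((1 - 10 * \<alpha>) / 6)"
      proof -
        have "(real n powr ((1 - 10 * \<alpha>) / 18)) ^ 3
            = real n powr ((1 - 10 * \<alpha>) / 18 + (1 - 10 * \<alpha>) / 18 + (1 - 10 * \<alpha>) / 18)"
          by (simp only: power3_eq_cube powr_add)
        also have "(1 - 10 * \<alpha>) / 18 + (1 - 10 * \<alpha>) / 18 + (1 - 10 * \<alpha>) / 18 = (1 - 10 * \<alpha>) / 6"
          by simp
        finally show ?thesis .
      qed
      have ratio: "real n powr (- \<alpha> / 6) / real n powr ((1 - 10 * \<alpha>) / 6) = \<rho> n"
        unfolding \<rho>_def powr_diff[symmetric] by (rule arg_cong[where f = "\<lambda>z. real n powr z"]) (simp add: field_simps)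
      have "(u / w) ^ 3 * v = (v / w ^ 3) * u ^ 3" for u v w :: real
        by (simp add: power_divide)
      then show ?case
        by (simp only: cube ratio)
    qed
    ultimately show ?thesis
      by (simp cong: filterlim_cong)
  qed
  have ev_k: "eventually (\<lambda>n. real (k n) / real n powr \<alpha> < 1) sequentially"
    using k_lim by (rule order_tendstoD) simp
  have ev_x: "eventually (\<lambda>n. 2 \<le> x n) sequentially"
    using x_top by (simp add: filterlim_at_top)
  have ev_x3: "eventually (\<lambda>n. \<rho> n * x n ^ 3 < 1 / (1000 * C)) sequentially"
    using x3 by (rule order_tendstoD) (use C in simp)
  have ev_e: "eventually (\<lambda>n. real n ^ 3 * exp (- 2 * real n powr \<alpha>) < min (C / 4) (1 / (16 * b\<^sup>2))) sequentially"
    using powr_exp_decay[OF \<alpha>(1)] by (rule order_tendstoD) (use C b in simp)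
  have "eventually (\<lambda>n. \<forall>s\<in>{1, -1}.
     \<bar>measure M {\<omega> \<in> space M. x n * sqrt (Var n) < s * (crossing_time n (k n) \<omega> - E n)} / (1 - Phi (x n)) - 1\<bar>
       \<le> (4000 * C) * (\<rho> n * x n ^ 3)) sequentially"
    using ev_k ev_x ev_x3 ev_e linear_le_power_div[OF cL(2)] eventually_gt_at_top[of 0]
  proof eventually_elim
    case (elim n)
    define N where "N = real n"
    define K where "K = real (k n)"
    define m where "m = nat \<lceil>N powr (1 / 3)\<rceil>"
    \<comment> \<open>Then \<open>exp (- 2 * p)\<close> beats every power of \<open>N\<close>, at
      the price of the factor \<open>N powr (\<alpha> / 2)\<close> in
      \<open>sqrt (V * p)\<close>.\<close>
    define p where "p = N powr \<alpha>"
    define V where "V = (b - a)\<^sup>2 * (4 * N powr (2 / 3) * K)"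
    define \<epsilon> where "\<epsilon> = C * \<rho> n"
    define \<sigma> where "\<sigma> = sd (strip 0 (int n + 1) (k n)) (T 0 (int n) (k n))"
    have N: "1 \<le> N"
      using elim by (simp add: N_def)
    have K: "1 \<le> K" "K \<le> N powr \<alpha>"
      using k_pos[of n] elim N by (auto simp: K_def N_def field_simps)
    have p1: "1 \<le> p"
      unfolding p_def using N \<alpha> by (intro ge_one_powr_ge_zero) auto
    have N13: "1 \<le> N powr (1 / 3)"
      using N by (intro ge_one_powr_ge_zero) auto
    have m: "N powr (1 / 3) \<le> real m" "real m \<le> 2 * N powr (1 / 3)" "0 < m"
      using N13 by (auto simp: m_def) linarith+
    \<comment> \<open>A crude lower bound, sufficient because the rare event decays faster than
      every power of \<open>N\<close>.\<close>
    have rho: "1 / N \<le> \<rho> n"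
    proof -
      have "N powr (- 1) \<le> N powr (- 1 / 6 + 3 * \<alpha> / 2)"
        using N \<alpha> by (intro powr_mono) auto
      moreover have "N powr (- 1) = 1 / N"
        unfolding powr_minus_divide using N by simp
      ultimately show ?thesis
        by (simp only: \<rho>_def N_def)
    qed
    have rho_pos: "0 < \<rho> n"
      using N by (simp add: \<rho>_def N_def)
    have sigma: "sqrt c * sqrt (N / K) \<le> \<sigma>"
    proof -
      have "K \<le> N"
        using K N \<alpha> powr_mono[of \<alpha> 1 N] by simp
      then have "2 * k n \<le> 2 ^ (n div L)"
        using elim(5) by (simp add: K_def N_def)
      then have "c * n / k n \<le> \<sigma>\<^sup>2"
        unfolding \<sigma>_def sd_square by (rule var[OF k_pos])
      then have "sqrt (c * (N / K)) \<le> \<sigma>"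
        by (intro real_le_lsqrt) (simp_all add: N_def K_def \<sigma>_def sd_nonneg)
      then show ?thesis
        by (simp only: real_sqrt_mult)
    qed
    have scale: "w * z \<le> \<epsilon> * \<sigma>" if "z \<le> \<rho> n * sqrt (N / K)" "0 \<le> w" "w \<le> C * sqrt c" for w z
    proof -
      have "w * z \<le> (C * sqrt c) * (\<rho> n * sqrt (N / K))"
      proof -
        have "w * z \<le> w * (\<rho> n * sqrt (N / K))"
          using that by (intro mult_left_mono)
        also have "\<dots> \<le> (C * sqrt c) * (\<rho> n * sqrt (N / K))"
          using that rho_pos N K by (intro mult_right_mono) auto
        finally show ?thesis .
      qed
      also have "\<dots> = \<epsilon> * (sqrt c * sqrt (N / K))"
        by (simp add: \<epsilon>_def)
      also have "\<dots> \<le> \<epsilon> * \<sigma>"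
        using sigma C rho_pos by (intro mult_left_mono) (auto simp: \<epsilon>_def)
      finally show ?thesis .
    qed
    have dev: "\<bar>measure M {\<omega> \<in> space M. x n * sqrt (Var n) < s * (crossing_time n (k n) \<omega> - E n)} - (1 - Phi (x n))\<bar>
        \<le> 4000 * (\<epsilon> * x n ^ 3) * (1 - Phi (x n))" if s: "s = 1 \<or> s = -1" for s
      unfolding M_def E_def Var_def
    proof (rule crossing_moderate_deviation[where n = n and k = "k n" and p = p and V = V, OF k_pos m(3), folded \<sigma>_def])
      show "0 < p" "2 \<le> x n" "s = 1 \<or> s = -1"
        using p1 elim s by auto
      show "0 < \<epsilon>"
        using C rho_pos by (simp add: \<epsilon>_def)
      show "\<epsilon> * x n ^ 3 \<le> 1 / 1000"
        using elim(3) C by (simp add: \<epsilon>_def field_simps)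
      show "(b - a)\<^sup>2 * (2 * (real n / real m + 1) * real (k n)) \<le> V"
      proof -
        have "N / real m \<le> N / N powr (1 / 3)"
          using m N13 N by (intro divide_left_mono mult_pos_pos) auto
        also have "\<dots> = N powr (2 / 3)"
        proof -
          have "N / N powr (1 / 3) = N powr 1 / N powr (1 / 3)"
            using N by simp
          also have "\<dots> = N powr (2 / 3)"
            unfolding powr_diff[symmetric] by simp
          finally show ?thesis .
        qed
        finally have "N / real m + 1 \<le> 2 * N powr (2 / 3)"
          using ge_one_powr_ge_zero[of N "2 / 3"] N by simp
        then have "2 * (N / real m + 1) * K \<le> 4 * N powr (2 / 3) * K"
          using K by (intro mult_right_mono) auto
        then show ?thesis
          unfolding V_def N_def K_def by (intro mult_left_mono) auto
      qed
      show "b * real m * real (k n) + 1 \<le> \<epsilon> * \<sigma>"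
      proof -
        have "b * real m * K \<le> b * (2 * N powr (1 / 3)) * K"
          using m b K by (intro mult_right_mono mult_left_mono) auto
        moreover have "1 * 1 \<le> N powr (1 / 3) * K"
          using N13 K by (intro mult_mono) auto
        ultimately have "b * real m * K + 1 \<le> (2 * b + 1) * (N powr (1 / 3) * K)"
          by (simp add: algebra_simps)
        also have "\<dots> \<le> \<epsilon> * \<sigma>"
          using scale_comparison(1)[OF N K] b C
          by (intro scale) (auto simp: \<rho>_def N_def)
        finally show ?thesis
          by (simp add: K_def)
      qed
      have sqrtVp: "sqrt (V * p) = 2 * (b - a) * (N powr (1 / 3) * sqrt K * N powr (\<alpha> / 2))"
      proof -
        have "sqrt (N powr (2 / 3)) = N powr (1 / 3)" "sqrt (N powr \<alpha>) = N powr (\<alpha> / 2)"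
          using N by (simp_all add: powr_half_sqrt[symmetric] powr_powr)
        then show ?thesis
          using b by (simp add: V_def p_def real_sqrt_mult)
      qed
      show Vp: "sqrt (V * p) \<le> \<epsilon> * \<sigma>"
        unfolding sqrtVp using scale_comparison(2)[OF N K] b C
        by (intro scale) (auto simp: \<rho>_def N_def)
      have "V * 1 \<le> V * p"
        using p1 N K by (intro mult_left_mono) (auto simp: V_def)
      then have "sqrt V \<le> sqrt (V * p)"
        by simp
      then show "sqrt V \<le> \<epsilon> * \<sigma>"
        using Vp by (rule order_trans)
      have N_le: "N powr (1 / 3) \<le> N"
        using powr_mono[of "1 / 3" 1 N] N by simp
      have e: "N ^ 3 * exp (- 2 * p) < C / 4" "N ^ 3 * exp (- 2 * p) < 1 / (16 * b\<^sup>2)"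
        using elim(4) by (auto simp: N_def p_def)
      have mN: "2 * real m * exp (- 2 * p) \<le> 4 * N * exp (- 2 * p)"
        using m N_le by (intro mult_right_mono) auto
      have "1 * N \<le> N * N" "N * N * 1 \<le> N * N * N"
        using N by (intro mult_right_mono mult_left_mono; simp)+
      then have "N * N \<le> N ^ 3" "N \<le> N ^ 3"
        by (simp_all add: power3_eq_cube)
      show "2 * real m * exp (- 2 * p) \<le> \<epsilon>"
      proof -
        have "4 * N * exp (- 2 * p) = (4 * (N * N) * exp (- 2 * p)) * (1 / N)"
          using N by simp
        also have "\<dots> \<le> (4 * N ^ 3 * exp (- 2 * p)) * \<rho> n"
          using \<open>N * N \<le> N ^ 3\<close> rho N by (intro mult_mono mult_right_mono) auto
        also have "\<dots> \<le> C * \<rho> n"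
          using e(1) rho_pos by (intro mult_right_mono) auto
        finally show ?thesis
          using mN unfolding \<epsilon>_def by linarith
      qed
      show "4 * (b * real n)\<^sup>2 * (2 * real m * exp (- 2 * p)) \<le> 1"
      proof -
        have "4 * (b * real n)\<^sup>2 * (2 * real m * exp (- 2 * p)) \<le> 4 * (b * N)\<^sup>2 * (4 * N * exp (- 2 * p))"
          unfolding N_def[symmetric] using mN by (intro mult_left_mono) auto
        also have "\<dots> = 16 * b\<^sup>2 * (N ^ 3 * exp (- 2 * p))"
          by (simp add: power_mult_distrib power2_eq_square power3_eq_cube)
        also have "\<dots> \<le> 16 * b\<^sup>2 * (1 / (16 * b\<^sup>2))"
          using e(2) by (intro mult_left_mono) auto
        also have "\<dots> = 1"
          using b by simp
        finally show ?thesis .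
      qed
    qed
    have q: "0 < 1 - Phi (x n)"
      using Phi_less_1[of "x n"] by simp
    show ?case
    proof
      fix s :: real assume "s \<in> {1, -1}"
      then have "s = 1 \<or> s = -1" by auto
      let ?P = "measure M {\<omega> \<in> space M. x n * sqrt (Var n) < s * (crossing_time n (k n) \<omega> - E n)}"
      have "\<bar>?P / (1 - Phi (x n)) - 1\<bar> = \<bar>?P - (1 - Phi (x n))\<bar> / (1 - Phi (x n))"
      proof -
        have "?P / (1 - Phi (x n)) - 1 = (?P - (1 - Phi (x n))) / (1 - Phi (x n))"
          using q by (simp add: diff_divide_distrib)
        then show ?thesis
          using q by (simp add: abs_divide)
      qed
      also have "\<dots> \<le> 4000 * (\<epsilon> * x n ^ 3) * (1 - Phi (x n)) / (1 - Phi (x n))"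
        using dev[OF \<open>s = 1 \<or> s = -1\<close>] q by (intro divide_right_mono) auto
      also have "\<dots> = 4000 * C * (\<rho> n * x n ^ 3)"
        using q by (simp add: \<epsilon>_def)
      finally show "\<bar>?P / (1 - Phi (x n)) - 1\<bar> \<le> 4000 * C * (\<rho> n * x n ^ 3)" .
    qed
  qed
  then show ?thesis
    unfolding \<rho>_def by blast
qed

theorem theorem4p1:
  fixes a b \<alpha> :: real and k :: "nat \<Rightarrow> nat" and x :: "nat \<Rightarrow> real"
  assumes "0 < a" and "a < b" and "\<alpha> < 1/10"
    and "\<And>n. 0 < k n"
    and "(\<lambda>n. real (k n) / real n powr \<alpha>) \<longlonglongrightarrow> 0"
    and "filterlim x at_top sequentially"
    and "(\<lambda>n. x n / real n powr ((1 - 10 * \<alpha>) / 18)) \<longlonglongrightarrow> 0"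
  shows
   "let M = weight_space a b;
        t = (\<lambda>n. crossing_time n (k n));
        E = (\<lambda>n. integral\<^sup>L M (t n));
        V = (\<lambda>n. integral\<^sup>L M (\<lambda>\<omega>. (t n \<omega> - E n)\<^sup>2));
        r = (\<lambda>n. x n ^ 3 / real n powr ((1 - 10 * \<alpha>) / 6))
    in (\<lambda>n. measure M {\<omega> \<in> space M. t n \<omega> - E n < - x n * sqrt (V n)} / (1 - Phi (x n)) - 1)
          \<in> o(r)
     \<and> (\<lambda>n. measure M {\<omega> \<in> space M. t n \<omega> - E n > x n * sqrt (V n)} / (1 - Phi (x n)) - 1)
          \<in> o(r)"
proof -
  interpret two_weights a b
    using assms(1,2) by unfold_locales
  \<comment> \<open>Forced by \<open>k n \<ge> 1\<close>: for nonpositive exponents the ratio of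
    \<open>k n\<close> to \<open>n powr \<alpha>\<close> stays at least 1.\<close>
  have "0 < \<alpha>"
  proof (rule ccontr)
    assume "\<not> 0 < \<alpha>"
    have "eventually (\<lambda>n. real (k n) / real n powr \<alpha> < 1) sequentially"
      using assms(5) by (rule order_tendstoD) simp
    then have "eventually (\<lambda>n::nat. False) sequentially"
      using eventually_gt_at_top[of 0]
    proof eventually_elim
      case (elim n)
      have "real n powr \<alpha> \<le> real n powr 0"
        using elim \<open>\<not> 0 < \<alpha>\<close> by (intro powr_mono) auto
      also have "\<dots> \<le> real (k n)"
        using elim assms(4)[of n] by simp
      finally show ?case
        using elim by (simp add: field_simps)
    qed
    then show False by simp
  qed
  define M where "M = weight_space a b"
  define E where "E = (\<lambda>n. integral\<^sup>L M (crossing_time n (k n)))"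
  define V where "V = (\<lambda>n. integral\<^sup>L M (\<lambda>\<omega>. (crossing_time n (k n) \<omega> - E n)\<^sup>2))"
  define r where "r = (\<lambda>n. x n ^ 3 / real n powr ((1 - 10 * \<alpha>) / 6))"
  define P where "P = (\<lambda>s n. measure M {\<omega> \<in> space M. x n * sqrt (V n) < s * (crossing_time n (k n) \<omega> - E n)})"
  obtain C where C: "eventually (\<lambda>n. \<forall>s\<in>{1, -1}. \<bar>P s n / (1 - Phi (x n)) - 1\<bar>
       \<le> C * (real n powr (- 1 / 6 + 3 * \<alpha> / 2) * x n ^ 3)) sequentially"
    using relative_error_eventually[OF \<open>0 < \<alpha>\<close> assms(3-7)]
    unfolding P_def V_def E_def M_def by blast
  have small: "(\<lambda>n. P s n / (1 - Phi (x n)) - 1) \<in> o(r)" if s: "s \<in> {1, -1}" for s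
  proof (rule landau_o.smallI)
    fix c :: real assume "0 < c"
    \<comment> \<open>The surplus over the error claimed, which absorbs the constant
      \<open>C\<close> and yields the little-o.\<close>
    have "(\<lambda>n. \<bar>C\<bar> * real n powr (- \<alpha> / 6)) \<longlonglongrightarrow> \<bar>C\<bar> * 0"
      using \<open>0 < \<alpha>\<close> by (intro tendsto_mult tendsto_const) real_asymp
    then have "eventually (\<lambda>n. \<bar>C\<bar> * real n powr (- \<alpha> / 6) < c) sequentially"
      by (rule order_tendstoD) (use \<open>0 < c\<close> in simp)
    moreover have "eventually (\<lambda>n. 2 \<le> x n) sequentially"
      using assms(6) by (simp add: filterlim_at_top)
    ultimately show "eventually (\<lambda>n. norm (P s n / (1 - Phi (x n)) - 1) \<le> c * norm (r n)) sequentially"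
      using C eventually_gt_at_top[of 0]
    proof eventually_elim
      case (elim n)
      have r0: "0 \<le> r n"
        using elim by (simp add: r_def)
      have "real n powr (- 1 / 6 + 3 * \<alpha> / 2) * x n ^ 3 = real n powr (- \<alpha> / 6) * r n"
      proof -
        have "real n powr (- 1 / 6 + 3 * \<alpha> / 2) = real n powr (- \<alpha> / 6) / real n powr ((1 - 10 * \<alpha>) / 6)"
          unfolding powr_diff[symmetric] by (rule arg_cong[where f = "\<lambda>z. real n powr z"]) (simp add: field_simps)
        then show ?thesis
          by (simp add: r_def)
      qed
      then have "\<bar>P s n / (1 - Phi (x n)) - 1\<bar> \<le> C * (real n powr (- \<alpha> / 6) * r n)"
        using elim(3) s by auto
      also have "\<dots> \<le> \<bar>C\<bar> * (real n powr (- \<alpha> / 6) * r n)"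
        using r0 by (intro mult_right_mono) auto
      also have "\<dots> = (\<bar>C\<bar> * real n powr (- \<alpha> / 6)) * r n"
        by simp
      also have "\<dots> \<le> c * r n"
        using elim r0 by (intro mult_right_mono) auto
      finally show ?case
        using r0 by simp
    qed
  qed
  have upper: "P 1 = (\<lambda>n. measure M {\<omega> \<in> space M. crossing_time n (k n) \<omega> - E n > x n * sqrt (V n)})"
    by (simp add: P_def)
  have lower: "P (-1) = (\<lambda>n. measure M {\<omega> \<in> space M. crossing_time n (k n) \<omega> - E n < - x n * sqrt (V n)})"
    unfolding P_def by (intro ext arg_cong[where f = "measure M"]) auto
  show ?thesis
    using small[of 1] small[of "-1"]
    unfolding Let_def upper lower r_def V_def E_def M_def by simp
qed

end
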